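(* Let $k$ be a field of characteristic different from $3$ and $a,d\in k$ such that the twisted Hessian curve $E:aX^3+Y^3+Z^3=dXYZ$ in $\mathbb{P}^2$ is nonsingular, with identity $O=(0:-1:1)$, and let $T=X+Y+Z$. The maps $\varphi_X=(X:X-T)$, $\varphi_Y=(Y:Y-T)$, $\varphi_Z=(Z:Z-T)$ are degree-$2$ morphisms $E\to\mathbb{P}^1$. Writing $P=(X_1:Y_1:Z_1)$, $Q=(X_2:Y_2:Z_2)$, the pairs $$\begin{aligned}&(X_1Y_2Z_2+Y_1X_2Y_2+Z_1X_2Z_2:\ X_1X_2^2+Y_1Z_2^2+Z_1Y_2^2),\\ &(X_1X_2Z_2+Y_1Y_2Z_2+Z_1X_2Y_2:\ X_1Y_2^2+Y_1X_2^2+Z_1Z_2^2),\\ &(X_1X_2Y_2+Y_1X_2Z_2+Z_1Y_2Z_2:\ X_1Z_2^2+Z_1X_2^2+Y_1Y_2^2)\end{aligned}$$ are addition law projections of bidegree $(1,2)$ for $\varphi_X\circ\mu$, $\varphi_Y\circ\mu$, $\varphi_Z\circ\mu$ respectively, and the pairs $$\begin{aligned}&(Y_1Z_1X_2+X_1Y_1Y_2+X_1Z_1Z_2:\ X_1^2X_2+Z_1^2Y_2+Y_1^2Z_2),\\ &(X_1Z_1X_2+Y_1Z_1Y_2+X_1Y_1Z_2:\ Y_1^2X_2+X_1^2Y_2+Z_1^2Z_2),\\ &(X_1Y_1X_2+X_1Z_1Y_2+Y_1Z_1Z_2:\ Z_1^2X_2+Y_1^2Y_2+X_1^2Z_2)\end{aligned}$$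 are addition law projections of bidegree $(2,1)$ for $\varphi_X\circ\mu$, $\varphi_Y\circ\mu$, $\varphi_Z\circ\mu$ respectively. Each of these spans the space of addition law projections of its bidegree for its projection, and that space is one-dimensional.
   Context: $\mu:E\times E\to E$ is the group law. For a morphism $\varphi:E\to\mathbb{P}^1$, an addition law projection of bidegree $(m,n)$ for $\varphi\circ\mu$ is a pair $(p_0:p_1)$ of polynomials in $(X_1,Y_1,Z_1),(X_2,Y_2,Z_2)$, bihomogeneous of bidegree $(m,n)$, considered modulo the bihomogeneous ideal of $E\times E$ and not both zero modulo it, such that $(p_0(P,Q):p_1(P,Q))=\varphi(P+Q)$ whenever $p_0(P,Q),p_1(P,Q)$ are not both zero; together with $0$ these form a $k$-vector space.
   Formalization: Proved only for a = 1. For every a ≠ 1 the claim is false: Y and Y−T have no common zero on E, so φ_Y has degree 3, and the pairs fail, e.g. with c³=a, P=Q=(1:−c:0) the first pair gives (c²:1) but φ_X(P+Q)=(1:c). *)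

theory Defs
  imports
    "HOL-Analysis.Analysis"
    "HOL-Algebra.Algebraic_Closure_Type"
    "HOL-Library.Poly_Mapping"
begin

section \<open>Projective space over a field\<close>

definition proj_rel :: "('k::field) ^ ('n::finite) \<Rightarrow> 'k ^ 'n \<Rightarrow> bool" where
  "proj_rel u v \<longleftrightarrow> u \<noteq> 0 \<and> v \<noteq> 0 \<and> (\<exists>c. c \<noteq> 0 \<and> (\<forall>i. v$i = c * u$i))"

lemma part_equivp_proj_rel: "part_equivp (proj_rel :: ('k::field) ^ ('n::finite) \<Rightarrow> _)"
proof (rule part_equivpI)
  have "(1 :: 'k ^ 'n) \<noteq> 0" by (simp add: vec_eq_iff)
  then have "proj_rel (1 :: 'k ^ 'n) 1"
    unfolding proj_rel_def by (intro conjI exI[of _ 1]) auto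
  then show "\<exists>x :: 'k ^ 'n. proj_rel x x" by blast
  show "symp (proj_rel :: 'k ^ 'n \<Rightarrow> _)"
  proof (rule sympI)
    fix u v :: "'k ^ 'n" assume "proj_rel u v"
    then obtain c where "u \<noteq> 0" "v \<noteq> 0" "c \<noteq> 0" "\<forall>i. v$i = c * u$i"
      unfolding proj_rel_def by blast
    then show "proj_rel v u"
      unfolding proj_rel_def by (intro conjI exI[of _ "inverse c"]) auto
  qed
  show "transp (proj_rel :: 'k ^ 'n \<Rightarrow> _)"
  proof (rule transpI)
    fix u v w :: "'k ^ 'n" assume "proj_rel u v" "proj_rel v w"
    then obtain c e where "u \<noteq> 0" "w \<noteq> 0" "c \<noteq> 0" "\<forall>i. v$i = c * u$i"
        "e \<noteq> 0" "\<forall>i. w$i = e * v$i"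
      unfolding proj_rel_def by blast
    then show "proj_rel u w"
      unfolding proj_rel_def by (intro conjI exI[of _ "e * c"]) auto
  qed
qed

text \<open>\<open>pt x\<close> is the point with homogeneous coordinate vector \<open>x\<close>; it is only meaningful for
  \<open>x \<noteq> 0\<close>.\<close>

quotient_type (overloaded) ('k, 'n) proj = "('k::field) ^ ('n::finite)" / partial: proj_rel
  morphisms coords_of pt
  by (rule part_equivp_proj_rel)

text \<open>Varieties over the field \<open>'a\<close> are described by their geometric points, i.e. points over the
  algebraic closure; all polynomials have coefficients in \<open>'a\<close>.\<close>

type_synonym 'a plane = "('a alg_closure, 3) proj"
type_synonym 'a line = "('a alg_closure, 2) proj"


section \<open>Polynomials\<close>

type_synonym ('v, 'a) mpoly = "('v \<Rightarrow>\<^sub>0 nat) \<Rightarrow>\<^sub>0 'a"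

text \<open>Polynomials in \<open>(X\<^sub>1, Y\<^sub>1, Z\<^sub>1), (X\<^sub>2, Y\<^sub>2, Z\<^sub>2)\<close>: the left summand indexes the
  first group of variables.\<close>

type_synonym 'a bipoly = "(3 + 3, 'a) mpoly"

definition Const :: "'a::field \<Rightarrow> ('v, 'a) mpoly" where
  "Const c = Poly_Mapping.single 0 c"

definition Var :: "'v \<Rightarrow> ('v, 'a::field) mpoly" where
  "Var v = Poly_Mapping.single (Poly_Mapping.single v 1) 1"

definition peval :: "('v::finite, 'a::field) mpoly \<Rightarrow> ('v \<Rightarrow> 'a alg_closure) \<Rightarrow> 'a alg_closure" where
  "peval p x = (\<Sum>m\<in>Poly_Mapping.keys p.
     to_ac (Poly_Mapping.lookup p m) * (\<Prod>v\<in>UNIV. x v ^ Poly_Mapping.lookup m v))"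

definition form :: "nat \<Rightarrow> ('v::finite, 'a::field) mpoly \<Rightarrow> bool" where
  "form n p \<longleftrightarrow> (\<forall>m\<in>Poly_Mapping.keys p. (\<Sum>v\<in>UNIV. Poly_Mapping.lookup m v) = n)"

definition biform :: "nat \<Rightarrow> nat \<Rightarrow> ('a::field) bipoly \<Rightarrow> bool" where
  "biform m n p \<longleftrightarrow> (\<forall>e\<in>Poly_Mapping.keys p.
     (\<Sum>i\<in>UNIV. Poly_Mapping.lookup e (Inl i)) = m \<and>
     (\<Sum>i\<in>UNIV. Poly_Mapping.lookup e (Inr i)) = n)"

definition bieval :: "('a::field) bipoly \<Rightarrow> 'a alg_closure ^ 3 \<Rightarrow> 'a alg_closure ^ 3 \<Rightarrow> 'a alg_closure"
  where "bieval p x y = peval p (case_sum (($) x) (($) y))"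


section \<open>The curve and its group law\<close>

definition hessian_eq :: "'a::field \<Rightarrow> 'a \<Rightarrow> 'a alg_closure ^ 3 \<Rightarrow> 'a alg_closure" where
  "hessian_eq a d x = to_ac a * x$1 ^ 3 + x$2 ^ 3 + x$3 ^ 3 - to_ac d * x$1 * x$2 * x$3"

definition hessian :: "'a::field \<Rightarrow> 'a \<Rightarrow> 'a plane set" where
  "hessian a d = {pt x | x. x \<noteq> 0 \<and> hessian_eq a d x = 0}"

text \<open>The three expressions are the partial derivatives of the defining equation.\<close>

definition nonsingular_hessian :: "'a::field \<Rightarrow> 'a \<Rightarrow> bool" where
  "nonsingular_hessian a d \<longleftrightarrow> (\<forall>x. x \<noteq> 0 \<and> hessian_eq a d x = 0 \<longrightarrow>
     \<not> (3 * to_ac a * x$1 ^ 2 - to_ac d * x$2 * x$3 = 0 \<and>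
        3 * x$2 ^ 2 - to_ac d * x$1 * x$3 = 0 \<and>
        3 * x$3 ^ 2 - to_ac d * x$1 * x$2 = 0))"

definition hessian_O :: "'a::field plane" where
  "hessian_O = pt (vector [0, -1, 1])"

definition vec_comb :: "'k::field \<Rightarrow> 'k ^ 3 \<Rightarrow> 'k \<Rightarrow> 'k ^ 3 \<Rightarrow> 'k ^ 3" where
  "vec_comb s u t v = (\<chi> i. s * u$i + t * v$i)"

text \<open>\<open>line_section a d P Q R\<close>: some line of the plane cuts the cubic in the divisor \<open>P + Q + R\<close>.
  The line is parametrised by \<open>(s : t) \<mapsto> s u + t v\<close>; the closed field being infinite, the equation
  for all \<open>s, t\<close> says that the restricted cubic form is, up to a nonzero constant, the product
  of the three linear forms vanishing at the parameters \<open>p, q, r\<close> of the three points.\<close>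

definition line_section :: "'a::field \<Rightarrow> 'a \<Rightarrow> 'a plane \<Rightarrow> 'a plane \<Rightarrow> 'a plane \<Rightarrow> bool" where
  "line_section a d P Q R \<longleftrightarrow>
     (\<exists>u v (p :: 'a alg_closure ^ 2) (q :: 'a alg_closure ^ 2) (r :: 'a alg_closure ^ 2) \<kappa>.
        (\<forall>s t. vec_comb s u t v = 0 \<longrightarrow> s = 0 \<and> t = 0) \<and>
        p \<noteq> 0 \<and> q \<noteq> 0 \<and> r \<noteq> 0 \<and> \<kappa> \<noteq> 0 \<and>
        P = pt (vec_comb (p$1) u (p$2) v) \<and>
        Q = pt (vec_comb (q$1) u (q$2) v) \<and>
        R = pt (vec_comb (r$1) u (r$2) v) \<and>
        (\<forall>s t. hessian_eq a d (vec_comb s u t v) =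
           \<kappa> * (s * p$2 - t * p$1) * (s * q$2 - t * q$1) * (s * r$2 - t * r$1)))"

text \<open>The chord-tangent law; \<open>hessian_O\<close> is a flex of the curve.\<close>

definition third_point :: "'a::field \<Rightarrow> 'a \<Rightarrow> 'a plane \<Rightarrow> 'a plane \<Rightarrow> 'a plane" where
  "third_point a d P Q = (THE R. line_section a d P Q R)"

definition hessian_add :: "'a::field \<Rightarrow> 'a \<Rightarrow> 'a plane \<Rightarrow> 'a plane \<Rightarrow> 'a plane" where
  "hessian_add a d P Q = third_point a d (third_point a d P Q) hessian_O"


section \<open>Morphisms from a plane curve to the projective line\<close>

definition morphism :: "'a::field plane set \<Rightarrow> ('a plane \<Rightarrow> 'a line) \<Rightarrow> bool" where
  "morphism C \<phi> \<longleftrightarrow> (\<forall>x. x \<noteq> 0 \<and> pt x \<in> C \<longrightarrow>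
     (\<exists>n (f :: (3, 'a) mpoly) g. form n f \<and> form n g \<and>
        (peval f (($) x) \<noteq> 0 \<or> peval g (($) x) \<noteq> 0) \<and>
        (\<forall>y. y \<noteq> 0 \<and> pt y \<in> C \<and> (peval f (($) y) \<noteq> 0 \<or> peval g (($) y) \<noteq> 0) \<longrightarrow>
           \<phi> (pt y) = pt (vector [peval f (($) y), peval g (($) y)]))))"

text \<open>\<open>\<phi> = (f : g)\<close> where \<open>f\<close> and \<open>g\<close> do not both vanish. On an irreducible curve and for
  \<open>f, g\<close> not both zero on it, this determines a morphism \<open>\<phi>\<close> uniquely on the curve.\<close>

definition given_by ::
    "'a::field plane set \<Rightarrow> ('a plane \<Rightarrow> 'a line) \<Rightarrow> (3, 'a) mpoly \<Rightarrow> (3, 'a) mpoly \<Rightarrow> bool" where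
  "given_by C \<phi> f g \<longleftrightarrow>
     (\<forall>x. x \<noteq> 0 \<and> pt x \<in> C \<and> (peval f (($) x) \<noteq> 0 \<or> peval g (($) x) \<noteq> 0) \<longrightarrow>
        \<phi> (pt x) = pt (vector [peval f (($) x), peval g (($) x)]))"

text \<open>The function field of an irreducible curve \<open>C\<close>: quotients \<open>f / g\<close> of forms of the same degree
  with \<open>g\<close> not vanishing identically on \<open>C\<close>. The value at zeros of \<open>g\<close> is left
  open, and two such functions are the same element of the function field iff they agree at
  all but finitely many points (\<open>fun_eq\<close>).\<close>

definition function_field :: "'a::field plane set \<Rightarrow> ('a plane \<Rightarrow> 'a alg_closure) set" where
  "function_field C = {h. \<exists>n (f :: (3, 'a) mpoly) g. form n f \<and> form n g \<and>
     (\<exists>x. x \<noteq> 0 \<and> pt x \<in> C \<and> peval g (($) x) \<noteq> 0) \<and>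
     (\<forall>x. x \<noteq> 0 \<and> pt x \<in> C \<and> peval g (($) x) \<noteq> 0 \<longrightarrow>
        h (pt x) = peval f (($) x) / peval g (($) x))}"

definition fun_eq ::
    "'a::field plane set \<Rightarrow> ('a plane \<Rightarrow> 'a alg_closure) \<Rightarrow> ('a plane \<Rightarrow> 'a alg_closure) \<Rightarrow> bool" where
  "fun_eq C h h' \<longleftrightarrow> finite {P \<in> C. h P \<noteq> h' P}"

text \<open>The subfield \<open>\<phi>\<^sup>* k(\<P>\<^sup>1)\<close> of the function field.\<close>

definition pullback_field ::
    "'a::field plane set \<Rightarrow> ('a plane \<Rightarrow> 'a line) \<Rightarrow> ('a plane \<Rightarrow> 'a alg_closure) set" where
  "pullback_field C \<phi> = {h. \<exists>n (f :: (2, 'a) mpoly) g. form n f \<and> form n g \<and>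
     (\<exists>P y. P \<in> C \<and> y \<noteq> 0 \<and> \<phi> P = pt y \<and> peval g (($) y) \<noteq> 0) \<and>
     (\<forall>P y. P \<in> C \<and> y \<noteq> 0 \<and> \<phi> P = pt y \<and> peval g (($) y) \<noteq> 0 \<longrightarrow>
        h P = peval f (($) y) / peval g (($) y))}"

text \<open>\<open>[k(C) : \<phi>\<^sup>* k(\<P>\<^sup>1)] = r\<close>: there is a basis \<open>b 0, \<dots>, b (r - 1)\<close>.\<close>

definition morphism_degree :: "'a::field plane set \<Rightarrow> ('a plane \<Rightarrow> 'a line) \<Rightarrow> nat \<Rightarrow> bool" where
  "morphism_degree C \<phi> r \<longleftrightarrow> (\<exists>b. (\<forall>i<r. b i \<in> function_field C) \<and>
     (\<forall>h\<in>function_field C. \<exists>c. (\<forall>i<r. c i \<in> pullback_field C \<phi>) \<and>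
        fun_eq C h (\<lambda>P. \<Sum>i<r. c i P * b i P)) \<and>
     (\<forall>c. (\<forall>i<r. c i \<in> pullback_field C \<phi>) \<and> fun_eq C (\<lambda>P. \<Sum>i<r. c i P * b i P) (\<lambda>_. 0) \<longrightarrow>
        (\<forall>i<r. fun_eq C (c i) (\<lambda>_. 0))))"


section \<open>Addition law projections\<close>

text \<open>Membership of a bihomogeneous polynomial in the bihomogeneous ideal of \<open>C \<times> C\<close>.\<close>

definition in_ideal :: "'a::field plane set \<Rightarrow> 'a bipoly \<Rightarrow> bool" where
  "in_ideal C p \<longleftrightarrow>
     (\<forall>x y. x \<noteq> 0 \<and> y \<noteq> 0 \<and> pt x \<in> C \<and> pt y \<in> C \<longrightarrow> bieval p x y = 0)"

definition null_pairs :: "'a::field plane set \<Rightarrow> nat \<Rightarrow> nat \<Rightarrow> ('a bipoly \<times> 'a bipoly) set" where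
  "null_pairs C m n = {(p0, p1). biform m n p0 \<and> biform m n p1 \<and> in_ideal C p0 \<and> in_ideal C p1}"

definition addition_law_projections ::
    "'a::field plane set \<Rightarrow> ('a plane \<Rightarrow> 'a plane \<Rightarrow> 'a plane) \<Rightarrow> ('a plane \<Rightarrow> 'a line) \<Rightarrow>
     nat \<Rightarrow> nat \<Rightarrow> ('a bipoly \<times> 'a bipoly) set" where
  "addition_law_projections C \<mu> \<phi> m n = {(p0, p1). biform m n p0 \<and> biform m n p1 \<and>
     \<not> (in_ideal C p0 \<and> in_ideal C p1) \<and>
     (\<forall>x y. x \<noteq> 0 \<and> y \<noteq> 0 \<and> pt x \<in> C \<and> pt y \<in> C \<and>
        (bieval p0 x y \<noteq> 0 \<or> bieval p1 x y \<noteq> 0) \<longrightarrow>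
        pt (vector [bieval p0 x y, bieval p1 x y]) = \<phi> (\<mu> (pt x) (pt y)))}"

text \<open>The vector space of addition law projections is the following set modulo \<open>null_pairs\<close>; the
  notions of span, basis and dimension below are those of this quotient.\<close>

definition alp_space ::
    "'a::field plane set \<Rightarrow> ('a plane \<Rightarrow> 'a plane \<Rightarrow> 'a plane) \<Rightarrow> ('a plane \<Rightarrow> 'a line) \<Rightarrow>
     nat \<Rightarrow> nat \<Rightarrow> ('a bipoly \<times> 'a bipoly) set" where
  "alp_space C \<mu> \<phi> m n = addition_law_projections C \<mu> \<phi> m n \<union> null_pairs C m n"

definition lin_comb ::
    "('a bipoly \<times> 'a bipoly) set \<Rightarrow> ('a bipoly \<times> 'a bipoly \<Rightarrow> 'a) \<Rightarrow> ('a::field) bipoly \<times> 'a bipoly" where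
  "lin_comb B c = (\<Sum>p\<in>B. (Const (c p) * fst p, Const (c p) * snd p))"

definition alp_spanned_by ::
    "'a::field plane set \<Rightarrow> ('a plane \<Rightarrow> 'a plane \<Rightarrow> 'a plane) \<Rightarrow> ('a plane \<Rightarrow> 'a line) \<Rightarrow>
     nat \<Rightarrow> nat \<Rightarrow> ('a bipoly \<times> 'a bipoly) set \<Rightarrow> bool" where
  "alp_spanned_by C \<mu> \<phi> m n B \<longleftrightarrow> finite B \<and>
     alp_space C \<mu> \<phi> m n = {q. \<exists>c. q - lin_comb B c \<in> null_pairs C m n}"

definition alp_dim ::
    "'a::field plane set \<Rightarrow> ('a plane \<Rightarrow> 'a plane \<Rightarrow> 'a plane) \<Rightarrow> ('a plane \<Rightarrow> 'a line) \<Rightarrow>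
     nat \<Rightarrow> nat \<Rightarrow> nat \<Rightarrow> bool" where
  "alp_dim C \<mu> \<phi> m n r \<longleftrightarrow> (\<exists>B. alp_spanned_by C \<mu> \<phi> m n B \<and> B \<subseteq> alp_space C \<mu> \<phi> m n \<and>
     (\<forall>c. lin_comb B c \<in> null_pairs C m n \<longrightarrow> (\<forall>p\<in>B. c p = 0)) \<and> card B = r)"


section \<open>Coordinates\<close>

abbreviation X0 :: "(3, 'a::field) mpoly" where "X0 \<equiv> Var 1"
abbreviation Y0 :: "(3, 'a::field) mpoly" where "Y0 \<equiv> Var 2"
abbreviation Z0 :: "(3, 'a::field) mpoly" where "Z0 \<equiv> Var 3"
abbreviation T0 :: "(3, 'a::field) mpoly" where "T0 \<equiv> X0 + Y0 + Z0"

text \<open>The forms \<open>Y\<close> and \<open>Y - T = -(X + Z)\<close> have a common zero on \<open>a X\<^sup>3 + Y\<^sup>3 + Z\<^sup>3 = d X Y Z\<close> only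
  if \<open>a = 1\<close>; for \<open>a \<noteq> 1\<close> the morphism \<open>(Y : Y - T)\<close> has degree 3, and so has \<open>(Z : Z - T)\<close>.\<close>

abbreviation X1 :: "'a::field bipoly" where "X1 \<equiv> Var (Inl 1)"
abbreviation Y1 :: "'a::field bipoly" where "Y1 \<equiv> Var (Inl 2)"
abbreviation Z1 :: "'a::field bipoly" where "Z1 \<equiv> Var (Inl 3)"
abbreviation X2 :: "'a::field bipoly" where "X2 \<equiv> Var (Inr 1)"
abbreviation Y2 :: "'a::field bipoly" where "Y2 \<equiv> Var (Inr 2)"
abbreviation Z2 :: "'a::field bipoly" where "Z2 \<equiv> Var (Inr 3)"

end

theory Submission
  imports Defs
begin

text \<open>
  The chord through distinct points \<open>x, y\<close> of the cubic \<open>F = 0\<close> meets it again in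
  \<open>R = (\<nabla>F(y) \<cdot> x) x - (\<nabla>F(x) \<cdot> y) y\<close>, the tangent at \<open>x\<close> in
  \<open>(X (Y\<^sup>3 - Z\<^sup>3) : Y (Z\<^sup>3 - X\<^sup>3) : Z (X\<^sup>3 - Y\<^sup>3))\<close>, and \<open>P + Q\<close> is \<open>R\<close> with two
  coordinates swapped. Hence the addition laws are polynomial identities modulo the equation of the
  curve, except where the sum is the base point of the projection; there \<open>Q\<close> is \<open>P\<close> with two
  coordinates swapped, and both sides are \<open>(3 : d)\<close>.

  For uniqueness, two projections \<open>q, p\<close> satisfy \<open>q\<^sub>0 p\<^sub>1 = q\<^sub>1 p\<^sub>0\<close> on \<open>E \<times> E\<close>. As a conic in the
  linear argument this vanishes identically, so the coefficients of \<open>q\<close> are proportional to those of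
  \<open>p\<close> at each point of the other factor. The coefficients of \<open>p\<^sub>1\<close> are \<open>X\<^sup>2, Y\<^sup>2, Z\<^sup>2\<close>, which forces the
  factor to be constant.

  The projections have degree 2 because with \<open>u = X / (Y + Z)\<close> and \<open>e = Y / (Y + Z)\<close> the curve
  becomes \<open>e\<^sup>2 - e + (1 + u\<^sup>3) / (d u + 3) = 0\<close>, so that \<open>1, e\<close> is a basis over \<open>k(u)\<close>.
\<close>

unbundle no Formal_Power_Series.fps_syntax

section \<open>Polynomials and projective points\<close>

text \<open>The hypothesis \<open>a = 1\<close> makes the cubic invariant under rotation of the
  coordinates, so calculations are done for one index \<open>i\<close> and its successors.
  Nonsingularity enters as \<open>d^3 \<noteq> 27\<close>, which excludes lines on the cubic, zero
  gradients and a zero tangential vector. Since \<open>third_point\<close> is a definite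
  description, the group law can be computed only after existence and uniqueness of the third point
  are known. The delicate case is a point equal to its own tangential: there a second point of the
  tangent has to be supplied. The uniqueness proof and the degree proof share one fact: modulo the
  cubic every polynomial is \<open>r0 + r1 Z + r2 Z^2\<close>, and it vanishes off finitely many
  points only if \<open>r0\<close>, \<open>r1\<close>, \<open>r2\<close> vanish. It takes the place
  of irreducibility of the curve.\<close>

lemma lookup_keys_sum_superset:
  assumes "finite A" "Poly_Mapping.keys p \<subseteq> A" "\<And>m. f m 0 = 0"
  shows "(\<Sum>m\<in>Poly_Mapping.keys p. f m (Poly_Mapping.lookup p m)) =
    (\<Sum>m\<in>A. f m (Poly_Mapping.lookup p m))"
  using assms by (intro sum.mono_neutral_left) (auto simp: in_keys_iff)

lemma peval_add: "peval (p + q) x = peval p x + peval q x"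
proof -
  let ?A = "Poly_Mapping.keys p \<union> Poly_Mapping.keys q"
  let ?f = "\<lambda>m c. to_ac c * (\<Prod>v\<in>UNIV. x v ^ Poly_Mapping.lookup m v)"
  have *: "peval r x = (\<Sum>m\<in>?A. ?f m (Poly_Mapping.lookup r m))"
    if "Poly_Mapping.keys r \<subseteq> ?A" for r
    unfolding peval_def using that by (intro lookup_keys_sum_superset) auto
  have "Poly_Mapping.keys (p + q) \<subseteq> ?A"
    by (rule keys_add)
  then show ?thesis
    by (simp add: * lookup_add distrib_right sum.distrib)
qed

lemma peval_zero [simp]: "peval 0 x = 0"
  by (simp add: peval_def)

lemma peval_single:
  "peval (Poly_Mapping.single m c) x = to_ac c * (\<Prod>v\<in>UNIV. x v ^ Poly_Mapping.lookup m v)"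
  by (cases "c = 0") (simp_all add: peval_def)

lemma peval_uminus: "peval (- p) x = - peval p x"
  using peval_add[of p "- p" x] by (simp add: eq_neg_iff_add_eq_0 add.commute)

lemma peval_diff: "peval (p - q) x = peval p x - peval q x"
  using peval_add[of p "- q" x] by (simp add: peval_uminus)

lemma mpoly_induct [case_names single add]:
  assumes "\<And>m c. P (Poly_Mapping.single m c)"
    and "\<And>p q. P p \<Longrightarrow> P q \<Longrightarrow> P (p + q)"
  shows "P (p :: ('v, 'a::field) mpoly)"
proof (induction p rule: update_induct)
  case const
  show ?case using assms(1)[of 0 0] by simp
next
  case (update f k c)
  have "Poly_Mapping.update k c f = f + Poly_Mapping.single k c"
    using update.hyps
    by (intro poly_mapping_eqI) (auto simp: lookup_update lookup_add lookup_single when_def in_keys_iff)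
  then show ?case using assms update.IH by simp
qed

lemma peval_mult: "peval (p * q) x = peval p x * peval q x"
proof (induction p rule: mpoly_induct)
  case (single m c)
  show ?case
  proof (induction q rule: mpoly_induct)
    case (single m' c')
    show ?case
      by (simp add: mult_single peval_single lookup_add power_add prod.distrib)
  qed (simp add: distrib_left peval_add)
qed (simp add: distrib_right peval_add)

lemma peval_Const: "peval (Const c) x = to_ac c"
  by (simp add: Const_def peval_single)

lemma peval_one: "peval 1 x = 1"
  using peval_Const[of 1 x] by (simp add: Const_def)

lemma peval_Var: "peval (Var v) x = x v"
proof -
  have "(\<Prod>w\<in>UNIV. x w ^ Poly_Mapping.lookup (Poly_Mapping.single v 1) w) =
      (\<Prod>w\<in>UNIV. if w = v then x w else 1)"
    by (intro prod.cong) (auto simp: lookup_single when_def)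
  then show ?thesis
    by (simp add: Var_def peval_single)
qed

lemma peval_power: "peval (p ^ n) x = peval p x ^ n"
  by (induction n) (simp_all add: peval_one peval_mult)

lemma peval_sum: "peval (sum f A) x = (\<Sum>a\<in>A. peval (f a) x)"
  by (induction A rule: infinite_finite_induct) (simp_all add: peval_add)

lemmas peval_simps =
  peval_add peval_diff peval_uminus peval_mult peval_power peval_Const peval_one peval_Var peval_sum

text \<open>The normal forms of polynomials on the curve come from this induction: functions of a
  given shape need only be stable under sums and products.\<close>

lemma peval_closure:
  fixes p :: "('v::finite, 'a::field) mpoly"
  assumes const: "\<And>c. S (\<lambda>x. to_ac c)"
    and var: "\<And>v. S (\<lambda>x. x v)"
    and add: "\<And>f g. S f \<Longrightarrow> S g \<Longrightarrow> S (\<lambda>x. f x + g x)"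
    and mult: "\<And>f g. S f \<Longrightarrow> S g \<Longrightarrow> S (\<lambda>x. f x * g x)"
  shows "S (peval p)"
proof (induction p rule: mpoly_induct)
  case (single m c)
  have pow: "S (\<lambda>x. x v ^ n)" for v n
  proof (induction n)
    case 0
    show ?case using const[of 1] by simp
  qed (use var mult in simp)
  have "S (\<lambda>x. \<Prod>v\<in>A. x v ^ Poly_Mapping.lookup m v)" if "finite A" for A
    using that
  proof (induction A)
    case empty
    show ?case using const[of 1] by simp
  qed (use pow mult in simp)
  then have "S (\<lambda>x. to_ac c * (\<Prod>v\<in>UNIV. x v ^ Poly_Mapping.lookup m v))"
    by (intro mult const) simp
  then show ?case
    by (simp add: peval_single[abs_def])
next
  case (add p q)
  then show ?case
    using assms(3)[of "peval p" "peval q"] by (simp add: peval_add[abs_def])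
qed

section \<open>Homogeneity and bihomogeneity\<close>

lemma peval_form_scale:
  assumes "form n p"
  shows "peval p (\<lambda>v. c * x v) = c ^ n * peval p x"
  unfolding peval_def sum_distrib_left
proof (intro sum.cong refl)
  fix m assume "m \<in> Poly_Mapping.keys p"
  with assms have "(\<Sum>v\<in>UNIV. Poly_Mapping.lookup m v) = n"
    by (auto simp: form_def)
  then show "to_ac (Poly_Mapping.lookup p m) * (\<Prod>v\<in>UNIV. (c * x v) ^ Poly_Mapping.lookup m v) =
      c ^ n * (to_ac (Poly_Mapping.lookup p m) * (\<Prod>v\<in>UNIV. x v ^ Poly_Mapping.lookup m v))"
    by (simp add: power_mult_distrib prod.distrib power_sum flip: power_sum)
qed

lemma form_add: "form n p \<Longrightarrow> form n q \<Longrightarrow> form n (p + q)"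
  unfolding form_def using keys_add[of p q] by blast

lemma keys_uminus_mpoly: "Poly_Mapping.keys (- p) = Poly_Mapping.keys (p :: ('v, 'a::field) mpoly)"
  by (auto simp: in_keys_iff)

lemma form_uminus: "form n p \<Longrightarrow> form n (- p)"
  by (simp add: form_def keys_uminus_mpoly)

lemma form_diff: "form n p \<Longrightarrow> form n q \<Longrightarrow> form n (p - q)"
  using form_add[of n p "- q"] form_uminus by auto

lemma form_mult: 
  assumes "form m p" "form n q"
  shows "form (m + n) (p * q)"
  unfolding form_def
proof
  fix e assume "e \<in> Poly_Mapping.keys (p * q)"
  then obtain a b where "e = a + b" "a \<in> Poly_Mapping.keys p" "b \<in> Poly_Mapping.keys q"
    using keys_mult[of p q] by blast
  then show "(\<Sum>v\<in>UNIV. Poly_Mapping.lookup e v) = m + n"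
    using assms by (simp add: form_def lookup_add sum.distrib)
qed

lemma form_Const: "form 0 (Const c)"
  by (auto simp: form_def Const_def)

lemma form_one: "form 0 1"
  using form_Const[of 1] by (simp add: Const_def)

lemma form_Var: "form 1 (Var v)"
  by (auto simp: form_def Var_def lookup_single when_def)

lemma form_power: "form m p \<Longrightarrow> form (k * m) (p ^ k)"
  by (induction k) (simp_all add: form_one form_mult)

lemma form_sum: "(\<And>a. a \<in> A \<Longrightarrow> form n (f a)) \<Longrightarrow> form n (sum f A)"
  by (induction A rule: infinite_finite_induct) (auto simp: form_add, simp_all add: form_def)

lemma biform_add: "biform m n p \<Longrightarrow> biform m n q \<Longrightarrow> biform m n (p + q)"
  unfolding biform_def using keys_add[of p q] by blast

lemma biform_uminus: "biform m n p \<Longrightarrow> biform m n (- p)"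
  by (simp add: biform_def keys_uminus_mpoly)

lemma biform_diff: "biform m n p \<Longrightarrow> biform m n q \<Longrightarrow> biform m n (p - q)"
  using biform_add[of m n p "- q"] biform_uminus by auto

lemma biform_mult:
  assumes "biform m n p" "biform m' n' q"
  shows "biform (m + m') (n + n') (p * q)"
  unfolding biform_def
proof
  fix e assume "e \<in> Poly_Mapping.keys (p * q)"
  then obtain a b where "e = a + b" "a \<in> Poly_Mapping.keys p" "b \<in> Poly_Mapping.keys q"
    using keys_mult[of p q] by blast
  then show "(\<Sum>i\<in>UNIV. Poly_Mapping.lookup e (Inl i)) = m + m' \<and>
      (\<Sum>i\<in>UNIV. Poly_Mapping.lookup e (Inr i)) = n + n'"
    using assms by (simp add: biform_def lookup_add sum.distrib)
qed

lemma biform_Const: "biform 0 0 (Const c)"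
  by (auto simp: biform_def Const_def)

lemma biform_Const_mult: "biform m n p \<Longrightarrow> biform m n (Const c * p)"
  using biform_mult[OF biform_Const] by fastforce

lemma biform_Inl: "biform 1 0 (Var (Inl i))"
  by (auto simp: biform_def Var_def lookup_single when_def)

lemma biform_Inr: "biform 0 1 (Var (Inr i))"
  by (auto simp: biform_def Var_def lookup_single when_def)

text \<open>Over a finite field, 1 plus the product of all \<open>z - c\<close> has positive degree
  and takes the value 1 everywhere.\<close>

lemma infinite_alg_closed: "infinite (UNIV :: 'k::alg_closed_field set)"
proof
  assume fin: "finite (UNIV :: 'k set)"
  define p where "p = (\<Prod>c\<in>UNIV. [:- c, 1::'k:]) + 1"
  have "Polynomial.degree (\<Prod>c\<in>UNIV. [:- c, 1::'k:]) = card (UNIV :: 'k set)"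
    by (subst degree_prod_eq_sum_degree) auto
  moreover have "card (UNIV :: 'k set) > 0"
    using fin by (simp add: card_gt_0_iff)
  ultimately have "Polynomial.degree p > 0"
    unfolding p_def by (subst degree_add_eq_left) auto
  then obtain z where "poly p z = 0"
    using alg_closed_imp_poly_has_root by blast
  moreover have "poly p z = 1"
    using fin by (simp add: p_def poly_prod prod_zero_iff)
  ultimately show False by simp
qed

lemma poly_eq_0_if_cofinite:
  fixes p :: "'k::alg_closed_field poly"
  assumes "finite S" "\<And>t. t \<notin> S \<Longrightarrow> poly p t = 0"
  shows "p = 0"
proof (rule ccontr)
  assume "p \<noteq> 0"
  then have "finite {t. poly p t = 0}" by (rule poly_roots_finite)
  moreover have "UNIV \<subseteq> S \<union> {t. poly p t = 0}" using assms by blast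
  ultimately show False
    using assms(1) infinite_alg_closed finite_subset by blast
qed

section \<open>Points given by coordinate vectors\<close>

lemma pt_eq_iff:
  assumes "u \<noteq> 0" "v \<noteq> 0"
  shows "pt u = pt v \<longleftrightarrow> (\<exists>c. c \<noteq> 0 \<and> (\<forall>i. v$i = c * u$i))"
proof -
  have refl: "proj_rel w w" if "w \<noteq> 0" for w :: "'a ^ 'b"
    using that by (auto simp: proj_rel_def intro!: exI[of _ 1])
  show ?thesis
    using Quotient3_rel[OF Quotient3_proj, of u v] refl assms by (auto simp: proj_rel_def)
qed

lemma pt_cases: obtains v where "v \<noteq> 0" "P = pt v"
proof -
  have "proj_rel (coords_of P) (coords_of P)" "P = pt (coords_of P)"
    using Quotient3_proj unfolding Quotient3_def by metis+
  then show ?thesis using that by (auto simp: proj_rel_def)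
qed

lemma coords_of: "coords_of P \<noteq> 0" "pt (coords_of P) = P"
proof -
  have "proj_rel (coords_of P) (coords_of P)" "pt (coords_of P) = P"
    using Quotient3_proj unfolding Quotient3_def by metis+
  then show "coords_of P \<noteq> 0" "pt (coords_of P) = P" by (auto simp: proj_rel_def)
qed

lemma coords_of_pt:
  assumes "v \<noteq> 0"
  obtains c where "c \<noteq> 0" "\<And>i. coords_of (pt v) $ i = c * v $ i"
  using pt_eq_iff[OF assms coords_of(1)[of "pt v"]] coords_of(2)[of "pt v"] by auto

lemma pt_scale: "c \<noteq> 0 \<Longrightarrow> u \<noteq> 0 \<Longrightarrow> (\<And>i. v$i = c * u$i) \<Longrightarrow> pt u = pt v"
  by (subst pt_eq_iff) (auto simp: vec_eq_iff)

lemma vector2_eq_0: "vector [a, b] = (0 :: 'k::field ^ 2) \<longleftrightarrow> a = 0 \<and> b = 0"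
  by (simp add: vec_eq_iff forall_2)

lemma pt_vector2_eq:
  assumes "a \<noteq> 0 \<or> b \<noteq> 0" "c \<noteq> 0 \<or> d \<noteq> (0::'k::field)"
  shows "pt (vector [a, b] :: 'k ^ 2) = pt (vector [c, d]) \<longleftrightarrow> a * d = b * c"
proof -
  have "(\<exists>k. k \<noteq> 0 \<and> c = k * a \<and> d = k * b) \<longleftrightarrow> a * d = b * c"
  proof
    assume *: "a * d = b * c"
    show "\<exists>k. k \<noteq> 0 \<and> c = k * a \<and> d = k * b"
    proof (cases "a = 0")
      case True
      then show ?thesis using assms * by (intro exI[of _ "d / b"]) (auto simp: field_simps)
    next
      case False
      then show ?thesis using assms * by (intro exI[of _ "c / a"]) (auto simp: field_simps)
    qed
  qed auto
  then show ?thesis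
    using assms by (subst pt_eq_iff) (auto simp: vector2_eq_0 forall_2)
qed

section \<open>Lines and the chord-tangent law\<close>

text \<open>Cyclic successor of an index. The cubic with \<open>a = 1\<close> is unchanged by
  rotating the coordinates, so a statement about \<open>i\<close>, \<open>nx i\<close>,
  \<open>nx (nx i)\<close> covers three cases at once.\<close>

definition nx :: "3 \<Rightarrow> 3" where
  "nx i = (if i = 1 then 2 else if i = 2 then 3 else 1)"

lemma nx_simps [simp]: "nx 1 = 2" "nx 2 = 3" "nx 3 = 1"
  by (simp_all add: nx_def)

lemma nx_nx_nx [simp]: "nx (nx (nx i)) = i"
  using exhaust_3[of i] by auto

lemma nx_neq [simp]: "nx i \<noteq> i" "i \<noteq> nx i" "nx (nx i) \<noteq> i" "i \<noteq> nx (nx i)"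
    "nx (nx i) \<noteq> nx i" "nx i \<noteq> nx (nx i)"
  using exhaust_3[of i] by auto

lemma exhaust_nx: "j = i \<or> j = nx i \<or> j = nx (nx i)"
  using exhaust_3[of i] exhaust_3[of j] by auto

lemma forall_nx: "(\<forall>j. P j) \<longleftrightarrow> P i \<and> P (nx i) \<and> P (nx (nx i))"
  by (metis exhaust_nx)

lemma vec_eq_0_nx: "(x :: 'k::zero ^ 3) = 0 \<longleftrightarrow> x$i = 0 \<and> x$(nx i) = 0 \<and> x$(nx (nx i)) = 0"
  unfolding vec_eq_iff using forall_nx[of "\<lambda>j. x$j = 0" i] by simp

lemma vec_comb_nth [simp]: "vec_comb s u t v $ i = s * u$i + t * v$i"
  by (simp add: vec_comb_def)

definition indep :: "'k::field ^ 3 \<Rightarrow> 'k ^ 3 \<Rightarrow> bool" where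
  "indep u v \<longleftrightarrow> (\<forall>s t. vec_comb s u t v = 0 \<longrightarrow> s = 0 \<and> t = 0)"

lemma indepD: "indep u v \<Longrightarrow> vec_comb s u t v = 0 \<Longrightarrow> s = 0 \<and> t = 0"
  by (auto simp: indep_def)

text \<open>If all these minors vanish and \<open>u$i \<noteq> 0\<close>, the relation with
  coefficients \<open>v$i\<close> and \<open>- u$i\<close> contradicts independence.\<close>

lemma indep_minor:
  assumes "indep u v"
  obtains i where "u$i * v$(nx i) - u$(nx i) * v$i \<noteq> 0"
proof -
  have False if *: "\<forall>i. u$i * v$(nx i) - u$(nx i) * v$i = 0"
  proof (cases "u = 0")
    case True
    then have "vec_comb 1 u 0 v = 0" by (simp add: vec_eq_iff)
    with assms show False unfolding indep_def by (metis zero_neq_one)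
  next
    case False
    then obtain i where i: "u$i \<noteq> 0" by (auto simp: vec_eq_iff)
    have "vec_comb (v$i) u (- u$i) v = 0"
      unfolding vec_eq_0_nx[of _ i] using *[rule_format, of i] *[rule_format, of "nx (nx i)"]
      by (simp add: algebra_simps)
    with assms have "- u$i = 0" unfolding indep_def by blast
    with i show False by simp
  qed
  with that show ?thesis by blast
qed

lemma indepI:
  assumes "x \<noteq> 0" "y \<noteq> 0" "pt x \<noteq> pt (y :: 'k::field ^ 3)"
  shows "indep x y"
  unfolding indep_def
proof (intro allI impI)
  fix s t assume *: "vec_comb s x t y = 0"
  have e: "s * x$i = - (t * y$i)" for i
    using * by (simp add: vec_eq_iff eq_neg_iff_add_eq_0)
  show "s = 0 \<and> t = 0"
  proof (rule ccontr)
    assume "\<not> ?thesis"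
    moreover have "s = 0" if "t = 0" using e assms(1) that by (auto simp: vec_eq_iff)
    moreover have "t = 0" if "s = 0" using e assms(2) that by (auto simp: vec_eq_iff)
    ultimately have "s \<noteq> 0" "t \<noteq> 0" by auto
    then have "y$i = (- s / t) * x$i" for i
      using e[of i] by (simp add: field_simps)
    then have "pt x = pt y"
      using \<open>s \<noteq> 0\<close> \<open>t \<noteq> 0\<close> assms by (intro pt_scale[of "- s / t"]) auto
    with assms show False by simp
  qed
qed

lemma mult_eq_imp_eq_divide_mult: "a \<noteq> 0 \<Longrightarrow> a * t = b * v \<Longrightarrow> t = (b / a) * (v :: 'k::field)"
  by (simp add: field_simps)

text \<open>The value \<open>t = 0\<close> is left out because the relations fed in here arise after
  division by \<open>t\<close>.\<close>

lemma two_coeffs: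
  assumes "\<And>t. t \<noteq> 0 \<Longrightarrow> a + t * b = (0 :: 'k::alg_closed_field)"
  shows "a = 0" "b = 0"
proof -
  have "[:a, b:] = 0"
    by (rule poly_eq_0_if_cofinite[of "{0}"]) (use assms in auto)
  then show "a = 0" "b = 0" by auto
qed

text \<open>The form in which nonsingularity is used for \<open>a = 1\<close>; it is derived in
  \<open>nonsingular_imp_cube_neq_27\<close>.\<close>

locale hessian_curve =
  fixes d :: "'a::field"
  assumes three: "(3 :: 'a) \<noteq> 0" and d3: "d ^ 3 \<noteq> 27"
begin

abbreviation \<delta> :: "'a alg_closure" where "\<delta> \<equiv> to_ac d"

lemma three_ac [simp]: "(3 :: 'a alg_closure) \<noteq> 0"
  using three to_ac_numeral[where ?'a = 'a, of "num.Bit1 num.One"] by (metis to_ac_eq_0_iff)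

lemma d3_ac: "\<delta> ^ 3 \<noteq> 27"
  using d3 by (metis to_ac_eq_iff to_ac_numeral to_ac_power)

abbreviation F :: "'a alg_closure ^ 3 \<Rightarrow> 'a alg_closure" where "F \<equiv> hessian_eq 1 d"

lemma F_nx: "F x = x$i^3 + x$(nx i)^3 + x$(nx (nx i))^3 - \<delta> * x$i * x$(nx i) * x$(nx (nx i))"
  using exhaust_3[of i] by (auto simp: hessian_eq_def algebra_simps)

lemma F_scale:
  assumes "\<And>i. y$i = c * x$i"
  shows "F y = c^3 * F x"
  unfolding hessian_eq_def assms by Groebner_Basis.algebra

text \<open>The gradient of \<open>F\<close> at \<open>x\<close> applied to \<open>y\<close>. Thus
  \<open>gr x y = 0\<close> says that \<open>y\<close> lies on the tangent at \<open>x\<close>, and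
  \<open>gr x y\<close>, \<open>gr y x\<close> are the mixed coefficients of \<open>F\<close> on the
  line through \<open>x\<close> and \<open>y\<close>.\<close>

definition gr :: "'a alg_closure ^ 3 \<Rightarrow> 'a alg_closure ^ 3 \<Rightarrow> 'a alg_closure" where
  "gr x y = (3 * x$1^2 - \<delta> * x$2 * x$3) * y$1 + (3 * x$2^2 - \<delta> * x$1 * x$3) * y$2 +
    (3 * x$3^2 - \<delta> * x$1 * x$2) * y$3"

lemma gr_nx: "gr x y = (3 * x$i^2 - \<delta> * x$(nx i) * x$(nx (nx i))) * y$i +
    (3 * x$(nx i)^2 - \<delta> * x$i * x$(nx (nx i))) * y$(nx i) +
    (3 * x$(nx (nx i))^2 - \<delta> * x$i * x$(nx i)) * y$(nx (nx i))"
  using exhaust_3[of i] by (auto simp: gr_def algebra_simps)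

lemma F_comb: "F (vec_comb s u t v) =
    s^3 * F u + s^2 * t * gr u v + s * t^2 * gr v u + t^3 * F v"
  unfolding hessian_eq_def gr_def by simp Groebner_Basis.algebra

lemma gr_scale:
  assumes "\<And>i. x'$i = c * x$i" "\<And>i. y'$i = e * y$i"
  shows "gr x' y' = c^2 * e * gr x y"
  unfolding gr_def assms by Groebner_Basis.algebra

text \<open>Euler's relation for a form of degree 3.\<close>

lemma gr_self: "gr x x = 3 * F x"
  unfolding gr_def hessian_eq_def by simp Groebner_Basis.algebra

text \<open>A line on the cubic would contain points \<open>(1, 0, a)\<close> and \<open>(0, 1, b)\<close> after a cyclic
  renaming of the coordinates; comparing coefficients forces \<open>3 a b = \<delta>\<close> and \<open>a\<^sup>3 = b\<^sup>3 = -1\<close>.\<close>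

lemma no_line:
  assumes "indep u v" "F u = 0" "F v = 0" "gr u v = 0" "gr v u = 0"
  shows False
proof -
  obtain i where m: "u$i * v$(nx i) - u$(nx i) * v$i \<noteq> 0" (is "?m \<noteq> 0")
    using assms(1) by (rule indep_minor)
  \<comment> \<open>Cramer's rule with the minor \<open>?m\<close>: \<open>e\<close> and
    \<open>f\<close> are the points of the line whose coordinates at \<open>i\<close>,
    \<open>nx i\<close> are \<open>(1, 0)\<close> and \<open>(0, 1)\<close>.\<close>
  define e where "e = vec_comb (v$(nx i) / ?m) u (- u$(nx i) / ?m) v"
  define f where "f = vec_comb (- v$i / ?m) u (u$i / ?m) v"
  define a b where "a = e$(nx (nx i))" and "b = f$(nx (nx i))"
  have line: "F (vec_comb s u t v) = 0" for s t
    using assms by (simp add: F_comb)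
  have e: "e$i = 1" "e$(nx i) = 0"
    using m by (simp_all add: e_def diff_divide_distrib[symmetric] mult.commute)
  have f: "f$i = 0" "f$(nx i) = 1"
    using m by (simp_all add: f_def add_divide_distrib[symmetric] mult.commute
        diff_divide_distrib[symmetric] add.commute)
  have "F (vec_comb s e t f) = 0" for s t
  proof -
    have "vec_comb s e t f = vec_comb (s * (v$(nx i) / ?m) + t * (- v$i / ?m)) u
        (s * (- u$(nx i) / ?m) + t * (u$i / ?m)) v"
      unfolding vec_eq_iff e_def f_def vec_comb_nth by (simp add: algebra_simps)
    then show ?thesis using line by metis
  qed
  note ef = this
  have F0: "F e = 0" "F f = 0"
    using line by (simp_all add: e_def f_def)
  have "gr e f + t * gr f e = 0" if "t \<noteq> 0" for t
    using ef[of 1 t] that F0 by (simp add: F_comb power2_eq_square) (metis distrib_left mult.assoc mult_eq_0_iff)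
  then have g: "gr e f = 0" using two_coeffs by blast
  have "1 + a^3 = 0" "1 + b^3 = 0"
    using F0 by (simp_all add: F_nx[of _ i] e f a_def b_def)
  moreover have "a * (3 * a * b - \<delta>) = 0"
    using g by (simp add: gr_nx[of _ _ i] e f a_def b_def algebra_simps power2_eq_square)
  ultimately have "\<delta> = 3 * a * b" "a^3 = -1" "b^3 = -1"
    by (auto simp: add_eq_0_iff)
  then have "\<delta>^3 = 27" by (simp add: power_mult_distrib)
  with d3_ac show False by simp
qed

text \<open>Multiplying the three equations gives
  \<open>27 (X Y Z)^2 = \<delta>^3 (X Y Z)^2\<close>, so some coordinate vanishes; the equations
  then kill the other two.\<close>

lemma gradient_nonzero:
  assumes "x \<noteq> 0"
  shows "\<exists>i. 3 * x$i^2 - \<delta> * x$(nx i) * x$(nx (nx i)) \<noteq> 0"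
proof (rule ccontr)
  assume "\<not> ?thesis"
  then have *: "3 * x$i^2 = \<delta> * x$(nx i) * x$(nx (nx i))" for i by simp
  have "27 * (x$1 * x$2 * x$3)^2 = \<delta>^3 * (x$1 * x$2 * x$3)^2"
    using *[of 1] *[of 2] *[of 3] by simp Groebner_Basis.algebra
  then have "x$1 * x$2 * x$3 = 0" using d3_ac by auto
  then obtain i where "x$i = 0" by auto
  then have "x = 0"
    using *[of "nx i"] *[of "nx (nx i)"] unfolding vec_eq_0_nx[of _ i] by simp
  with assms show False by simp
qed

text \<open>For \<open>x\<close>, \<open>y\<close> on the curve,
  \<open>F (s x + t y) = s t (s gr x y + t gr y x)\<close>, whose third root is
  \<open>(gr y x : - gr x y)\<close>.\<close>

definition third :: "'a alg_closure ^ 3 \<Rightarrow> 'a alg_closure ^ 3 \<Rightarrow> 'a alg_closure ^ 3" where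
  "third x y = vec_comb (gr y x) x (- gr x y) y"

definition tangential :: "'a alg_closure ^ 3 \<Rightarrow> 'a alg_closure ^ 3" where
  "tangential x = (\<chi> i. x$i * (x$(nx i)^3 - x$(nx (nx i))^3))"

section \<open>Existence and uniqueness of the third point\<close>

abbreviation LS where "LS \<equiv> line_section 1 d"

lemma third_nonzero:
  assumes "F x = 0" "F y = 0" "indep x y"
  shows "third x y \<noteq> 0"
  using no_line[OF assms(3,1,2)] assms(3) unfolding third_def indep_def by fastforce

lemma LS_third:
  assumes "F x = 0" "F y = 0" "indep x y"
  shows "LS (pt x) (pt y) (pt (third x y))"
proof -
  let ?r = "vector [gr y x, - gr x y] :: 'a alg_closure ^ 2"
  have "?r \<noteq> 0"
    using no_line[OF assms(3,1,2)] by (auto simp: vector2_eq_0)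
  moreover have "(vector [1, 0] :: 'a alg_closure ^ 2) \<noteq> 0" "(vector [0, 1] :: 'a alg_closure ^ 2) \<noteq> 0"
    by (simp_all add: vector2_eq_0)
  moreover have "F (vec_comb s x t y) = 1 * (s * 0 - t * 1) * (s * 1 - t * 0) * (s * (- gr x y) - t * gr y x)"
    for s t unfolding F_comb assms(1,2) by Groebner_Basis.algebra
  moreover have "vec_comb 1 x 0 y = x" "vec_comb 0 x 1 y = y"
    by (simp_all add: vec_eq_iff)
  ultimately show ?thesis
    using assms(3) unfolding line_section_def indep_def third_def
    by (intro exI[of _ x] exI[of _ y] exI[of _ "vector [1, 0]"] exI[of _ "vector [0, 1]"]
        exI[of _ ?r] exI[of _ 1]) (simp only: vector_2, simp)
qed

text \<open>With \<open>w\<close> on the tangent,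
  \<open>F (s x + t w) = t^2 (s gr w x + t F w)\<close>: a double root at \<open>x\<close>, and
  \<open>(F w : - gr w x)\<close> as the third. The last assumption keeps this form from being
  zero.\<close>

lemma LS_tangent:
  assumes "F x = 0" "indep x w" "gr x w = 0" "gr w x \<noteq> 0 \<or> F w \<noteq> 0"
  shows "LS (pt x) (pt x) (pt (vec_comb (F w) x (- gr w x) w))"
proof -
  let ?r = "vector [F w, - gr w x] :: 'a alg_closure ^ 2"
  have "?r \<noteq> 0"
    using assms by (auto simp: vector2_eq_0)
  moreover have "(vector [1, 0] :: 'a alg_closure ^ 2) \<noteq> 0"
    by (simp_all add: vector2_eq_0)
  moreover have "F (vec_comb s x t w) = (-1) * (s * 0 - t * 1) * (s * 0 - t * 1) * (s * (- gr w x) - t * F w)"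
    for s t unfolding F_comb assms(1,3) by Groebner_Basis.algebra
  moreover have "vec_comb 1 x 0 w = x"
    by (simp_all add: vec_eq_iff)
  ultimately show ?thesis
    using assms(2) unfolding line_section_def indep_def
    by (intro exI[of _ x] exI[of _ w] exI[of _ "vector [1, 0]"] exI[of _ "vector [1, 0]"]
        exI[of _ ?r] exI[of _ "-1"]) (simp only: vector_2, simp)
qed

lemma vec_comb_nonzero: "indep u v \<Longrightarrow> (p :: 'a alg_closure ^ 2) \<noteq> 0 \<Longrightarrow> vec_comb (p$1) u (p$2) v \<noteq> 0"
  unfolding indep_def by (metis (full_types) exhaust_2 vec_eq_iff zero_index)

text \<open>The factorization in \<open>line_section\<close> refers to an arbitrary basis of the
  line. Rewritten in the basis given by the two points, its coefficients must agree with those of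
  \<open>F_comb\<close>, which determines the third parameter.\<close>

lemma LS_chord_unique:
  assumes x: "x \<noteq> 0" "F x = 0" and y: "y \<noteq> 0" "F y = 0" and ne: "pt x \<noteq> pt y"
    and LS: "LS (pt x) (pt y) R"
  shows "R = pt (third x y)"
proof -
  obtain u v and p q r :: "'a alg_closure ^ 2" and \<kappa> where uv: "indep u v" and nz: "p \<noteq> 0" "q \<noteq> 0" "r \<noteq> 0" "\<kappa> \<noteq> 0"
    and pts: "pt x = pt (vec_comb (p$1) u (p$2) v)" "pt y = pt (vec_comb (q$1) u (q$2) v)"
      "R = pt (vec_comb (r$1) u (r$2) v)"
    and fac: "\<And>s t. F (vec_comb s u t v) =
      \<kappa> * (s * p$2 - t * p$1) * (s * q$2 - t * q$1) * (s * r$2 - t * r$1)"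
    using LS unfolding line_section_def indep_def by blast
  define x0 where "x0 = vec_comb (p$1) u (p$2) v"
  define y0 where "y0 = vec_comb (q$1) u (q$2) v"
  have XY0: "x0 \<noteq> 0" "y0 \<noteq> 0"
    using vec_comb_nonzero uv nz by (simp_all add: x0_def y0_def)
  obtain c where c: "c \<noteq> 0" "\<And>i. x0$i = c * x$i"
    using pts(1) x XY0 pt_eq_iff[of x x0] by (auto simp: x0_def)
  obtain e where e: "e \<noteq> 0" "\<And>i. y0$i = e * y$i"
    using pts(2) y XY0 pt_eq_iff[of y y0] by (auto simp: y0_def)
  have FX: "F x0 = 0" "F y0 = 0"
    using F_scale[of x0 c x] F_scale[of y0 e y] c e x y by auto
  \<comment> \<open>The determinant of the parameters of the two points. The next identity is
    Cramer's rule, expressing the third point in the first two.\<close>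
  define m where "m = p$1 * q$2 - p$2 * q$1"
  have XY: "m * vec_comb (r$1) u (r$2) v $ i =
      (r$1 * q$2 - r$2 * q$1) * x0$i + (p$1 * r$2 - p$2 * r$1) * y0$i" for i
    unfolding m_def x0_def y0_def by simp Groebner_Basis.algebra
  have "m \<noteq> 0"
  proof
    assume "m = 0"
    have "vec_comb (q$1) x0 (- p$1) y0 = 0" "vec_comb (q$2) x0 (- p$2) y0 = 0"
      using \<open>m = 0\<close> unfolding vec_eq_iff m_def x0_def y0_def by (simp_all, Groebner_Basis.algebra+)
    moreover have "indep x0 y0"
      using indepI XY0 ne pts by (simp add: x0_def y0_def)
    ultimately have "q$1 = 0" "q$2 = 0" by (auto simp: indep_def)
    with nz show False by (auto simp: vec_eq_iff forall_2)
  qed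
  have F1: "F (vec_comb s x0 t y0) =
      - \<kappa> * m^2 * s * t * (s * (p$1 * r$2 - p$2 * r$1) + t * (q$1 * r$2 - q$2 * r$1))" for s t
  proof -
    have comb: "vec_comb s x0 t y0 = vec_comb (s * p$1 + t * q$1) u (s * p$2 + t * q$2) v"
      unfolding vec_eq_iff x0_def y0_def by (simp add: algebra_simps)
    show ?thesis unfolding comb fac m_def by Groebner_Basis.algebra
  qed
  have "(gr x0 y0 + \<kappa> * m^2 * (p$1 * r$2 - p$2 * r$1)) +
      t * (gr y0 x0 + \<kappa> * m^2 * (q$1 * r$2 - q$2 * r$1)) = 0" if "t \<noteq> 0" for t
  proof -
    have "t * ((gr x0 y0 + \<kappa> * m^2 * (p$1 * r$2 - p$2 * r$1)) +
        t * (gr y0 x0 + \<kappa> * m^2 * (q$1 * r$2 - q$2 * r$1))) = 0"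
      using F1[of 1 t] FX by (simp add: F_comb) Groebner_Basis.algebra
    then show ?thesis using that by simp
  qed
  from two_coeffs[OF this]
  have g: "gr x0 y0 = - \<kappa> * m^2 * (p$1 * r$2 - p$2 * r$1)"
      "gr y0 x0 = - \<kappa> * m^2 * (q$1 * r$2 - q$2 * r$1)"
    by (simp_all add: eq_neg_iff_add_eq_0)
  have g': "gr x0 y0 = c^2 * e * gr x y" "gr y0 x0 = e^2 * c * gr y x"
    using gr_scale c e by auto
  have "third x y $ i = (\<kappa> * m^3 / (e^2 * c^2)) * vec_comb (r$1) u (r$2) v $ i" for i
  proof -
    have "e^2 * c^2 * third x y $ i = gr y0 x0 * x0$i - gr x0 y0 * y0$i"
      unfolding third_def g' c e by simp Groebner_Basis.algebra
    also have "\<dots> = \<kappa> * m^2 * (m * vec_comb (r$1) u (r$2) v $ i)"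
      unfolding g XY by Groebner_Basis.algebra
    also have "\<dots> = \<kappa> * m^3 * vec_comb (r$1) u (r$2) v $ i"
      by (simp only: power3_eq_cube power2_eq_square mult.assoc)
    finally show ?thesis using c e by (intro mult_eq_imp_eq_divide_mult) auto
  qed
  moreover have "\<kappa> * m^3 / (e^2 * c^2) \<noteq> 0"
    using nz \<open>m \<noteq> 0\<close> c e by simp
  ultimately show ?thesis
    unfolding pts(3) using vec_comb_nonzero[OF uv nz(3)] by (intro pt_scale)
qed

text \<open>Here \<open>p\<close> and \<open>q\<close> are proportional, so the two points give no
  basis of the line. Completing \<open>p\<close> by any independent \<open>p'\<close> gives a second
  point \<open>w\<close>, and the double factor \<open>t^2\<close> forces
  \<open>gr x w = 0\<close>.\<close>

lemma LS_tangent_form: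
  assumes x: "x \<noteq> 0" "F x = 0" and LS: "LS (pt x) (pt x) R"
  obtains w where "indep x w" "gr x w = 0" "R = pt (vec_comb (F w) x (- gr w x) w)"
    "vec_comb (F w) x (- gr w x) w \<noteq> 0"
proof -
  obtain u v and p q r :: "'a alg_closure ^ 2" and \<kappa> where uv: "indep u v" and nz: "p \<noteq> 0" "q \<noteq> 0" "r \<noteq> 0" "\<kappa> \<noteq> 0"
    and pts: "pt x = pt (vec_comb (p$1) u (p$2) v)" "pt x = pt (vec_comb (q$1) u (q$2) v)"
      "R = pt (vec_comb (r$1) u (r$2) v)"
    and fac: "\<And>s t. F (vec_comb s u t v) =
      \<kappa> * (s * p$2 - t * p$1) * (s * q$2 - t * q$1) * (s * r$2 - t * r$1)"
    using LS unfolding line_section_def indep_def by blast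
  define x0 where "x0 = vec_comb (p$1) u (p$2) v"
  define y0 where "y0 = vec_comb (q$1) u (q$2) v"
  have XY0: "x0 \<noteq> 0" "y0 \<noteq> 0"
    using vec_comb_nonzero uv nz by (simp_all add: x0_def y0_def)
  obtain c where c: "c \<noteq> 0" "\<And>i. x0$i = c * x$i"
    using pts(1) x XY0 pt_eq_iff[of x x0] by (auto simp: x0_def)
  obtain e where e: "e \<noteq> 0" "\<And>i. y0$i = e * x0$i"
    using pts(1,2) XY0 pt_eq_iff[of x0 y0] by (auto simp: x0_def y0_def)
  have "vec_comb (e * p$1 - q$1) u (e * p$2 - q$2) v = 0"
    using e(2) unfolding vec_eq_iff x0_def y0_def by (simp add: algebra_simps)
  from indepD[OF uv this] have q: "q$1 = e * p$1" "q$2 = e * p$2"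
    by simp_all
  \<comment> \<open>A unit vector independent of \<open>p\<close>.\<close>
  obtain p' :: "'a alg_closure ^ 2" where n: "p$1 * p'$2 - p$2 * p'$1 \<noteq> 0"
  proof (cases "p$1 = 0")
    case True
    then have "p$2 \<noteq> 0" using nz(1) by (auto simp: vec_eq_iff forall_2)
    then show ?thesis using that[of "vector [1, 0]"] by simp
  next
    case False
    then show ?thesis using that[of "vector [0, 1]"] by simp
  qed
  define n where "n = p$1 * p'$2 - p$2 * p'$1"
  define w where "w = vec_comb (p'$1) u (p'$2) v"
  have FX: "F x0 = 0"
    using F_scale[of x0 c x] c x by auto
  have XY: "n * vec_comb (r$1) u (r$2) v $ i =
      (r$1 * p'$2 - r$2 * p'$1) * x0$i + (p$1 * r$2 - p$2 * r$1) * w$i" for i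
    unfolding n_def x0_def w_def by simp Groebner_Basis.algebra
  have comb: "vec_comb s x0 t w = vec_comb (s * p$1 + t * p'$1) u (s * p$2 + t * p'$2) v" for s t
    unfolding vec_eq_iff x0_def w_def by (simp add: algebra_simps)
  have F1: "F (vec_comb s x0 t w) =
      \<kappa> * e * n^2 * t^2 * (s * (p$1 * r$2 - p$2 * r$1) + t * (p'$1 * r$2 - p'$2 * r$1))" for s t
    unfolding comb fac n_def q by Groebner_Basis.algebra
  have indepX: "indep x0 w"
    unfolding indep_def
  proof (intro allI impI)
    fix s t assume "vec_comb s x0 t w = 0"
    then have "s * p$1 + t * p'$1 = 0" "s * p$2 + t * p'$2 = 0"
      using uv unfolding comb by (auto simp: indep_def)
    then have "s * n = 0" "t * n = 0"
      unfolding n_def by Groebner_Basis.algebra+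
    with n show "s = 0 \<and> t = 0" by (simp add: n_def)
  qed
  have Fw: "F w = \<kappa> * e * n^2 * (p'$1 * r$2 - p'$2 * r$1)"
  proof -
    have "vec_comb 0 x0 1 w = w" by (simp add: vec_eq_iff)
    then show ?thesis using F1[of 0 1] by simp
  qed
  have "gr x0 w + t * (gr w x0 - \<kappa> * e * n^2 * (p$1 * r$2 - p$2 * r$1)) = 0" if "t \<noteq> 0" for t
  proof -
    have "t * (gr x0 w + t * (gr w x0 - \<kappa> * e * n^2 * (p$1 * r$2 - p$2 * r$1))) = 0"
      using F1[of 1 t] FX Fw by (simp add: F_comb) Groebner_Basis.algebra
    then show ?thesis using that by simp
  qed
  from two_coeffs[OF this]
  have g: "gr x0 w = 0" "gr w x0 = \<kappa> * e * n^2 * (p$1 * r$2 - p$2 * r$1)"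
    by simp_all
  have g': "gr x0 w = c^2 * gr x w" "gr w x0 = c * gr w x"
    using gr_scale[of x0 c x w 1 w] gr_scale[of w 1 w x0 c x] c by auto
  have "indep x w"
    unfolding indep_def
  proof (intro allI impI)
    fix s t assume "vec_comb s x t w = 0"
    then have "vec_comb (s / c) x0 t w = 0" using c by (simp add: vec_eq_iff)
    from indepD[OF indepX this] c show "s = 0 \<and> t = 0" by simp
  qed
  have eq: "vec_comb (F w) x (- gr w x) w $ i =
      (- \<kappa> * e * n^3 / c) * vec_comb (r$1) u (r$2) v $ i" for i
  proof -
    have "c * vec_comb (F w) x (- gr w x) w $ i = F w * x0$i - gr w x0 * w$i"
      unfolding g' c by simp Groebner_Basis.algebra
    also have "\<dots> = - \<kappa> * e * n^2 * (n * vec_comb (r$1) u (r$2) v $ i)"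
      unfolding g Fw XY by Groebner_Basis.algebra
    also have "\<dots> = - \<kappa> * e * n^3 * vec_comb (r$1) u (r$2) v $ i"
      by (simp only: power3_eq_cube power2_eq_square mult.assoc)
    finally show ?thesis using c(1) by (intro mult_eq_imp_eq_divide_mult)
  qed
  have k: "- \<kappa> * e * n^3 / c \<noteq> 0"
    using nz n c e by (simp add: n_def)
  have R0: "vec_comb (r$1) u (r$2) v \<noteq> 0"
    using vec_comb_nonzero[OF uv nz(3)] .
  show ?thesis
  proof
    show "indep x w" by fact
    show "gr x w = 0" using g g' c by simp
    show "R = pt (vec_comb (F w) x (- gr w x) w)"
      unfolding pts(3) using R0 k eq by (intro pt_scale)
    show "vec_comb (F w) x (- gr w x) w \<noteq> 0"
      using R0 k eq unfolding vec_eq_iff zero_index by (metis mult_eq_0_iff)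
  qed
qed

text \<open>The gradient at \<open>x\<close> is nonzero, so the tangent is a single line and
  \<open>w' = \<alpha> x + \<beta> w\<close>. Replacing \<open>w\<close> by \<open>w'\<close>
  multiplies the vector of the third point by \<open>\<beta>^3\<close>.\<close>

lemma LS_tangent_unique:
  assumes x: "x \<noteq> 0" "F x = 0" and "LS (pt x) (pt x) R" "LS (pt x) (pt x) R'"
  shows "R = R'"
proof -
  obtain w where w: "indep x w" "gr x w = 0" "R = pt (vec_comb (F w) x (- gr w x) w)"
    "vec_comb (F w) x (- gr w x) w \<noteq> 0"
    using LS_tangent_form[OF x assms(3)] .
  obtain w' where w': "indep x w'" "gr x w' = 0" "R' = pt (vec_comb (F w') x (- gr w' x) w')"
    "vec_comb (F w') x (- gr w' x) w' \<noteq> 0"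
    using LS_tangent_form[OF x assms(4)] .
  obtain i where m: "x$i * w$(nx i) - x$(nx i) * w$i \<noteq> 0" (is "?m \<noteq> 0")
    using w(1) by (rule indep_minor)
  obtain j where nj: "3 * x$j^2 - \<delta> * x$(nx j) * x$(nx (nx j)) \<noteq> 0"
    using gradient_nonzero x by blast
  \<comment> \<open>The determinant of \<open>x\<close>, \<open>w\<close>, \<open>w'\<close>; it
    vanishes because the gradient at \<open>x\<close> annihilates all three.\<close>
  define D where "D = x$1 * (w$2 * w'$3 - w$3 * w'$2) - x$2 * (w$1 * w'$3 - w$3 * w'$1) +
    x$3 * (w$1 * w'$2 - w$2 * w'$1)"
  have gx: "gr x x = 0" using x by (simp add: gr_self)
  have "(3 * x$j^2 - \<delta> * x$(nx j) * x$(nx (nx j))) * D = 0"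
  proof -
    note e = gx w(2) w'(2)
    consider "j = 1" | "j = 2" | "j = 3" using exhaust_3 by blast
    then show ?thesis
    proof cases
      case 1
      show ?thesis using e unfolding D_def gr_def 1 nx_simps by Groebner_Basis.algebra
    next
      case 2
      show ?thesis using e unfolding D_def gr_def 2 nx_simps by Groebner_Basis.algebra
    next
      case 3
      show ?thesis using e unfolding D_def gr_def 3 nx_simps by Groebner_Basis.algebra
    qed
  qed
  then have "D = 0" using nj by simp
  \<comment> \<open>Coefficients of \<open>w'\<close> in terms of \<open>x\<close> and
    \<open>w\<close> by Cramer's rule in the coordinates \<open>i\<close>,
    \<open>nx i\<close>.\<close>
  define \<alpha> where "\<alpha> = (w'$i * w$(nx i) - w'$(nx i) * w$i) / ?m"
  define \<beta> where "\<beta> = (x$i * w'$(nx i) - x$(nx i) * w'$i) / ?m"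
  have "?m * w'$k = (w'$i * w$(nx i) - w'$(nx i) * w$i) * x$k +
      (x$i * w'$(nx i) - x$(nx i) * w'$i) * w$k" for k
  proof -
    have D: "x$i * (w$(nx i) * w'$(nx (nx i)) - w$(nx (nx i)) * w'$(nx i)) -
        x$(nx i) * (w$i * w'$(nx (nx i)) - w$(nx (nx i)) * w'$i) +
        x$(nx (nx i)) * (w$i * w'$(nx i) - w$(nx i) * w'$i) = 0"
      using exhaust_3[of i] \<open>D = 0\<close> unfolding D_def by (elim disjE) (simp_all add: algebra_simps)
    consider "k = i" | "k = nx i" | "k = nx (nx i)" using exhaust_nx by blast
    then show ?thesis
    proof cases
      case 1
      show ?thesis unfolding 1 by Groebner_Basis.algebra
    next
      case 2
      show ?thesis unfolding 2 by Groebner_Basis.algebra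
    next
      case 3
      show ?thesis using D unfolding 3 by Groebner_Basis.algebra
    qed
  qed
  then have w'_k: "w'$k = ((w'$i * w$(nx i) - w'$(nx i) * w$i) * x$k +
      (x$i * w'$(nx i) - x$(nx i) * w'$i) * w$k) / ?m" for k
    using m by (metis nonzero_mult_div_cancel_left)
  have w'_lin: "w'$k = \<alpha> * x$k + \<beta> * w$k" for k
    unfolding \<alpha>_def \<beta>_def times_divide_eq_left add_divide_distrib[symmetric] by (rule w'_k)
  then have w'_eq: "w' = vec_comb \<alpha> x \<beta> w" by (simp add: vec_eq_iff)
  have "\<beta> \<noteq> 0"
  proof
    assume "\<beta> = 0"
    then have "vec_comb \<alpha> x (-1) w' = 0" by (simp add: w'_eq vec_eq_iff)
    with w'(1) show False unfolding indep_def by (metis neg_equal_0_iff_equal zero_neq_one)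
  qed
  have expand: "F (vec_comb s x t w') = s * t^2 * (\<beta>^2 * gr w x) + t^3 * (\<alpha> * \<beta>^2 * gr w x + \<beta>^3 * F w)"
    for s t
  proof -
    have comb: "vec_comb s x t w' = vec_comb (s + t * \<alpha>) x (t * \<beta>) w"
      unfolding w'_eq by (simp add: vec_eq_iff algebra_simps)
    show ?thesis unfolding comb F_comb x(2) w(2) by Groebner_Basis.algebra
  qed
  have Fw': "F w' = \<alpha> * \<beta>^2 * gr w x + \<beta>^3 * F w"
    using expand[of 0 1] x by (simp add: F_comb)
  then have gw': "gr w' x = \<beta>^2 * gr w x"
    using expand[of 1 1] x w' by (simp add: F_comb)
  have "vec_comb (F w') x (- gr w' x) w' $ k = \<beta>^3 * vec_comb (F w) x (- gr w x) w $ k" for k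
    unfolding vec_comb_nth Fw' gw' w'_lin by Groebner_Basis.algebra
  then show ?thesis
    unfolding w(3) w'(3) using w(4) \<open>\<beta> \<noteq> 0\<close> by (intro pt_scale[of "\<beta>^3"]) auto
qed

lemma tangential_nth: "tangential x $ i = x$i * (x$(nx i)^3 - x$(nx (nx i))^3)"
  by (simp add: tangential_def)

text \<open>If no coordinate of \<open>x\<close> vanishes, the three cubes are equal, so
  \<open>3 Z^3 = \<delta> X Y Z\<close>, and cubing gives \<open>\<delta>^3 = 27\<close>. If one
  vanishes, so does the product of the others, and the cubic leaves only
  \<open>x = 0\<close>.\<close>

lemma tangential_nonzero:
  assumes "x \<noteq> 0" "F x = 0"
  shows "tangential x \<noteq> 0"
proof
  assume "tangential x = 0"
  then have t: "x$i * (x$(nx i)^3 - x$(nx (nx i))^3) = 0" for i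
    by (metis tangential_nth zero_index)
  show False
  proof (cases "\<exists>i. x$i = 0")
    case True
    then obtain i where i: "x$i = 0" ..
    have "x$(nx i) * x$(nx (nx i)) = 0"
      using t[of "nx i"] i by auto
    then have "x = 0" unfolding vec_eq_0_nx[of _ i]
      using i assms(2) F_nx[of x i] by auto
    then show False using assms by simp
  next
    case False
    then have c: "x$1^3 = x$3^3" "x$2^3 = x$3^3"
      using t[of 2] t[of 1] by auto
    have e: "x$1^3 + x$2^3 + x$3^3 = \<delta> * (x$1 * x$2 * x$3)"
      using assms(2) by (simp add: hessian_eq_def mult.assoc)
    have "27 * (x$1 * x$2 * x$3)^3 = (3 * x$3^3)^3"
      using c by (simp add: power_mult_distrib)
    also have "3 * x$3^3 = \<delta> * (x$1 * x$2 * x$3)"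
      using e c by simp
    finally have "27 * (x$1 * x$2 * x$3)^3 = \<delta>^3 * (x$1 * x$2 * x$3)^3"
      by (simp add: power_mult_distrib)
    then show False using False d3_ac by auto
  qed
qed

lemma F_tangential: "F x = 0 \<Longrightarrow> F (tangential x) = 0"
  unfolding hessian_eq_def tangential_nth nx_simps by simp Groebner_Basis.algebra

lemma gr_tangential: "gr x (tangential x) = 0"
  unfolding gr_def tangential_nth nx_simps by Groebner_Basis.algebra

text \<open>When \<open>tangential x\<close> is a point other than \<open>x\<close>, it serves as
  the second point of the tangent. Otherwise the tangent meets the curve only at \<open>x\<close>,
  and a point off the curve is needed to span it.\<close>

lemma LS_tangential:
  assumes x: "x \<noteq> 0" "F x = 0"
  shows "LS (pt x) (pt x) (pt (tangential x))"
proof (cases "pt x = pt (tangential x)")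
  case False
  then have ind: "indep x (tangential x)"
    using indepI x tangential_nonzero by blast
  have g: "gr (tangential x) x \<noteq> 0"
    using no_line[OF ind] x F_tangential gr_tangential by blast
  have "LS (pt x) (pt x) (pt (vec_comb (F (tangential x)) x (- gr (tangential x) x) (tangential x)))"
    using LS_tangent[OF x(2) ind gr_tangential] g by blast
  also have "pt (vec_comb (F (tangential x)) x (- gr (tangential x) x) (tangential x)) = pt (tangential x)"
    using g tangential_nonzero[OF x] F_tangential[OF x(2)]
    by (intro pt_scale[symmetric, of "- gr (tangential x) x"]) auto
  finally show ?thesis .
next
  case True
  then obtain c where c: "c \<noteq> 0" "\<And>i. tangential x $ i = c * x$i"
    using pt_eq_iff[OF x(1) tangential_nonzero[OF x]] by auto
  \<comment> \<open>Otherwise all three cyclic differences of cubes equal \<open>c\<close>; their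
    sum is zero, so \<open>3 c = 0\<close>.\<close>
  have "\<exists>i. x$i = 0"
  proof (rule ccontr)
    assume "\<not> ?thesis"
    then have "x$(nx i)^3 - x$(nx (nx i))^3 = c" for i
      using c(2)[of i] by (simp add: tangential_nth)
    from this[of 1] this[of 2] this[of 3] have
      "3 * c = (x$2^3 - x$3^3) + (x$3^3 - x$1^3) + (x$1^3 - x$2^3)"
      unfolding nx_simps by (simp only:) simp
    then have "3 * c = 0" by simp
    with c show False by simp
  qed
  then obtain i where i: "x$i = 0" ..
  let ?j = "nx i" and ?k = "nx (nx i)"
  have cub: "x$?j^3 + x$?k^3 = 0" using x(2) by (simp add: F_nx[of _ i] i)
  have nz: "x$?j \<noteq> 0" "x$?k \<noteq> 0"
    using cub x(1) i vec_eq_0_nx[of x i] by auto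
  \<comment> \<open>With \<open>x$i = 0\<close> the gradient at \<open>x\<close> is
    \<open>(- \<delta> x$j x$k, 3 x$j^2, 3 x$k^2)\<close>, and \<open>w\<close> is its annihilated
    vector with last coordinate 0. Both mixed coefficients vanish, so \<open>F\<close> restricts to
    \<open>t^3 F w\<close>: a triple contact.\<close>
  define w :: "'a alg_closure ^ 3"
    where "w = (\<chi> l. if l = i then 3 * x$?j else if l = ?j then \<delta> * x$?k else 0)"
  have w: "w$i = 3 * x$?j" "w$?j = \<delta> * x$?k" "w$?k = 0"
    by (simp_all add: w_def)
  have "indep x w"
    unfolding indep_def
  proof (intro allI impI)
    fix s t assume *: "vec_comb s x t w = 0"
    then have "s * x$l + t * w$l = 0" for l by (metis vec_comb_nth zero_index)
    from this[of ?k] this[of i] show "s = 0 \<and> t = 0" using w i nz by simp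
  qed
  moreover have "gr x w = 0" "gr w x = 0"
    unfolding gr_nx[of _ _ i] w i by (simp_all add: power2_eq_square)
  moreover have "F w \<noteq> 0"
  proof -
    have "F w = x$?k^3 * (\<delta>^3 - 27)"
      unfolding F_nx[of _ i] w using cub by simp Groebner_Basis.algebra
    then show ?thesis using nz d3_ac by simp
  qed
  ultimately have "LS (pt x) (pt x) (pt (vec_comb (F w) x (- gr w x) w))"
    using LS_tangent x by blast
  also have "pt (vec_comb (F w) x (- gr w x) w) = pt x"
    using \<open>F w \<noteq> 0\<close> \<open>gr w x = 0\<close> x by (intro pt_scale[symmetric, of "F w"]) auto
  finally show ?thesis using True by simp
qed

text \<open>Makes the definite description in \<open>third_point\<close> usable; afterwards
  collinearity, which is symmetric, can replace the function.\<close>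

lemma LS_iff_third_point:
  assumes "x \<noteq> 0" "F x = 0" "y \<noteq> 0" "F y = 0"
  shows "LS (pt x) (pt y) R \<longleftrightarrow> R = third_point 1 d (pt x) (pt y)"
proof -
  have "\<exists>!R. LS (pt x) (pt y) R"
  proof (cases "pt x = pt y")
    case True
    then show ?thesis using LS_tangential LS_tangent_unique assms by metis
  next
    case False
    then show ?thesis using LS_third LS_chord_unique assms indepI by metis
  qed
  then show ?thesis
    unfolding third_point_def by (metis (no_types, lifting) theI_unique)
qed

lemma third_point_third:
  assumes "x \<noteq> 0" "F x = 0" "y \<noteq> 0" "F y = 0" "pt x \<noteq> pt y"
  shows "third_point 1 d (pt x) (pt y) = pt (third x y)"
  using LS_iff_third_point LS_third indepI assms by metis

lemma third_point_tangential:
  assumes "x \<noteq> 0" "F x = 0"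
  shows "third_point 1 d (pt x) (pt x) = pt (tangential x)"
  using LS_iff_third_point LS_tangential assms by metis

lemma LS_commute: "LS P Q R \<Longrightarrow> LS Q P R"
  unfolding line_section_def by (elim exE conjE, intro exI conjI) (assumption | simp)+

lemma LS_rotate: "LS P Q R \<Longrightarrow> LS P R Q"
  unfolding line_section_def by (elim exE conjE, intro exI conjI) (assumption | simp)+

lemma third_point_commute: "third_point 1 d P Q = third_point 1 d Q P"
proof -
  have "LS P Q = LS Q P" using LS_commute by blast
  then show ?thesis by (simp add: third_point_def)
qed

end

section \<open>The addition law\<close>

text \<open>Flexes with coordinates in the prime field: \<open>flex 1\<close> is the identity of the
  group, the other two are points of order 3.\<close>

definition flex :: "3 \<Rightarrow> 'k::field ^ 3" where
  "flex j = (\<chi> i. if i = j then 0 else if i = nx j then -1 else 1)"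

text \<open>The third point on the chord through \<open>x\<close> and \<open>flex j\<close>, by
  \<open>third_point_flex\<close>; in particular \<open>swap 1\<close> is negation.\<close>

definition swap :: "3 \<Rightarrow> 'k ^ 3 \<Rightarrow> 'k ^ 3" where
  "swap j x = (\<chi> i. if i = j then x$j else if i = nx j then x$(nx (nx j)) else x$(nx j))"

lemma flex_nth [simp]: "flex j $ j = 0" "flex j $ nx j = -1" "flex j $ nx (nx j) = 1"
  by (simp_all add: flex_def)

lemma swap_nth [simp]:
  "swap j x $ j = x$j" "swap j x $ nx j = x$(nx (nx j))" "swap j x $ nx (nx j) = x$(nx j)"
  by (simp_all add: swap_def)

lemma vec_eq_nx: "(x :: 'k ^ 3) = y \<longleftrightarrow>
    x$i = y$i \<and> x$(nx i) = y$(nx i) \<and> x$(nx (nx i)) = y$(nx (nx i))"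
  unfolding vec_eq_iff using forall_nx[of "\<lambda>j. x$j = y$j" i] by simp

lemma flex_nonzero: "flex j \<noteq> 0"
  by (simp add: vec_eq_0_nx[of _ j])

lemma swap_nonzero: "x \<noteq> 0 \<Longrightarrow> swap j x \<noteq> 0"
  by (auto simp: vec_eq_0_nx[of _ j])

lemma hessian_O_flex: "hessian_O = pt (flex 1)"
proof -
  have "vector [0, -1, 1] = (flex 1 :: 'a alg_closure ^ 3)"
    by (simp add: vec_eq_nx[of _ _ 1]) (simp add: flex_def)
  then show ?thesis by (simp add: hessian_O_def)
qed

lemma pt_vector2_neg:
  assumes "p \<noteq> 0 \<or> q \<noteq> 0" "a \<noteq> 0 \<or> b \<noteq> 0" "p * b + q * a = (0 :: 'k::field)"
  shows "pt (vector [p, q] :: 'k ^ 2) = pt (vector [a, - b])"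
  using assms by (subst pt_vector2_eq) (auto simp: add_eq_0_iff2)

text \<open>The addition law projections for \<open>\<phi>\<^sub>Y\<close> and \<open>\<phi>\<^sub>Z\<close> arise from the one for
  \<open>\<phi>\<^sub>X\<close> by rotating the coordinates of one argument (translation by a point of order 3).\<close>

definition rot :: "3 \<Rightarrow> 'k ^ 3 \<Rightarrow> 'k ^ 3" where
  "rot i x = (\<chi> j. if i = 1 then x$j else if i = 2 then x$(nx j) else x$(nx (nx j)))"

definition law0 :: "'k::field ^ 3 \<Rightarrow> 'k ^ 3 \<Rightarrow> 'k" where
  "law0 x y = x$1 * y$2 * y$3 + x$2 * y$1 * y$2 + x$3 * y$1 * y$3"

definition law1 :: "'k::field ^ 3 \<Rightarrow> 'k ^ 3 \<Rightarrow> 'k" where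
  "law1 x y = x$1 * y$1^2 + x$2 * y$3^2 + x$3 * y$2^2"

lemma rot_nth: "rot 1 x $ j = x$j" "rot 2 x $ j = x$(nx j)" "rot 3 x $ j = x$(nx (nx j))"
  by (simp_all add: rot_def)

section \<open>The laws as identities modulo the cubic\<close>

context hessian_curve
begin

lemma F_flex: "F (flex j) = 0"
  by (simp add: F_nx[of _ j])

text \<open>The difference \<open>x - swap j x\<close> is a multiple of \<open>flex j\<close>, so
  the three are collinear, and \<open>third\<close> returns \<open>swap j x\<close> up to the factor
  \<open>gr (flex j) x\<close>. At \<open>x = flex j\<close> the tangential formula applies, as
  \<open>flex j\<close> is its own tangential.\<close>

lemma third_point_flex:
  assumes x: "x \<noteq> 0" "F x = 0"
  shows "third_point 1 d (pt x) (pt (flex j)) = pt (swap j x)"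
proof (cases "pt x = pt (flex j)")
  case True
  then obtain c where c: "c \<noteq> 0" "\<And>i. x $ i = c * flex j $ i"
    using pt_eq_iff[OF flex_nonzero x(1)] by metis
  have "tangential (flex j) = flex j"
    by (simp add: vec_eq_nx[of _ _ j] tangential_nth)
  then have "third_point 1 d (pt x) (pt (flex j)) = pt (flex j)"
    using third_point_tangential[OF flex_nonzero F_flex] True by metis
  moreover have "swap j x $ i = - c * flex j $ i" for i
    using exhaust_nx[of i j] c(2)[of j] c(2)[of "nx j"] c(2)[of "nx (nx j)"] by auto
  ultimately show ?thesis
    using c(1) by (metis flex_nonzero neg_equal_0_iff_equal pt_scale)
next
  case False
  have "third x (flex j) = vec_comb (gr (flex j) x) (swap j x) 0 0"
  proof -
    have "gr (flex j) x = \<delta> * x$j + 3 * x$(nx j) + 3 * x$(nx (nx j))"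
      by (simp add: gr_nx[of _ _ j])
    moreover have "gr x (flex j) = (3 * x$(nx (nx j))^2 - \<delta> * x$j * x$(nx j)) -
        (3 * x$(nx j)^2 - \<delta> * x$j * x$(nx (nx j)))"
      by (simp add: gr_nx[of _ _ j])
    ultimately show ?thesis
      unfolding vec_eq_nx[of _ _ j] third_def vec_comb_nth flex_nth swap_nth
      by (simp add: algebra_simps power2_eq_square)
  qed
  then have *: "third x (flex j) $ i = gr (flex j) x * swap j x $ i" for i
    by simp
  have "third x (flex j) \<noteq> 0"
    using third_nonzero F_flex x indepI flex_nonzero False by blast
  then have "gr (flex j) x \<noteq> 0"
    using * by (auto simp: vec_eq_iff)
  then have "pt (swap j x) = pt (third x (flex j))"
    using * swap_nonzero[OF x(1)] by (intro pt_scale)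
  then show ?thesis
    using third_point_third[OF x flex_nonzero F_flex False] by simp
qed

lemma F_third: "F x = 0 \<Longrightarrow> F y = 0 \<Longrightarrow> F (third x y) = 0"
  unfolding third_def F_comb by (simp add: power2_eq_square)

text \<open>The second case is the point \<open>flex i\<close>, where the defining forms of the projection both vanish; the
  value comes from \<open>(Y + Z) (Y\<^sup>2 - Y Z + Z\<^sup>2) = X (d Y Z - X\<^sup>2)\<close>.\<close>

definition phi :: "3 \<Rightarrow> 'a plane \<Rightarrow> 'a line" where
  "phi i P = (let x = coords_of P in
     if x$i \<noteq> 0 \<or> x$(nx i) + x$(nx (nx i)) \<noteq> 0
     then pt (vector [x$i, - (x$(nx i) + x$(nx (nx i)))]) else pt (vector [3, \<delta>]))"

lemma phi_pt:
  assumes "x \<noteq> 0"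
  shows "phi i (pt x) = (if x$i \<noteq> 0 \<or> x$(nx i) + x$(nx (nx i)) \<noteq> 0
     then pt (vector [x$i, - (x$(nx i) + x$(nx (nx i)))]) else pt (vector [3, \<delta>]))"
proof -
  obtain c where c: "c \<noteq> 0" "\<And>i. coords_of (pt x) $ i = c * x$i"
    by (rule coords_of_pt[OF assms]) (rule that)
  show ?thesis
  proof (cases "x$i \<noteq> 0 \<or> x$(nx i) + x$(nx (nx i)) \<noteq> 0")
    case True
    have scale: "pt (vector [c * s, - (c * t)] :: 'a alg_closure ^ 2) = pt (vector [s, - t])"
      if "s \<noteq> 0 \<or> t \<noteq> 0" for s t
      using that c(1) by (subst pt_vector2_eq) auto
    note scale[OF True]
    then show ?thesis
      using True c by (simp add: phi_def Let_def flip: distrib_left)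
  next
    case False
    then show ?thesis
      using c by (simp add: phi_def Let_def flip: distrib_left)
  qed
qed

lemma mem_hessian: "x \<noteq> 0 \<Longrightarrow> pt x \<in> hessian 1 d \<longleftrightarrow> F x = 0"
proof
  assume x: "x \<noteq> 0" and "pt x \<in> hessian 1 d"
  then obtain y where y: "y \<noteq> 0" "F y = 0" "pt x = pt y"
    by (auto simp: hessian_def)
  then obtain c where "\<And>i. x$i = c * y$i"
    using pt_eq_iff[OF y(1) x] by metis
  then show "F x = 0" using F_scale[of x c y] y by simp
qed (auto simp: hessian_def)

lemma hessian_add_pt:
  assumes "third_point 1 d (pt x) (pt y) = pt r" "r \<noteq> 0" "F r = 0"
  shows "hessian_add 1 d (pt x) (pt y) = pt (swap 1 r)"
  unfolding hessian_add_def assms(1) hessian_O_flex using third_point_flex assms by blast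

text \<open>The cross-multiplied form of
  \<open>(law0 : law1) = (w$i : - (w$(nx i) + w$(nx (nx i))))\<close>. The left side lies in the
  ideal generated by \<open>F x\<close> and \<open>F y\<close>.\<close>

lemma law_chord:
  fixes x y i
  defines "w \<equiv> swap 1 (third x y)"
  assumes "F x = 0" "F y = 0"
  shows "law0 (rot i x) y * (w$(nx i) + w$(nx (nx i))) + law1 (rot i x) y * w$i = 0"
proof -
  \<comment> \<open>Cofactors of bidegree \<open>(3, 1)\<close> and \<open>(0, 4)\<close> in
    \<open>x\<close>, \<open>y\<close>. Their common linear factor is \<open>gr (flex j) y\<close>,
    the equation of the tangent at \<open>flex j\<close>, and the index \<open>j\<close> that works
    is the later \<open>partner i\<close>.\<close>
  define M where "M j = x$1 * x$2 * x$3 * (\<delta> * y$j + 3 * y$(nx j) + 3 * y$(nx (nx j)))" for j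
  define N where "N j = y$1 * y$2 * y$3 * (\<delta> * y$j + 3 * y$(nx j) + 3 * y$(nx (nx j)))" for j
  have w: "w$1 = gr y x * x$1 - gr x y * y$1" "w$2 = gr y x * x$3 - gr x y * y$3"
      "w$3 = gr y x * x$2 - gr x y * y$2"
    by (simp_all add: w_def third_def swap_def)
  consider "i = 1" | "i = 2" | "i = 3" using exhaust_3 by blast
  then have "\<exists>j. law0 (rot i x) y * (w$(nx i) + w$(nx (nx i))) + law1 (rot i x) y * w$i =
      M j * F y - N j * F x"
  proof cases
    case 1
    show ?thesis unfolding 1 law0_def law1_def rot_nth nx_simps w gr_def M_def N_def hessian_eq_def to_ac_1
      by (rule exI[of _ 1], unfold nx_simps, Groebner_Basis.algebra)
  next
    case 2
    show ?thesis unfolding 2 law0_def law1_def rot_nth nx_simps w gr_def M_def N_def hessian_eq_def to_ac_1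
      by (rule exI[of _ 3], unfold nx_simps, Groebner_Basis.algebra)
  next
    case 3
    show ?thesis unfolding 3 law0_def law1_def rot_nth nx_simps w gr_def M_def N_def hessian_eq_def to_ac_1
      by (rule exI[of _ 2], unfold nx_simps, Groebner_Basis.algebra)
  qed
  with assms show ?thesis by auto
qed

lemma law_tangent:
  fixes x i
  defines "w \<equiv> swap 1 (tangential x)"
  shows "law0 (rot i x) x * (w$(nx i) + w$(nx (nx i))) + law1 (rot i x) x * w$i = 0"
proof -
  have w: "w$1 = x$1 * (x$2^3 - x$3^3)" "w$2 = x$3 * (x$1^3 - x$2^3)" "w$3 = x$2 * (x$3^3 - x$1^3)"
    by (simp_all add: w_def tangential_nth swap_def)
  consider "i = 1" | "i = 2" | "i = 3" using exhaust_3 by blast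
  then show ?thesis
  proof cases
    case 1
    show ?thesis unfolding 1 law0_def law1_def rot_nth nx_simps w by Groebner_Basis.algebra
  next
    case 2
    show ?thesis unfolding 2 law0_def law1_def rot_nth nx_simps w by Groebner_Basis.algebra
  next
    case 3
    show ?thesis unfolding 3 law0_def law1_def rot_nth nx_simps w by Groebner_Basis.algebra
  qed
qed

text \<open>The sum is the base point of \<open>phi i\<close> iff the third point of the chord is \<open>flex (partner i)\<close>.\<close>

definition partner :: "3 \<Rightarrow> 3" where
  "partner i = (if i = 1 then 1 else if i = 2 then 3 else 2)"

lemma law_swap:
  assumes "F x = 0"
  shows "law0 (rot i x) (swap (partner i) x) * \<delta> = law1 (rot i x) (swap (partner i) x) * 3"
proof -
  have "law0 (rot i x) (swap (partner i) x) = 3 * (x$1 * x$2 * x$3)"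
    "law1 (rot i x) (swap (partner i) x) = x$1^3 + x$2^3 + x$3^3"
    using exhaust_3[of i]
    by (auto simp: law0_def law1_def rot_def swap_def partner_def power3_eq_cube power2_eq_square)
  moreover have "x$1^3 + x$2^3 + x$3^3 = \<delta> * (x$1 * x$2 * x$3)"
    using assms by (simp add: hessian_eq_def mult.assoc)
  ultimately show ?thesis by simp
qed

lemma law_scale_right:
  assumes "\<And>i. y$i = c * x$i"
  shows "law0 z y = c^2 * law0 z x" "law1 z y = c^2 * law1 z x"
  unfolding law0_def law1_def assms by Groebner_Basis.algebra+

text \<open>The assumptions put \<open>swap 1 r\<close> at the base point \<open>flex i\<close>;
  negation fixes \<open>flex 1\<close> and exchanges \<open>flex 2\<close> and
  \<open>flex 3\<close>.\<close>

lemma swap_1_flex: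
  assumes "swap 1 r $ i = 0" "swap 1 r $ nx i + swap 1 r $ nx (nx i) = 0"
  shows "r $ k = r $ nx (nx (partner i)) * flex (partner i) $ k"
proof -
  let ?j = "partner i"
  have r: "r$?j = 0" "r$nx ?j = - r$nx (nx ?j)"
    using assms exhaust_3[of i]
    by (auto simp: swap_def partner_def eq_neg_iff_add_eq_0 add.commute[of "r$1"] add.commute[of "r$2" "r$3"])
  show ?thesis
    using exhaust_nx[of k ?j] by (elim disjE) (simp_all add: r)
qed

lemma addition_law:
  assumes x: "x \<noteq> 0" "F x = 0" and y: "y \<noteq> 0" "F y = 0"
    and nz: "law0 (rot i x) y \<noteq> 0 \<or> law1 (rot i x) y \<noteq> 0"
  shows "pt (vector [law0 (rot i x) y, law1 (rot i x) y]) = phi i (hessian_add 1 d (pt x) (pt y))"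
proof -
  obtain r where r: "r \<noteq> 0" "F r = 0" "third_point 1 d (pt x) (pt y) = pt r"
    and eq: "law0 (rot i x) y * (swap 1 r$(nx i) + swap 1 r$(nx (nx i))) + law1 (rot i x) y * swap 1 r$i = 0"
  proof (cases "pt x = pt y")
    case True
    then obtain c where c: "\<And>i. y$i = c * x$i" using pt_eq_iff x y by metis
    show ?thesis
    proof (rule that[of "tangential x"])
      show "law0 (rot i x) y * (swap 1 (tangential x)$(nx i) + swap 1 (tangential x)$(nx (nx i))) +
          law1 (rot i x) y * swap 1 (tangential x)$i = 0"
        using law_tangent[of i x] unfolding law_scale_right[OF c] by Groebner_Basis.algebra
      show "third_point 1 d (pt x) (pt y) = pt (tangential x)"
        using third_point_tangential[OF x] True by simp
    qed (use tangential_nonzero F_tangential x in auto)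
  next
    case False
    have "third x y \<noteq> 0"
      by (rule third_nonzero[OF x(2) y(2) indepI[OF x(1) y(1) False]])
    then show ?thesis
      by (rule that[of "third x y"]) (use F_third third_point_third law_chord x y False in auto)
  qed
  define w where "w = swap 1 r"
  have w0: "w \<noteq> 0" using r by (simp add: w_def swap_nonzero)
  have add: "hessian_add 1 d (pt x) (pt y) = pt w"
    using hessian_add_pt r by (simp add: w_def)
  show ?thesis
  proof (cases "w$i \<noteq> 0 \<or> w$(nx i) + w$(nx (nx i)) \<noteq> 0")
    case True
    then have "pt (vector [law0 (rot i x) y, law1 (rot i x) y]) =
        (pt (vector [w$i, - (w$(nx i) + w$(nx (nx i)))]) :: 'a line)"
      using nz eq by (intro pt_vector2_neg) (auto simp: w_def)
    then show ?thesis unfolding add phi_pt[OF w0] using True by simp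
  next
    \<comment> \<open>Both coefficients in \<open>eq\<close> vanish here, so it gives no
      information. Instead collinearity of \<open>x\<close>, \<open>y\<close> and
      \<open>flex ?j\<close> is read as determining \<open>y\<close> from \<open>x\<close>.\<close>
    case False
    let ?j = "partner i"
    have rO: "r$k = r$(nx (nx ?j)) * flex ?j $ k" for k
      by (rule swap_1_flex) (use False in \<open>simp_all add: w_def\<close>)
    have "r$(nx (nx ?j)) \<noteq> 0"
      using r(1) rO unfolding vec_eq_iff zero_index by (metis mult_zero_left)
    then have "pt (flex ?j) = pt r"
      using flex_nonzero rO by (rule pt_scale)
    then have "LS (pt x) (pt y) (pt (flex ?j))"
      using LS_iff_third_point[OF x y] r by simp
    then have "LS (pt x) (pt (flex ?j)) (pt y)" by (rule LS_rotate)
    then have "pt y = pt (swap ?j x)"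
      using LS_iff_third_point[OF x flex_nonzero F_flex] third_point_flex[OF x] by simp
    then obtain c where c: "\<And>k. y$k = c * swap ?j x $ k"
      using pt_eq_iff[OF swap_nonzero[OF x(1)] y(1)] by metis
    have "law0 (rot i x) y * \<delta> = law1 (rot i x) y * 3"
      unfolding law_scale_right[OF c] using law_swap[OF x(2)] by (simp add: mult.assoc)
    then have "pt (vector [law0 (rot i x) y, law1 (rot i x) y]) = (pt (vector [3, \<delta>]) :: 'a line)"
      using nz by (subst pt_vector2_eq) auto
    then show ?thesis unfolding add phi_pt[OF w0] using False by simp
  qed
qed

text \<open>Shows that no law lies in the ideal of the product of the curve with itself.\<close>

lemma law0_flex: "law0 (rot i (flex i)) (flex 3) = (1 :: 'k::field)"
  using exhaust_3[of i] by (auto simp: law0_def rot_def flex_def)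

end

section \<open>Forms vanishing on the curve\<close>

text \<open>Polynomial in each variable separately is enough for vanishing arguments, and it lets
  coefficients be handled as plain functions of two arguments.\<close>

definition sep_poly :: "('k::field \<Rightarrow> 'k \<Rightarrow> 'k) \<Rightarrow> bool" where
  "sep_poly r \<longleftrightarrow> (\<forall>y. \<exists>p. \<forall>x. r x y = poly p x) \<and> (\<forall>x. \<exists>p. \<forall>y. r x y = poly p y)"

lemma sep_poly_const: "sep_poly (\<lambda>x y. c)"
  unfolding sep_poly_def by (intro conjI allI exI[of _ "[:c:]"]) auto

lemma sep_poly_fst: "sep_poly (\<lambda>x y. x :: 'k::field)"
  and sep_poly_snd: "sep_poly (\<lambda>x y. y :: 'k)"
proof -
  have "\<exists>p. \<forall>x. x = poly p (x :: 'k)"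
    by (intro exI[of _ "[:0, 1:]"]) auto
  moreover have "\<exists>p. \<forall>y. c = poly p (y :: 'k)" for c
    by (intro exI[of _ "[:c:]"]) auto
  ultimately show "sep_poly (\<lambda>x y. x :: 'k)" "sep_poly (\<lambda>x y. y :: 'k)"
    unfolding sep_poly_def by blast+
qed

lemma sep_poly_add: "sep_poly r \<Longrightarrow> sep_poly s \<Longrightarrow> sep_poly (\<lambda>x y. r x y + s x y)"
  unfolding sep_poly_def by (metis poly_add)

lemma sep_poly_mult: "sep_poly r \<Longrightarrow> sep_poly s \<Longrightarrow> sep_poly (\<lambda>x y. r x y * s x y)"
  unfolding sep_poly_def by (metis poly_mult)

lemma sep_poly_uminus: "sep_poly r \<Longrightarrow> sep_poly (\<lambda>x y. - r x y)"
  unfolding sep_poly_def by (metis poly_minus)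

lemma sep_poly_diff: "sep_poly r \<Longrightarrow> sep_poly s \<Longrightarrow> sep_poly (\<lambda>x y. r x y - s x y)"
  unfolding sep_poly_def by (metis poly_diff)

lemma sep_poly_power: "sep_poly r \<Longrightarrow> sep_poly (\<lambda>x y. r x y ^ n)"
  by (induction n) (simp_all add: sep_poly_const sep_poly_mult)

lemmas sep_poly_intros = sep_poly_const sep_poly_fst sep_poly_snd sep_poly_add sep_poly_mult
  sep_poly_uminus sep_poly_diff sep_poly_power

text \<open>For each \<open>y \<noteq> 0\<close> the polynomial in \<open>x\<close> has too many
  zeros; then the same holds in \<open>y\<close>.\<close>

lemma sep_poly_zero:
  fixes r :: "'k::alg_closed_field \<Rightarrow> 'k \<Rightarrow> 'k"
  assumes "sep_poly r"
    and "\<And>y. y \<noteq> 0 \<Longrightarrow> \<exists>S. finite S \<and> (\<forall>x. x \<notin> S \<longrightarrow> r x y = 0)"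
  shows "r x y = 0"
proof -
  have *: "r x y = 0" if y: "y \<noteq> 0" for x y
  proof -
    obtain p where p: "\<And>x. r x y = poly p x" using assms(1) unfolding sep_poly_def by metis
    obtain S where "finite S" "\<And>x. x \<notin> S \<Longrightarrow> r x y = 0" using assms(2)[OF y] by blast
    then have "p = 0" using p by (intro poly_eq_0_if_cofinite[of S]) auto
    then show ?thesis using p by simp
  qed
  obtain p where p: "\<And>y. r x y = poly p y" using assms(1) unfolding sep_poly_def by metis
  have "p = 0" using * by (intro poly_eq_0_if_cofinite[of "{0}"]) (auto simp flip: p)
  then show ?thesis using p by simp
qed

lemma monic_quadratic_splits:
  obtains r s :: "'k::alg_closed_field" where "\<And>z. z^2 + b * z + c = (z - r) * (z - s)"
proof -
  have "Polynomial.degree [:c, b, 1::'k:] > 0" by simp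
  then obtain r where r: "poly [:c, b, 1:] r = 0"
    using alg_closed_imp_poly_has_root by blast
  have "z^2 + b * z + c = (z - r) * (z - (- b - r))" for z
  proof -
    have "r^2 + b * r + c = 0" using r by (simp add: algebra_simps power2_eq_square)
    then show ?thesis by Groebner_Basis.algebra
  qed
  with that show ?thesis by blast
qed

lemma monic_cubic_splits:
  obtains r s t :: "'k::alg_closed_field"
  where "\<And>z. z^3 + b * z + c = (z - r) * (z - s) * (z - t)"
proof -
  have "Polynomial.degree [:c, b, 0, 1::'k:] > 0" by simp
  then obtain r where r: "poly [:c, b, 0, 1:] r = 0"
    using alg_closed_imp_poly_has_root by blast
  obtain s t where st: "\<And>z. z^2 + r * z + (r^2 + b) = (z - s) * (z - t)"
    by (rule monic_quadratic_splits[of r "r^2 + b"]) (rule that)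
  have "z^3 + b * z + c = (z - r) * (z^2 + r * z + (r^2 + b))" for z
  proof -
    have "r^3 + b * r + c = 0" using r by (simp add: algebra_simps power3_eq_cube)
    then show ?thesis by Groebner_Basis.algebra
  qed
  with st that show ?thesis by (metis mult.assoc)
qed

lemma quadratic_three_roots:
  fixes a b c :: "'k::field"
  assumes "a + b * r + c * r^2 = 0" "a + b * s + c * s^2 = 0" "a + b * t + c * t^2 = 0"
    and "r \<noteq> s" "r \<noteq> t" "s \<noteq> t"
  shows "a = 0" "b = 0" "c = 0"
proof -
  have 1: "(r - s) * (b + c * (r + s)) = 0" "(r - t) * (b + c * (r + t)) = 0"
    using assms(1-3) by Groebner_Basis.algebra+
  then have 2: "b + c * (r + s) = 0" "b + c * (r + t) = 0" using assms by auto
  then have "c * (s - t) = 0" by Groebner_Basis.algebra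
  then show "c = 0" using assms by simp
  with 2 show "b = 0" by simp
  with \<open>c = 0\<close> assms(1) show "a = 0" by simp
qed

lemma reduce_product:
  fixes z :: "'k::field"
  assumes "z^3 = e * z - c"
  shows "(a0 + a1 * z + a2 * z^2) * (b0 + b1 * z + b2 * z^2) =
    (a0 * b0 - (a1 * b2 + a2 * b1) * c) +
    (a0 * b1 + a1 * b0 + (a1 * b2 + a2 * b1) * e - (a2 * b2) * c) * z +
    (a0 * b2 + a1 * b1 + a2 * b0 + (a2 * b2) * e) * z^2"
proof -
  have "(a0 + a1 * z + a2 * z^2) * (b0 + b1 * z + b2 * z^2) =
    a0 * b0 + (a0 * b1 + a1 * b0) * z + (a0 * b2 + a1 * b1 + a2 * b0) * z^2 +
      (a1 * b2 + a2 * b1) * z^3 + a2 * b2 * z * z^3"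
    by (simp add: algebra_simps power2_eq_square power3_eq_cube)
  then show ?thesis
    unfolding assms by (simp add: algebra_simps power2_eq_square)
qed

context hessian_curve
begin

lemma F_vec3: "F (vector [x, y, z]) = z^3 + (- \<delta> * x * y) * z + (x^3 + y^3)"
  by (simp add: hessian_eq_def algebra_simps)

text \<open>For almost all \<open>(x : y)\<close> there are three points \<open>(x, y, z)\<close> on the curve: a double root
  in \<open>z\<close> forces \<open>4 \<delta>\<^sup>3 x\<^sup>3 y\<^sup>3 = 27 (x\<^sup>3 + y\<^sup>3)\<^sup>2\<close>, whose coefficient of \<open>x\<^sup>6\<close> is nonzero.\<close>

lemma reduced_zero:
  assumes sep: "sep_poly r0" "sep_poly r1" "sep_poly r2"
    and fin: "finite S"
    and zero: "\<And>x. x \<noteq> 0 \<Longrightarrow> F x = 0 \<Longrightarrow> pt x \<notin> S \<Longrightarrow> r0 (x$1) (x$2) + r1 (x$1) (x$2) * x$3 + r2 (x$1) (x$2) * x$3^2 = 0"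
  shows "r0 x y = 0" "r1 x y = 0" "r2 x y = 0"
proof -
  have *: "\<exists>S'. finite S' \<and> (\<forall>x. x \<notin> S' \<longrightarrow> r0 x y = 0 \<and> r1 x y = 0 \<and> r2 x y = 0)"
    if y: "y \<noteq> 0" for y
  proof -
    \<comment> \<open>Up to sign the discriminant of the cubic in \<open>Z\<close>, as a polynomial
      in \<open>x\<close>.\<close>
    define D where "D = [:27 * y^6, 0, 0, 54 * y^3 - 4 * \<delta>^3 * y^3, 0, 0, 27:]"
    have D: "poly D x = 27 * (x^3 + y^3)^2 - 4 * \<delta>^3 * x^3 * y^3" for x
      by (simp add: D_def) Groebner_Basis.algebra
    have "(27 :: 'a alg_closure) = 3^3" by simp
    then have "(27 :: 'a alg_closure) \<noteq> 0" using three_ac by (metis power_not_zero)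
    then have "D \<noteq> 0" by (simp add: D_def)
    then have fin1: "finite {x. poly D x = 0}" by (rule poly_roots_finite)
    \<comment> \<open>Also excluded are the \<open>x\<close> for which some point
      \<open>(x, y, z)\<close> lies in \<open>S\<close>. A zero second coordinate makes the quotient
      0, which merely excludes \<open>x = 0\<close> as well.\<close>
    define S' where "S' = {x. poly D x = 0} \<union> (\<lambda>P. y * (coords_of P $ 1 / coords_of P $ 2)) ` S"
    have "r0 x y = 0 \<and> r1 x y = 0 \<and> r2 x y = 0" if x: "x \<notin> S'" for x
    proof -
      obtain r s t where roots: "\<And>z. z^3 + (- \<delta> * x * y) * z + (x^3 + y^3) = (z - r) * (z - s) * (z - t)"
        by (rule monic_cubic_splits[of "- \<delta> * x * y" "x^3 + y^3"]) (rule that)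
      have double: "False" if "\<And>z. z^3 + (- \<delta> * x * y) * z + (x^3 + y^3) = (z - r) * (z - r) * (z - s)"
        for r s
      proof -
        let ?p = "[:x^3 + y^3, - \<delta> * x * y, 0, 1:]"
        let ?q = "[:-r, 1:] * [:-r, 1:] * [:-s, 1:]"
        have "poly (?p - ?q) z = 0" for z
          using that[of z] by (simp add: power3_eq_cube) Groebner_Basis.algebra
        then have "?p - ?q = 0" by (intro poly_eq_0_if_cofinite[of "{}"]) auto
        then have "s = - 2 * r" "- \<delta> * x * y = r * r + 2 * r * s" "x^3 + y^3 = - (r * r * s)"
          by (simp_all add: algebra_simps eq_neg_iff_add_eq_0)
        then have "\<delta> * x * y = 3 * r^2" "x^3 + y^3 = 2 * r^3"
          by Groebner_Basis.algebra+
        then have "27 * (x^3 + y^3)^2 - 4 * \<delta>^3 * x^3 * y^3 = 0" by Groebner_Basis.algebra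
        then have "poly D x = 0" by (simp add: D)
        with x show False by (simp add: S'_def)
      qed
      have "r \<noteq> s" using double[of r t] roots by auto
      moreover have "r \<noteq> t" using double[of r s] roots by (auto simp: mult_ac)
      moreover have "s \<noteq> t" using double[of s r] roots by (auto simp: mult_ac)
      moreover have "r0 x y + r1 x y * z + r2 x y * z^2 = 0" if z: "z \<in> {r, s, t}" for z
      proof -
        define v where "v = (vector [x, y, z] :: 'a alg_closure ^ 3)"
        have v: "v$1 = x" "v$2 = y" "v$3 = z" by (simp_all add: v_def)
        have v0: "v \<noteq> 0" using y v(2) by auto
        have "F v = 0" using roots[of z] z by (auto simp: v_def F_vec3)
        moreover have "pt v \<notin> S"
        proof
          assume "pt v \<in> S"
          obtain c where c: "c \<noteq> 0" "\<And>i. coords_of (pt v) $ i = c * v$i"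
            by (rule coords_of_pt[OF v0]) (rule that)
          then have "x = y * (coords_of (pt v) $ 1 / coords_of (pt v) $ 2)"
            using y by (simp add: v)
          then have "x \<in> S'" using \<open>pt v \<in> S\<close> unfolding S'_def by blast
          with x show False by simp
        qed
        ultimately show ?thesis using zero[of v] v0 v by simp
      qed
      ultimately show ?thesis using quadratic_three_roots[of "r0 x y" "r1 x y" r "r2 x y" s t] by simp
    qed
    moreover have "finite S'" using fin fin1 by (simp add: S'_def)
    ultimately show ?thesis by blast
  qed
  show "r0 x y = 0" "r1 x y = 0" "r2 x y = 0"
    using sep_poly_zero[OF sep(1)] sep_poly_zero[OF sep(2)] sep_poly_zero[OF sep(3)] * by meson+
qed

text \<open>Modulo the equation of the curve every polynomial has degree at most 2 in \<open>Z\<close>.\<close>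

definition reducible_mod :: "((3 \<Rightarrow> 'a alg_closure) \<Rightarrow> 'a alg_closure) \<Rightarrow> bool" where
  "reducible_mod g \<longleftrightarrow> (\<exists>r0 r1 r2. sep_poly r0 \<and> sep_poly r1 \<and> sep_poly r2 \<and>
     (\<forall>x. F x = 0 \<longrightarrow> g (($) x) = r0 (x$1) (x$2) + r1 (x$1) (x$2) * x$3 + r2 (x$1) (x$2) * x$3^2))"

lemma reducible_modI:
  assumes "sep_poly r0" "sep_poly r1" "sep_poly r2"
    and "\<And>x. F x = 0 \<Longrightarrow> g (($) x) = r0 (x$1) (x$2) + r1 (x$1) (x$2) * x$3 + r2 (x$1) (x$2) * x$3^2"
  shows "reducible_mod g"
  unfolding reducible_mod_def
  by (rule exI[of _ r0], rule exI[of _ r1], rule exI[of _ r2]) (use assms in simp)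

lemma reducible_mod_peval: "reducible_mod (peval p)"
proof (rule peval_closure)
  show "reducible_mod (\<lambda>x. to_ac c)" for c
    by (rule reducible_modI[of "\<lambda>x y. to_ac c" "\<lambda>x y. 0" "\<lambda>x y. 0"])
      (simp_all add: sep_poly_const)
  show "reducible_mod (\<lambda>x. x v)" for v
  proof -
    consider "v = 1" | "v = 2" | "v = 3" using exhaust_3 by blast
    then show ?thesis
    proof cases
      case 1
      show ?thesis unfolding 1
        by (rule reducible_modI[of "\<lambda>x y. x" "\<lambda>x y. 0" "\<lambda>x y. 0"])
          (simp_all add: sep_poly_const sep_poly_fst sep_poly_snd)
    next
      case 2
      show ?thesis unfolding 2
        by (rule reducible_modI[of "\<lambda>x y. y" "\<lambda>x y. 0" "\<lambda>x y. 0"])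
          (simp_all add: sep_poly_const sep_poly_fst sep_poly_snd)
    next
      case 3
      show ?thesis unfolding 3
        by (rule reducible_modI[of "\<lambda>x y. 0" "\<lambda>x y. 1" "\<lambda>x y. 0"]) (simp_all add: sep_poly_const)
    qed
  qed
next
  fix f g
  assume fg: "reducible_mod f" "reducible_mod g"
  from fg(1) obtain f0 f1 f2 where f: "sep_poly f0 \<and> sep_poly f1 \<and> sep_poly f2 \<and>
     (\<forall>x. F x = 0 \<longrightarrow> f (($) x) = f0 (x$1) (x$2) + f1 (x$1) (x$2) * x$3 + f2 (x$1) (x$2) * x$3^2)"
    unfolding reducible_mod_def by (elim exE) (rule that)
  from fg(2) obtain g0 g1 g2 where g: "sep_poly g0 \<and> sep_poly g1 \<and> sep_poly g2 \<and>
     (\<forall>x. F x = 0 \<longrightarrow> g (($) x) = g0 (x$1) (x$2) + g1 (x$1) (x$2) * x$3 + g2 (x$1) (x$2) * x$3^2)"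
    unfolding reducible_mod_def by (elim exE) (rule that)
  have sep: "sep_poly f0" "sep_poly f1" "sep_poly f2" "sep_poly g0" "sep_poly g1" "sep_poly g2"
    using f g by simp_all
  have f: "f (($) x) = f0 (x$1) (x$2) + f1 (x$1) (x$2) * x$3 + f2 (x$1) (x$2) * x$3^2"
    and g: "g (($) x) = g0 (x$1) (x$2) + g1 (x$1) (x$2) * x$3 + g2 (x$1) (x$2) * x$3^2"
    if "F x = 0" for x
    using f g that by simp_all
  show "reducible_mod (\<lambda>x. f x + g x)"
    by (rule reducible_modI[of "\<lambda>x y. f0 x y + g0 x y" "\<lambda>x y. f1 x y + g1 x y" "\<lambda>x y. f2 x y + g2 x y"])
      (simp_all add: sep_poly_add sep f g algebra_simps)
  define h3 where "h3 x y = f1 x y * g2 x y + f2 x y * g1 x y" for x y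
  define h4 where "h4 x y = f2 x y * g2 x y" for x y
  have sep34: "sep_poly h3" "sep_poly h4"
    unfolding h3_def[abs_def] h4_def[abs_def] by (simp_all add: sep_poly_add sep_poly_mult sep)
  have "f (($) x) * g (($) x) =
      (f0 (x$1) (x$2) * g0 (x$1) (x$2) - h3 (x$1) (x$2) * (x$1^3 + x$2^3)) +
      (f0 (x$1) (x$2) * g1 (x$1) (x$2) + f1 (x$1) (x$2) * g0 (x$1) (x$2) +
        h3 (x$1) (x$2) * (\<delta> * x$1 * x$2) - h4 (x$1) (x$2) * (x$1^3 + x$2^3)) * x$3 +
      (f0 (x$1) (x$2) * g2 (x$1) (x$2) + f1 (x$1) (x$2) * g1 (x$1) (x$2) + f2 (x$1) (x$2) * g0 (x$1) (x$2) +
        h4 (x$1) (x$2) * (\<delta> * x$1 * x$2)) * x$3^2"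
    if "F x = 0" for x
  proof -
    have "x$3^3 = (\<delta> * x$1 * x$2) * x$3 - (x$1^3 + x$2^3)"
      using that by (simp add: hessian_eq_def algebra_simps)
    then show ?thesis
      unfolding f[OF that] g[OF that] h3_def h4_def by (rule reduce_product)
  qed
  then show "reducible_mod (\<lambda>x. f x * g x)"
    by (rule reducible_modI[of "\<lambda>x y. f0 x y * g0 x y - h3 x y * (x^3 + y^3)"
        "\<lambda>x y. f0 x y * g1 x y + f1 x y * g0 x y + h3 x y * (\<delta> * x * y) - h4 x y * (x^3 + y^3)"
        "\<lambda>x y. f0 x y * g2 x y + f1 x y * g1 x y + f2 x y * g0 x y + h4 x y * (\<delta> * x * y)", rotated -1])
      (assumption | intro sep_poly_intros sep sep34)+
qed

text \<open>Used where one would invoke irreducibility of the curve: the three coefficients of the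
  reduced form vanish identically.\<close>

lemma form_zero_if_cofinite:
  assumes "finite S" "\<And>x. x \<noteq> 0 \<Longrightarrow> F x = 0 \<Longrightarrow> pt x \<notin> S \<Longrightarrow> peval p (($) x) = 0"
    and "F x = 0"
  shows "peval p (($) x) = 0"
proof -
  obtain r0 r1 r2 where r: "sep_poly r0 \<and> sep_poly r1 \<and> sep_poly r2 \<and>
     (\<forall>x. F x = 0 \<longrightarrow> peval p (($) x) = r0 (x$1) (x$2) + r1 (x$1) (x$2) * x$3 + r2 (x$1) (x$2) * x$3^2)"
    using reducible_mod_peval[of p] unfolding reducible_mod_def by (elim exE) (rule that)
  then have sep: "sep_poly r0" "sep_poly r1" "sep_poly r2" by simp_all
  have r: "peval p (($) x) = r0 (x$1) (x$2) + r1 (x$1) (x$2) * x$3 + r2 (x$1) (x$2) * x$3^2"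
    if "F x = 0" for x
    using r that by simp
  have "r0 (x$1) (x$2) + r1 (x$1) (x$2) * x$3 + r2 (x$1) (x$2) * x$3^2 = 0"
    if "x \<noteq> 0" "F x = 0" "pt x \<notin> S" for x
    using assms(2)[OF that] r[OF that(2)] by simp
  note reduced_zero[OF sep assms(1) this]
  then show ?thesis unfolding r[OF assms(3)] by simp
qed

end

section \<open>Uniqueness of addition law projections\<close>

lemma bieval_simps:
  "bieval (p + q) x y = bieval p x y + bieval q x y"
  "bieval (p - q) x y = bieval p x y - bieval q x y"
  "bieval (p * q) x y = bieval p x y * bieval q x y"
  "bieval (p ^ n) x y = bieval p x y ^ n"
  "bieval (Const c) x y = to_ac c"
  "bieval (Var (Inl i)) x y = x$i"
  "bieval (Var (Inr i)) x y = y$i"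
  by (simp_all add: bieval_def peval_simps)

lemma bieval_sum_monomials:
  "bieval p x y = (\<Sum>e\<in>Poly_Mapping.keys p. to_ac (Poly_Mapping.lookup p e) *
     ((\<Prod>i\<in>UNIV. x$i ^ Poly_Mapping.lookup e (Inl i)) * (\<Prod>i\<in>UNIV. y$i ^ Poly_Mapping.lookup e (Inr i))))"
proof -
  have "(\<Prod>v\<in>UNIV. case_sum (($) x) (($) y) v ^ Poly_Mapping.lookup e v) =
    (\<Prod>i\<in>UNIV. x$i ^ Poly_Mapping.lookup e (Inl i)) * (\<Prod>i\<in>UNIV. y$i ^ Poly_Mapping.lookup e (Inr i))"
    for e :: "3 + 3 \<Rightarrow>\<^sub>0 nat"
    by (subst UNIV_Plus_UNIV[symmetric], subst prod.Plus) simp_all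
  then show ?thesis by (simp add: bieval_def peval_def)
qed

lemma monomial_factor:
  assumes "(\<Sum>i\<in>(UNIV :: 3 set). e i) = Suc n"
  obtains i e' where "(\<Sum>i\<in>UNIV. e' i) = n"
    "\<And>x :: 'k::field ^ 3. (\<Prod>i\<in>UNIV. x$i ^ e i) = x$i * (\<Prod>i\<in>UNIV. x$i ^ e' i)"
proof -
  obtain i where i: "e i \<noteq> 0"
    using assms by (metis sum.neutral nat.distinct(1))
  define e' where "e' = e(i := e i - 1)"
  have "(\<Sum>j\<in>UNIV. e j) = e i + (\<Sum>j\<in>UNIV-{i}. e j)" "(\<Sum>j\<in>UNIV. e' j) = e' i + (\<Sum>j\<in>UNIV-{i}. e' j)"
    by (simp_all add: sum.remove)
  moreover have "(\<Sum>j\<in>UNIV-{i}. e' j) = (\<Sum>j\<in>UNIV-{i}. e j)"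
    by (intro sum.cong) (auto simp: e'_def)
  ultimately have "(\<Sum>j\<in>UNIV. e' j) = n" using assms i by (simp add: e'_def)
  moreover have "(\<Prod>j\<in>UNIV. x$j ^ e j) = x$i * (\<Prod>j\<in>UNIV. x$j ^ e' j)" for x :: "'k ^ 3"
  proof -
    have "(\<Prod>j\<in>UNIV. x$j ^ e j) = x$i ^ e i * (\<Prod>j\<in>UNIV-{i}. x$j ^ e j)"
      "(\<Prod>j\<in>UNIV. x$j ^ e' j) = x$i ^ e' i * (\<Prod>j\<in>UNIV-{i}. x$j ^ e' j)"
      by (simp_all add: prod.remove)
    moreover have "(\<Prod>j\<in>UNIV-{i}. x$j ^ e' j) = (\<Prod>j\<in>UNIV-{i}. x$j ^ e j)"
      by (intro prod.cong) (auto simp: e'_def)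
    moreover have "x$i ^ e i = x$i * x$i ^ e' i"
      using i by (simp add: e'_def power_eq_if)
    ultimately show ?thesis by (simp add: mult.assoc)
  qed
  ultimately show ?thesis by (rule that)
qed

lemma monomial_degree_1:
  assumes "(\<Sum>i\<in>(UNIV :: 3 set). e i) = (1 :: nat)"
  obtains i where "\<And>x :: 'k::field ^ 3. (\<Prod>i\<in>UNIV. x$i ^ e i) = x$i"
proof -
  have "(\<Sum>i\<in>(UNIV :: 3 set). e i) = Suc 0" using assms by simp
  then obtain i e' where e': "(\<Sum>i\<in>UNIV. e' i) = 0"
    "\<And>x :: 'k ^ 3. (\<Prod>i\<in>UNIV. x$i ^ e i) = x$i * (\<Prod>i\<in>UNIV. x$i ^ e' i)"
    by (rule monomial_factor) (rule that)
  then have "(\<Prod>i\<in>UNIV. x$i ^ e i) = x$i" for x :: "'k ^ 3" by simp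
  then show ?thesis by (rule that)
qed

lemma monomial_degree_2:
  assumes "(\<Sum>i\<in>(UNIV :: 3 set). e i) = (2 :: nat)"
  obtains i j where "\<And>x :: 'k::field ^ 3. (\<Prod>i\<in>UNIV. x$i ^ e i) = x$i * x$j"
proof -
  have "(\<Sum>i\<in>(UNIV :: 3 set). e i) = Suc 1" using assms by simp
  then obtain i e' where e': "(\<Sum>i\<in>UNIV. e' i) = 1"
    "\<And>x :: 'k ^ 3. (\<Prod>i\<in>UNIV. x$i ^ e i) = x$i * (\<Prod>i\<in>UNIV. x$i ^ e' i)"
    by (rule monomial_factor) (rule that)
  obtain j where "\<And>x :: 'k ^ 3. (\<Prod>i\<in>UNIV. x$i ^ e' i) = x$j"
    using e'(1) by (rule monomial_degree_1) (rule that)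
  then have "(\<Prod>i\<in>UNIV. x$i ^ e i) = x$i * x$j" for x :: "'k ^ 3" using e'(2) by simp
  then show ?thesis by (rule that)
qed

text \<open>General shape of a polynomial of bidegree \<open>(1, 2)\<close>. The array is not
  symmetrized in \<open>j\<close>, \<open>k\<close>, which would require division by 2; for
  \<open>j \<noteq> k\<close> only \<open>g i j k + g i k j\<close> matters.\<close>

definition trilinear :: "(3 \<Rightarrow> 3 \<Rightarrow> 3 \<Rightarrow> 'a::field) \<Rightarrow> 'a alg_closure ^ 3 \<Rightarrow> 'a alg_closure ^ 3 \<Rightarrow> 'a alg_closure" where
  "trilinear g x y = (\<Sum>i\<in>UNIV. x$i * (\<Sum>j\<in>UNIV. \<Sum>k\<in>UNIV. to_ac (g i j k) * (y$j * y$k)))"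

lemma trilinear_add:
  "trilinear (\<lambda>i j k. g i j k + h i j k) x y = trilinear g x y + trilinear h x y"
  by (simp add: trilinear_def sum.distrib algebra_simps)

lemma trilinear_monomial:
  "trilinear (\<lambda>i' j' k'. if i' = i \<and> j' = j \<and> k' = k then c else 0) x y = to_ac c * (x$i * (y$j * y$k))"
  using exhaust_3[of i] exhaust_3[of j] exhaust_3[of k]
  by (elim disjE) (simp_all add: trilinear_def sum_3)

lemma trilinear_sum:
  fixes f :: "'b \<Rightarrow> 'a::field alg_closure ^ 3 \<Rightarrow> 'a alg_closure ^ 3 \<Rightarrow> 'a alg_closure"
  assumes "finite A" "\<And>a. a \<in> A \<Longrightarrow> \<exists>g. \<forall>x y. f a x y = trilinear g x y"
  shows "\<exists>g. \<forall>x y. (\<Sum>a\<in>A. f a x y) = trilinear g x y"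
  using assms
proof (induction A)
  case empty
  have "trilinear (\<lambda>i j k. 0) x y = 0" for x y :: "'a alg_closure ^ 3" by (simp add: trilinear_def)
  then show ?case by (metis sum.empty)
next
  case (insert a A)
  then obtain g h where "\<forall>x y. f a x y = trilinear g x y" "\<forall>x y. (\<Sum>a\<in>A. f a x y) = trilinear h x y"
    by (metis insert_iff)
  then have "(\<Sum>a\<in>insert a A. f a x y) = trilinear (\<lambda>i j k. g i j k + h i j k) x y" for x y
    using insert.hyps by (simp add: trilinear_add)
  then show ?case by blast
qed

lemma biform_1_2:
  assumes "biform 1 2 (p :: 'a::field bipoly)"
  shows "\<exists>g. \<forall>x y. bieval p x y = trilinear g x y"
  unfolding bieval_sum_monomials
proof (rule trilinear_sum)
  fix e assume "e \<in> Poly_Mapping.keys p"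
  then have e: "(\<Sum>i\<in>UNIV. Poly_Mapping.lookup e (Inl i)) = 1" "(\<Sum>i\<in>UNIV. Poly_Mapping.lookup e (Inr i)) = 2"
    using assms by (auto simp: biform_def)
  obtain i where i: "\<And>x :: 'a alg_closure ^ 3. (\<Prod>i\<in>UNIV. x$i ^ Poly_Mapping.lookup e (Inl i)) = x$i"
    by (rule monomial_degree_1[OF e(1)]) (rule that)
  obtain j k where jk: "\<And>x :: 'a alg_closure ^ 3. (\<Prod>i\<in>UNIV. x$i ^ Poly_Mapping.lookup e (Inr i)) = x$j * x$k"
    by (rule monomial_degree_2[OF e(2)]) (rule that)
  show "\<exists>g. \<forall>x y :: 'a alg_closure ^ 3. to_ac (Poly_Mapping.lookup p e) *
     ((\<Prod>i\<in>UNIV. x$i ^ Poly_Mapping.lookup e (Inl i)) * (\<Prod>i\<in>UNIV. y$i ^ Poly_Mapping.lookup e (Inr i))) =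
     trilinear g x y"
    unfolding i jk trilinear_monomial[symmetric] by blast
qed simp

lemma biform_2_1:
  assumes "biform 2 1 (p :: 'a::field bipoly)"
  shows "\<exists>g. \<forall>x y. bieval p x y = trilinear g y x"
proof -
  have "\<exists>g. \<forall>y x. bieval p x y = trilinear g y x"
    unfolding bieval_sum_monomials
  proof (rule trilinear_sum)
    fix e assume "e \<in> Poly_Mapping.keys p"
    then have e: "(\<Sum>i\<in>UNIV. Poly_Mapping.lookup e (Inl i)) = 2" "(\<Sum>i\<in>UNIV. Poly_Mapping.lookup e (Inr i)) = 1"
      using assms by (auto simp: biform_def)
    obtain i where i: "\<And>x :: 'a alg_closure ^ 3. (\<Prod>i\<in>UNIV. x$i ^ Poly_Mapping.lookup e (Inr i)) = x$i"
      by (rule monomial_degree_1[OF e(2)]) (rule that)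
    obtain j k where jk: "\<And>x :: 'a alg_closure ^ 3. (\<Prod>i\<in>UNIV. x$i ^ Poly_Mapping.lookup e (Inl i)) = x$j * x$k"
      by (rule monomial_degree_2[OF e(1)]) (rule that)
    show "\<exists>g. \<forall>y x :: 'a alg_closure ^ 3. to_ac (Poly_Mapping.lookup p e) *
       ((\<Prod>i\<in>UNIV. x$i ^ Poly_Mapping.lookup e (Inl i)) * (\<Prod>i\<in>UNIV. y$i ^ Poly_Mapping.lookup e (Inr i))) =
       trilinear g y x"
      unfolding i jk mult.commute[of "_ * _" "_ $ i"] trilinear_monomial[symmetric] by blast
  qed simp
  then show ?thesis by blast
qed

text \<open>The first two assumptions say that the linear forms with coefficients \<open>m\<close>
  and \<open>n\<close> have product zero as a polynomial; the second form is not zero.\<close>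

lemma symmetric_product_zero:
  fixes m n :: "3 \<Rightarrow> 'k::field"
  assumes "\<And>i j. m i * n j + m j * n i = 0" "\<And>i. m i * n i = 0" "n l \<noteq> 0"
  shows "m k = 0"
proof -
  have "m l = 0" using assms(2)[of l] assms(3) by simp
  then show ?thesis using assms(1)[of k l] assms(3) by simp
qed

lemma quadratic_zero_if_cofinite:
  fixes a b c :: "'k::alg_closed_field"
  assumes "\<And>t. t \<noteq> 0 \<Longrightarrow> a + b * t + c * t^2 = 0"
  shows "a = 0" "b = 0" "c = 0"
proof -
  have "[:a, b, c:] = 0"
    by (rule poly_eq_0_if_cofinite[of "{0}"])
      (use assms in \<open>auto simp: algebra_simps power2_eq_square\<close>)
  then show "a = 0" "b = 0" "c = 0" by auto
qed

context hessian_curve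
begin

text \<open>A conic has degree at most 2 in \<open>Z\<close>, so it is already reduced modulo the
  cubic and cannot vanish on it.\<close>

lemma conic_zero:
  fixes c :: "3 \<Rightarrow> 3 \<Rightarrow> 'a alg_closure"
  assumes "\<And>x. x \<noteq> 0 \<Longrightarrow> F x = 0 \<Longrightarrow> (\<Sum>i\<in>UNIV. \<Sum>j\<in>UNIV. c i j * (x$i * x$j)) = 0"
  shows "c i i = 0" "c i j + c j i = 0"
proof -
  have z: "(c 1 1 * x^2 + (c 1 2 + c 2 1) * x * y + c 2 2 * y^2) = 0"
      "(c 1 3 + c 3 1) * x + (c 2 3 + c 3 2) * y = 0" "c 3 3 = 0" for x y
    by (rule reduced_zero[of "\<lambda>x y. c 1 1 * x^2 + (c 1 2 + c 2 1) * x * y + c 2 2 * y^2"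
          "\<lambda>x y. (c 1 3 + c 3 1) * x + (c 2 3 + c 3 2) * y" "\<lambda>x y. c 3 3" "{}"];
        ((simp add: sep_poly_intros; fail) | (use assms in \<open>simp add: sum_3 algebra_simps power2_eq_square\<close>)))+
  have d: "c 1 1 = 0" "c 2 2 = 0" "c 3 3 = 0" "c 1 3 + c 3 1 = 0" "c 2 3 + c 3 2 = 0"
    using z(1)[of 1 0] z(1)[of 0 1] z(2)[of 1 0] z(2)[of 0 1] z(3) by simp_all
  then have "c 1 2 + c 2 1 = 0" using z(1)[of 1 1] by simp
  with d show "c i i = 0" "c i j + c j i = 0"
    using exhaust_3[of i] exhaust_3[of j] by (auto simp: add.commute)
qed

text \<open>Bilinear forms whose ratio is the projection \<open>law0 : law1\<close>: comparing the two as linear forms in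
  the first argument, the coefficients of \<open>q1\<close> are proportional to those of \<open>law1\<close>, which are squares.
  Hence they are equal up to one constant.\<close>

lemma law_unique:
  fixes g0 g1 :: "3 \<Rightarrow> 3 \<Rightarrow> 3 \<Rightarrow> 'a"
  assumes eq: "\<And>x y. x \<noteq> 0 \<Longrightarrow> F x = 0 \<Longrightarrow> y \<noteq> 0 \<Longrightarrow> F y = 0 \<Longrightarrow>
      trilinear g0 x y * law1 x y = trilinear g1 x y * law0 x y"
  shows "\<exists>c. \<forall>x y. y \<noteq> 0 \<longrightarrow> F y = 0 \<longrightarrow>
      trilinear g0 x y = to_ac c * law0 x y \<and> trilinear g1 x y = to_ac c * law1 x y"
proof -
  define q0 where "q0 y i = (\<Sum>j\<in>UNIV. \<Sum>k\<in>UNIV. to_ac (g0 i j k) * (y$j * y$k))" for y i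
  define q1 where "q1 y i = (\<Sum>j\<in>UNIV. \<Sum>k\<in>UNIV. to_ac (g1 i j k) * (y$j * y$k))" for y i
  define l0 :: "'a alg_closure ^ 3 \<Rightarrow> 3 \<Rightarrow> 'a alg_closure"
    where "l0 y i = (if i = 1 then y$2 * y$3 else if i = 2 then y$1 * y$2 else y$1 * y$3)" for y i
  define l1 :: "'a alg_closure ^ 3 \<Rightarrow> 3 \<Rightarrow> 'a alg_closure"
    where "l1 y i = (if i = 1 then y$1^2 else if i = 2 then y$3^2 else y$2^2)" for y i
  have sums: "trilinear g0 x y = (\<Sum>i\<in>UNIV. x$i * q0 y i)" "trilinear g1 x y = (\<Sum>i\<in>UNIV. x$i * q1 y i)"
    "law0 x y = (\<Sum>i\<in>UNIV. x$i * l0 y i)" "law1 x y = (\<Sum>i\<in>UNIV. x$i * l1 y i)" for x y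
    by (simp_all add: trilinear_def q0_def q1_def law0_def law1_def l0_def l1_def sum_3 mult.assoc)
  have l_simps: "l0 y 1 = y$2 * y$3" "l0 y 2 = y$1 * y$2" "l0 y 3 = y$1 * y$3"
      "l1 y 1 = y$1^2" "l1 y 2 = y$3^2" "l1 y 3 = y$2^2" for y
    by (simp_all add: l0_def l1_def)
  have coeffs: "q0 y i * l1 y i = q1 y i * l0 y i"
      "q0 y i * l1 y j + q0 y j * l1 y i = q1 y i * l0 y j + q1 y j * l0 y i"
    if y: "y \<noteq> 0" "F y = 0" for y i j
  proof -
    have "(\<Sum>i\<in>UNIV. \<Sum>j\<in>UNIV. (q0 y i * l1 y j - q1 y i * l0 y j) * (x$i * x$j)) = 0"
      if "x \<noteq> 0" "F x = 0" for x
      using eq[OF that y] unfolding sums sum_3 by Groebner_Basis.algebra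
    from conic_zero[of "\<lambda>i j. q0 y i * l1 y j - q1 y i * l0 y j", OF this]
    show "q0 y i * l1 y i = q1 y i * l0 y i"
      "q0 y i * l1 y j + q0 y j * l1 y i = q1 y i * l0 y j + q1 y j * l0 y i"
      by (simp_all add: algebra_simps)
  qed
  have cross: "q1 y (nx i) * l1 y (nx (nx i)) = q1 y (nx (nx i)) * l1 y (nx i)"
    if y: "y \<noteq> 0" "F y = 0" for y i
  proof -
    \<comment> \<open>The cross products of \<open>q1\<close> and of \<open>l0\<close> with
      \<open>l1\<close>. On the line \<open>l1 \<cdot> x = 0\<close>, parametrized by the cross
      products of \<open>l1\<close> with vectors \<open>z\<close>, the forms \<open>q1\<close> and
      \<open>l0\<close> become \<open>M \<cdot> z\<close> and \<open>N \<cdot> z\<close>; by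
      \<open>coeffs\<close> their product is zero.\<close>
    define M where "M i = q1 y (nx i) * l1 y (nx (nx i)) - q1 y (nx (nx i)) * l1 y (nx i)" for i
    define N where "N i = l0 y (nx i) * l1 y (nx (nx i)) - l0 y (nx (nx i)) * l1 y (nx i)" for i
    note c = coeffs[OF y]
    have "M i * N j + M j * N i = 0 \<and> M i * N i = 0" for i j
    proof -
      note c = c(1)[of 1] c(1)[of 2] c(1)[of 3] c(2)[of 1 2] c(2)[of 2 3] c(2)[of 1 3]
      have "M 1 * N 1 = 0" "M 2 * N 2 = 0" "M 3 * N 3 = 0" "M 1 * N 2 + M 2 * N 1 = 0"
        "M 2 * N 3 + M 3 * N 2 = 0" "M 1 * N 3 + M 3 * N 1 = 0"
        using c unfolding M_def N_def nx_simps by Groebner_Basis.algebra+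
      then show ?thesis using exhaust_3[of i] exhaust_3[of j] by (auto simp: add.commute)
    qed
    moreover have "\<exists>l. N l \<noteq> 0"
    proof -
      \<comment> \<open>Up to the order of its entries \<open>N\<close> is the tangential vector, so
        \<open>l0\<close> and \<open>l1\<close> are not parallel at any point of the curve.\<close>
      have "tangential y \<noteq> 0" using tangential_nonzero y by blast
      then obtain l where "tangential y $ l \<noteq> 0" by (auto simp: vec_eq_iff)
      moreover have "N 1 = tangential y $ 1" "N 3 = tangential y $ 2" "N 2 = tangential y $ 3"
        unfolding N_def tangential_nth nx_simps l_simps by Groebner_Basis.algebra+
      ultimately show ?thesis using exhaust_3[of l] by metis
    qed
    ultimately have "M i = 0" using symmetric_product_zero[of M N] by blast
    then show ?thesis by (simp add: M_def)
  qed
  define a where "a j k = to_ac (g1 1 j k)" for j k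
  define b where "b j k = to_ac (g1 3 j k)" for j k
  \<comment> \<open>The components 1 and 3 are compared because \<open>l1\<close> is
    \<open>X^2\<close> and \<open>Y^2\<close> there: the relation has degree at most 2 in
    \<open>Z\<close>, and \<open>reduced_zero\<close> applies without reduction.\<close>
  have red: "(a 1 1 * x^2 + (a 1 2 + a 2 1) * x * y + a 2 2 * y^2) * y^2 -
      (b 1 1 * x^2 + (b 1 2 + b 2 1) * x * y + b 2 2 * y^2) * x^2 = 0"
    "((a 1 3 + a 3 1) * x + (a 2 3 + a 3 2) * y) * y^2 - ((b 1 3 + b 3 1) * x + (b 2 3 + b 3 2) * y) * x^2 = 0"
    "a 3 3 * y^2 - b 3 3 * x^2 = 0" for x y
  proof -
    let ?r0 = "\<lambda>x y. (a 1 1 * x^2 + (a 1 2 + a 2 1) * x * y + a 2 2 * y^2) * y^2 -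
      (b 1 1 * x^2 + (b 1 2 + b 2 1) * x * y + b 2 2 * y^2) * x^2"
    let ?r1 = "\<lambda>x y. ((a 1 3 + a 3 1) * x + (a 2 3 + a 3 2) * y) * y^2 -
      ((b 1 3 + b 3 1) * x + (b 2 3 + b 3 2) * y) * x^2"
    let ?r2 = "\<lambda>x y. a 3 3 * y^2 - b 3 3 * x^2"
    have sep: "sep_poly ?r0" "sep_poly ?r1" "sep_poly ?r2"
      by (simp_all add: sep_poly_intros)
    have z: "?r0 (y$1) (y$2) + ?r1 (y$1) (y$2) * y$3 + ?r2 (y$1) (y$2) * y$3^2 = 0"
      if y: "y \<noteq> 0" "F y = 0" "pt y \<notin> {}" for y
    proof -
      have "q1 y 3 * y$1^2 = q1 y 1 * y$2^2"
        using cross[OF y(1,2), of 2] by (simp add: l_simps)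
      then show ?thesis
        unfolding q1_def sum_3 a_def b_def by Groebner_Basis.algebra
    qed
    show "?r0 x y = 0" by (rule reduced_zero(1)[OF sep finite.emptyI z])
    show "?r1 x y = 0" by (rule reduced_zero(2)[OF sep finite.emptyI z])
    show "?r2 x y = 0" by (rule reduced_zero(3)[OF sep finite.emptyI z])
  qed
  have ab3: "a 3 3 = 0" "b 3 3 = 0" "a 2 3 + a 3 2 = 0" "b 1 3 + b 3 1 = 0" "a 2 2 = 0" "b 1 1 = 0"
    using red(3)[of 0 1] red(3)[of 1 0] red(2)[of 0 1] red(2)[of 1 0] red(1)[of 0 1] red(1)[of 1 0]
    by (simp_all del: minus_add_distrib)
  \<comment> \<open>The identity at \<open>(1, t)\<close> with a factor \<open>t\<close> removed;
    \<open>0 * t^2\<close> gives it the shape of \<open>quadratic_zero_if_cofinite\<close>.\<close>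
  have "- (b 2 3 + b 3 2) + (a 1 3 + a 3 1) * t + 0 * t^2 = 0" if "t \<noteq> 0" for t
  proof -
    have "t * (- (b 2 3 + b 3 2) + (a 1 3 + a 3 1) * t + 0 * t^2) = 0"
      using red(2)[of 1 t, unfolded power_one mult_1_right] ab3 by Groebner_Basis.algebra
    then show ?thesis using that by simp
  qed
  from quadratic_zero_if_cofinite[OF this] have ab13: "b 2 3 + b 3 2 = 0" "a 1 3 + a 3 1 = 0"
    by (simp_all del: minus_add_distrib)
  have "- (b 1 2 + b 2 1) + (a 1 1 - b 2 2) * t + (a 1 2 + a 2 1) * t^2 = 0" if "t \<noteq> 0" for t
  proof -
    have "t * (- (b 1 2 + b 2 1) + (a 1 1 - b 2 2) * t + (a 1 2 + a 2 1) * t^2) = 0"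
      using red(1)[of 1 t, unfolded power_one mult_1_right] ab3 by Groebner_Basis.algebra
    then show ?thesis using that by simp
  qed
  from quadratic_zero_if_cofinite[OF this]
  have ab12: "b 1 2 + b 2 1 = 0" "a 1 2 + a 2 1 = 0" "b 2 2 = a 1 1"
    by (simp_all del: minus_add_distrib)
  have q1_1: "q1 y 1 = a 1 1 * y$1^2" for y
    using ab3 ab13 ab12 unfolding q1_def sum_3 a_def[symmetric] by Groebner_Basis.algebra
  have q1_3: "q1 y 3 = a 1 1 * y$2^2" for y
    using ab3 ab13 ab12 unfolding q1_def sum_3 b_def[symmetric] by Groebner_Basis.algebra
  have q1: "q1 y i = a 1 1 * l1 y i" if y: "y \<noteq> 0" "F y = 0" for y i
  proof -
    have "q1 y 2 = a 1 1 * y$3^2"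
    proof (cases "y$1 = 0")
      case False
      then show ?thesis using cross[OF y, of 3] by (simp add: l_simps q1_1)
    next
      case True
      have "y$2 \<noteq> 0"
      proof
        assume "y$2 = 0"
        then have "y$3 = 0" using True y(2) by (simp add: hessian_eq_def)
        with True \<open>y$2 = 0\<close> y(1) show False by (simp add: vec_eq_iff forall_3)
      qed
      then show ?thesis using cross[OF y, of 1] by (simp add: l_simps q1_3)
    qed
    then show ?thesis using exhaust_3[of i] q1_1 q1_3 by (auto simp: l_simps)
  qed
  \<comment> \<open>With \<open>q1\<close> known, \<open>coeffs\<close> says that the form
    \<open>q0 - a 1 1 * l0\<close> times the nonzero form \<open>l1\<close> is zero.\<close>
  have q0: "q0 y i = a 1 1 * l0 y i" if y: "y \<noteq> 0" "F y = 0" for y i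
  proof -
    obtain l where l: "l1 y l \<noteq> 0"
    proof -
      obtain l where "y$l \<noteq> 0" using y(1) by (auto simp: vec_eq_iff)
      then have "l1 y 1 \<noteq> 0 \<or> l1 y 2 \<noteq> 0 \<or> l1 y 3 \<noteq> 0"
        using exhaust_3[of l] by (auto simp: l_simps)
      with that show ?thesis by blast
    qed
    have "(q0 y i - a 1 1 * l0 y i) * l1 y j + (q0 y j - a 1 1 * l0 y j) * l1 y i = 0" for i j
      using coeffs(2)[OF y, of i j] unfolding q1[OF y] by Groebner_Basis.algebra
    moreover have "(q0 y i - a 1 1 * l0 y i) * l1 y i = 0" for i
      using coeffs(1)[OF y, of i] unfolding q1[OF y] by Groebner_Basis.algebra
    ultimately have "q0 y i - a 1 1 * l0 y i = 0"
      by (rule symmetric_product_zero[where n = "l1 y"]) (rule l)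
    then show ?thesis by simp
  qed
  show ?thesis
  \<comment> \<open>The constant has to lie in the base field: it is the coefficient of
    \<open>X1 * X2^2\<close> in the second polynomial.\<close>
  proof (intro exI[of _ "g1 1 1 1"] allI impI)
    fix x y assume y: "y \<noteq> 0" "F y = 0"
    show "trilinear g0 x y = to_ac (g1 1 1 1) * law0 x y \<and> trilinear g1 x y = to_ac (g1 1 1 1) * law1 x y"
      unfolding sums q0[OF y] q1[OF y] a_def by (simp add: sum_distrib_left mult_ac)
  qed
qed

end

section \<open>From one projection to all six addition laws\<close>

context hessian_curve
begin

lemma hessian_add_commute: "hessian_add 1 d P Q = hessian_add 1 d Q P"
  by (simp add: hessian_add_def third_point_commute)

lemma F_rot: "F (rot i x) = F x"
  using exhaust_3[of i] by (auto simp: hessian_eq_def rot_def algebra_simps)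

text \<open>Rotations 2 and 3 are inverse to each other, so \<open>partner i\<close> also indexes
  the inverse rotation.\<close>

lemma rot_rot: "rot i (rot (partner i) x) = x"
  using exhaust_3[of i] by (auto simp: vec_eq_iff rot_def partner_def)

lemma rot_rot': "rot (partner i) (rot i x) = x"
  using exhaust_3[of i] by (auto simp: vec_eq_iff rot_def partner_def)

lemma rot_nonzero:
  assumes "x \<noteq> 0"
  shows "rot i x \<noteq> 0"
proof
  assume "rot i x = 0"
  then have "x = rot (partner i) 0" using rot_rot'[of i x] by simp
  then show False using assms by (auto simp: rot_def vec_eq_iff split: if_splits)
qed

lemma trilinear_rot:
  fixes g :: "3 \<Rightarrow> 3 \<Rightarrow> 3 \<Rightarrow> 'a"
  shows "\<exists>g'. \<forall>x y. trilinear g (rot j x) y = trilinear g' x y"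
proof -
  consider "j = 1" | "j = 2" | "j = 3" using exhaust_3 by blast
  then show ?thesis
  proof cases
    case 1
    have "rot 1 x = x" for x :: "'a alg_closure ^ 3" by (simp add: vec_eq_iff rot_def)
    then show ?thesis unfolding 1 by (intro exI[of _ g]) simp
  next
    case 2
    have "trilinear g (rot 2 x) y = trilinear (\<lambda>i. g (nx (nx i))) x y" for x y
      unfolding trilinear_def sum_3[of "\<lambda>i. _ $ i * _ i"] by (simp add: rot_nth algebra_simps)
    then show ?thesis unfolding 2 by blast
  next
    case 3
    have "trilinear g (rot 3 x) y = trilinear (\<lambda>i. g (nx i)) x y" for x y
      unfolding trilinear_def sum_3[of "\<lambda>i. _ $ i * _ i"] by (simp add: rot_nth algebra_simps)
    then show ?thesis unfolding 3 by blast
  qed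
qed

lemma law_unique_rot:
  fixes g0 g1 :: "3 \<Rightarrow> 3 \<Rightarrow> 3 \<Rightarrow> 'a"
  assumes eq: "\<And>x y. x \<noteq> 0 \<Longrightarrow> F x = 0 \<Longrightarrow> y \<noteq> 0 \<Longrightarrow> F y = 0 \<Longrightarrow>
      trilinear g0 x y * law1 (rot i x) y = trilinear g1 x y * law0 (rot i x) y"
  shows "\<exists>c. \<forall>x y. y \<noteq> 0 \<longrightarrow> F y = 0 \<longrightarrow>
      trilinear g0 x y = to_ac c * law0 (rot i x) y \<and> trilinear g1 x y = to_ac c * law1 (rot i x) y"
proof -
  obtain h0 where h0: "\<And>x y. trilinear g0 (rot (partner i) x) y = trilinear h0 x y"
    using trilinear_rot[of g0 "partner i"] by blast
  obtain h1 where h1: "\<And>x y. trilinear g1 (rot (partner i) x) y = trilinear h1 x y"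
    using trilinear_rot[of g1 "partner i"] by blast
  have "trilinear h0 x y * law1 x y = trilinear h1 x y * law0 x y"
    if "x \<noteq> 0" "F x = 0" "y \<noteq> 0" "F y = 0" for x y
    using eq[of "rot (partner i) x" y] that rot_nonzero[OF that(1)]
    by (simp add: h0 h1 rot_rot F_rot)
  from law_unique[of h0 h1, OF this]
  obtain c where c: "\<And>x y. y \<noteq> 0 \<Longrightarrow> F y = 0 \<Longrightarrow>
      trilinear h0 x y = to_ac c * law0 x y \<and> trilinear h1 x y = to_ac c * law1 x y"
    by blast
  have "trilinear g0 x y = trilinear h0 (rot i x) y" "trilinear g1 x y = trilinear h1 (rot i x) y" for x y
    unfolding h0[symmetric] h1[symmetric] rot_rot' by simp_all
  then show ?thesis using c by metis
qed

text \<open>The linear algebra common to both bidegrees. \<open>L0\<close>, \<open>L1\<close> stand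
  for the values of the law, and \<open>unique\<close> supplies proportionality on the curve, which
  becomes congruence modulo \<open>null_pairs\<close>.\<close>

lemma alp_one_dim:
  fixes p0 p1 :: "'a bipoly" and L0 L1 \<phi> m n
  defines "p \<equiv> (p0, p1)"
  assumes bi: "biform m n p0" "biform m n p1"
    and ev: "\<And>x y. bieval p0 x y = L0 x y" "\<And>x y. bieval p1 x y = L1 x y"
    and law: "\<And>x y. x \<noteq> 0 \<Longrightarrow> F x = 0 \<Longrightarrow> y \<noteq> 0 \<Longrightarrow> F y = 0 \<Longrightarrow> L0 x y \<noteq> 0 \<or> L1 x y \<noteq> 0 \<Longrightarrow>
      pt (vector [L0 x y, L1 x y]) = \<phi> (hessian_add 1 d (pt x) (pt y))"
    and nz: "\<exists>x y. x \<noteq> 0 \<and> F x = 0 \<and> y \<noteq> 0 \<and> F y = 0 \<and> L0 x y \<noteq> 0"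
    and unique: "\<And>q0 q1 :: 'a bipoly. biform m n q0 \<Longrightarrow> biform m n q1 \<Longrightarrow>
      (\<And>x y. x \<noteq> 0 \<Longrightarrow> F x = 0 \<Longrightarrow> y \<noteq> 0 \<Longrightarrow> F y = 0 \<Longrightarrow> bieval q0 x y * L1 x y = bieval q1 x y * L0 x y) \<Longrightarrow>
      \<exists>c. \<forall>x y. x \<noteq> 0 \<longrightarrow> F x = 0 \<longrightarrow> y \<noteq> 0 \<longrightarrow> F y = 0 \<longrightarrow>
        bieval q0 x y = to_ac c * L0 x y \<and> bieval q1 x y = to_ac c * L1 x y"
  shows "p \<in> addition_law_projections (hessian 1 d) (hessian_add 1 d) \<phi> m n \<and>
    alp_spanned_by (hessian 1 d) (hessian_add 1 d) \<phi> m n {p} \<and>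
    alp_dim (hessian 1 d) (hessian_add 1 d) \<phi> m n 1"
proof -
  let ?C = "hessian 1 d"
  have ideal: "in_ideal ?C q \<longleftrightarrow> (\<forall>x y. x \<noteq> 0 \<longrightarrow> F x = 0 \<longrightarrow> y \<noteq> 0 \<longrightarrow> F y = 0 \<longrightarrow> bieval q x y = 0)" for q
    unfolding in_ideal_def using mem_hessian by meson
  have alp: "(q0, q1) \<in> addition_law_projections ?C (hessian_add 1 d) \<phi> m n \<longleftrightarrow>
      biform m n q0 \<and> biform m n q1 \<and> \<not> (in_ideal ?C q0 \<and> in_ideal ?C q1) \<and>
      (\<forall>x y. x \<noteq> 0 \<longrightarrow> F x = 0 \<longrightarrow> y \<noteq> 0 \<longrightarrow> F y = 0 \<longrightarrow> bieval q0 x y \<noteq> 0 \<or> bieval q1 x y \<noteq> 0 \<longrightarrow>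
        pt (vector [bieval q0 x y, bieval q1 x y]) = \<phi> (hessian_add 1 d (pt x) (pt y)))" for q0 q1
    unfolding addition_law_projections_def using mem_hessian by auto
  have mem: "p \<in> addition_law_projections ?C (hessian_add 1 d) \<phi> m n"
    unfolding p_def alp ideal ev using bi law nz by blast
  have comb: "q - lin_comb {p} c = (fst q - Const (c p) * p0, snd q - Const (c p) * p1)" for q c
    by (simp add: lin_comb_def p_def prod_eq_iff)
  have null: "q - lin_comb {p} c \<in> null_pairs ?C m n \<longleftrightarrow>
      biform m n (fst q) \<and> biform m n (snd q) \<and>
      (\<forall>x y. x \<noteq> 0 \<longrightarrow> F x = 0 \<longrightarrow> y \<noteq> 0 \<longrightarrow> F y = 0 \<longrightarrow>
        bieval (fst q) x y = to_ac (c p) * L0 x y \<and> bieval (snd q) x y = to_ac (c p) * L1 x y)" for q c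
  proof -
    have "biform m n (fst q - Const (c p) * p0) \<longleftrightarrow> biform m n (fst q)"
      using biform_add[of m n "fst q - Const (c p) * p0" "Const (c p) * p0"]
        biform_diff[of m n "fst q" "Const (c p) * p0"] biform_Const_mult[OF bi(1)] by auto
    moreover have "biform m n (snd q - Const (c p) * p1) \<longleftrightarrow> biform m n (snd q)"
      using biform_add[of m n "snd q - Const (c p) * p1" "Const (c p) * p1"]
        biform_diff[of m n "snd q" "Const (c p) * p1"] biform_Const_mult[OF bi(2)] by auto
    ultimately show ?thesis
      unfolding comb null_pairs_def by (auto simp: ideal bieval_simps ev)
  qed
  have span: "alp_space ?C (hessian_add 1 d) \<phi> m n = {q. \<exists>c. q - lin_comb {p} c \<in> null_pairs ?C m n}"
  proof (intro subset_antisym subsetI)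
    fix q assume "q \<in> alp_space ?C (hessian_add 1 d) \<phi> m n"
    then consider "q \<in> null_pairs ?C m n" | "q \<in> addition_law_projections ?C (hessian_add 1 d) \<phi> m n"
      by (auto simp: alp_space_def)
    then show "q \<in> {q. \<exists>c. q - lin_comb {p} c \<in> null_pairs ?C m n}"
    proof cases
      case 1
      have "q - lin_comb {p} (\<lambda>_. 0) = q"
        unfolding comb by (simp add: Const_def)
      with 1 have "q - lin_comb {p} (\<lambda>_. 0) \<in> null_pairs ?C m n" by (simp only:)
      then show ?thesis by blast
    next
      case 2
      obtain q0 q1 where q: "q = (q0, q1)" by fastforce
      have q2: "biform m n q0" "biform m n q1"
        and qlaw: "\<And>x y. x \<noteq> 0 \<Longrightarrow> F x = 0 \<Longrightarrow> y \<noteq> 0 \<Longrightarrow> F y = 0 \<Longrightarrow> bieval q0 x y \<noteq> 0 \<or> bieval q1 x y \<noteq> 0 \<Longrightarrow>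
        pt (vector [bieval q0 x y, bieval q1 x y]) = \<phi> (hessian_add 1 d (pt x) (pt y))"
        using 2 unfolding q alp by blast+
      \<comment> \<open>Where one of the pairs is zero both products vanish; elsewhere the pairs
        represent the same point of the line.\<close>
      have "bieval q0 x y * L1 x y = bieval q1 x y * L0 x y"
        if xy: "x \<noteq> 0" "F x = 0" "y \<noteq> 0" "F y = 0" for x y
      proof (cases "(bieval q0 x y \<noteq> 0 \<or> bieval q1 x y \<noteq> 0) \<and> (L0 x y \<noteq> 0 \<or> L1 x y \<noteq> 0)")
        case True
        then have "pt (vector [bieval q0 x y, bieval q1 x y]) = (pt (vector [L0 x y, L1 x y]) :: 'a line)"
          using qlaw[OF xy] law[OF xy] by simp
        then show ?thesis using True by (subst (asm) pt_vector2_eq) auto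
      qed auto
      from unique[OF q2 this] obtain c where "\<forall>x y. x \<noteq> 0 \<longrightarrow> F x = 0 \<longrightarrow> y \<noteq> 0 \<longrightarrow> F y = 0 \<longrightarrow>
        bieval q0 x y = to_ac c * L0 x y \<and> bieval q1 x y = to_ac c * L1 x y" by blast
      then have "q - lin_comb {p} (\<lambda>_. c) \<in> null_pairs ?C m n"
        unfolding null using q2 by (simp add: q)
      then show ?thesis by blast
    qed
  next
    fix q assume "q \<in> {q. \<exists>c. q - lin_comb {p} c \<in> null_pairs ?C m n}"
    then obtain c where c: "q - lin_comb {p} c \<in> null_pairs ?C m n" by blast
    obtain q0 q1 where q: "q = (q0, q1)" by fastforce
    note n = c[unfolded null q fst_conv snd_conv]
    show "q \<in> alp_space ?C (hessian_add 1 d) \<phi> m n"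
    proof (cases "c p = 0")
      case True
      then have "q \<in> null_pairs ?C m n"
        using n by (simp add: q null_pairs_def ideal)
      then show ?thesis by (simp add: alp_space_def)
    next
      case False
      have "q \<in> addition_law_projections ?C (hessian_add 1 d) \<phi> m n"
        unfolding q alp ideal
      proof (intro conjI allI impI)
        show "biform m n q0" "biform m n q1" using n by simp_all
        show "\<not> ((\<forall>x y. x \<noteq> 0 \<longrightarrow> F x = 0 \<longrightarrow> y \<noteq> 0 \<longrightarrow> F y = 0 \<longrightarrow> bieval q0 x y = 0) \<and>
          (\<forall>x y. x \<noteq> 0 \<longrightarrow> F x = 0 \<longrightarrow> y \<noteq> 0 \<longrightarrow> F y = 0 \<longrightarrow> bieval q1 x y = 0))"
        proof -
          obtain x y where xy: "x \<noteq> 0" "F x = 0" "y \<noteq> 0" "F y = 0" "L0 x y \<noteq> 0" using nz by blast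
          then have "bieval q0 x y \<noteq> 0" using n False by simp
          with xy show ?thesis by blast
        qed
        fix x y assume xy: "x \<noteq> 0" "F x = 0" "y \<noteq> 0" "F y = 0" and ne: "bieval q0 x y \<noteq> 0 \<or> bieval q1 x y \<noteq> 0"
        have e: "bieval q0 x y = to_ac (c p) * L0 x y" "bieval q1 x y = to_ac (c p) * L1 x y"
          using n xy by simp_all
        then have L: "L0 x y \<noteq> 0 \<or> L1 x y \<noteq> 0" using ne by auto
        have "pt (vector [bieval q0 x y, bieval q1 x y]) = (pt (vector [L0 x y, L1 x y]) :: 'a line)"
          using ne L by (subst pt_vector2_eq) (auto simp: e)
        then show "pt (vector [bieval q0 x y, bieval q1 x y]) = \<phi> (hessian_add 1 d (pt x) (pt y))"
          using law[OF xy L] by simp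
      qed
      then show ?thesis by (simp add: alp_space_def)
    qed
  qed
  have indep: "c p = 0" if "lin_comb {p} c \<in> null_pairs ?C m n" for c
  proof -
    obtain x y where xy: "x \<noteq> 0" "F x = 0" "y \<noteq> 0" "F y = 0" "L0 x y \<noteq> 0" using nz by blast
    have "in_ideal ?C (Const (c p) * p0)"
      using that by (simp add: null_pairs_def lin_comb_def p_def)
    then have "bieval (Const (c p) * p0) x y = 0"
      unfolding ideal using xy by blast
    then have "to_ac (c p) * L0 x y = 0" by (simp add: bieval_simps ev)
    with xy show ?thesis by simp
  qed
  have spanned: "alp_spanned_by ?C (hessian_add 1 d) \<phi> m n {p}"
    unfolding alp_spanned_by_def using span by simp
  moreover have "alp_dim ?C (hessian_add 1 d) \<phi> m n 1"
    unfolding alp_dim_def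
  proof (intro exI[of _ "{p}"] conjI allI impI)
    show "{p} \<subseteq> alp_space ?C (hessian_add 1 d) \<phi> m n" using mem by (simp add: alp_space_def)
  qed (use spanned indep in auto)
  ultimately show ?thesis using mem by blast
qed

lemma law_nonzero: "\<exists>x y. x \<noteq> 0 \<and> F x = 0 \<and> y \<noteq> 0 \<and> F y = 0 \<and> law0 (rot i x) y \<noteq> 0"
  by (intro exI[of _ "flex i"] exI[of _ "flex 3"]) (simp add: flex_nonzero F_flex law0_flex)

lemma alp_1_2:
  assumes bi: "biform 1 2 p0" "biform 1 2 p1"
    and ev: "\<And>x y. bieval p0 x y = law0 (rot i x) y" "\<And>x y. bieval p1 x y = law1 (rot i x) y"
  shows "(p0, p1) \<in> addition_law_projections (hessian 1 d) (hessian_add 1 d) (phi i) 1 2 \<and>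
    alp_spanned_by (hessian 1 d) (hessian_add 1 d) (phi i) 1 2 {(p0, p1)} \<and>
    alp_dim (hessian 1 d) (hessian_add 1 d) (phi i) 1 2 1"
proof (rule alp_one_dim[OF bi ev addition_law law_nonzero])
  fix q0 q1 :: "'a bipoly"
  assume q: "biform 1 2 q0" "biform 1 2 q1"
    and eq: "\<And>x y. x \<noteq> 0 \<Longrightarrow> F x = 0 \<Longrightarrow> y \<noteq> 0 \<Longrightarrow> F y = 0 \<Longrightarrow>
      bieval q0 x y * law1 (rot i x) y = bieval q1 x y * law0 (rot i x) y"
  obtain g0 where g0: "\<And>x y. bieval q0 x y = trilinear g0 x y" using biform_1_2[OF q(1)] by blast
  obtain g1 where g1: "\<And>x y. bieval q1 x y = trilinear g1 x y" using biform_1_2[OF q(2)] by blast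
  show "\<exists>c. \<forall>x y. x \<noteq> 0 \<longrightarrow> F x = 0 \<longrightarrow> y \<noteq> 0 \<longrightarrow> F y = 0 \<longrightarrow>
      bieval q0 x y = to_ac c * law0 (rot i x) y \<and> bieval q1 x y = to_ac c * law1 (rot i x) y"
    using law_unique_rot[of g0 i g1] eq unfolding g0 g1 by blast
qed

text \<open>By commutativity of the group law these are the laws of bidegree \<open>(1, 2)\<close>
  with the two arguments exchanged.\<close>

lemma alp_2_1:
  assumes bi: "biform 2 1 p0" "biform 2 1 p1"
    and ev: "\<And>x y. bieval p0 x y = law0 (rot i y) x" "\<And>x y. bieval p1 x y = law1 (rot i y) x"
  shows "(p0, p1) \<in> addition_law_projections (hessian 1 d) (hessian_add 1 d) (phi i) 2 1 \<and>
    alp_spanned_by (hessian 1 d) (hessian_add 1 d) (phi i) 2 1 {(p0, p1)} \<and>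
    alp_dim (hessian 1 d) (hessian_add 1 d) (phi i) 2 1 1"
proof (rule alp_one_dim[OF bi ev])
  fix x y assume "x \<noteq> 0" "F x = 0" "y \<noteq> 0" "F y = 0" "law0 (rot i y) x \<noteq> 0 \<or> law1 (rot i y) x \<noteq> 0"
  then show "pt (vector [law0 (rot i y) x, law1 (rot i y) x]) = phi i (hessian_add 1 d (pt x) (pt y))"
    using addition_law[of y x i] hessian_add_commute[of "pt x" "pt y"] by simp
next
  show "\<exists>x y. x \<noteq> 0 \<and> F x = 0 \<and> y \<noteq> 0 \<and> F y = 0 \<and> law0 (rot i y) x \<noteq> 0"
    using law_nonzero[of i] by blast
next
  fix q0 q1 :: "'a bipoly"
  assume q: "biform 2 1 q0" "biform 2 1 q1"
    and eq: "\<And>x y. x \<noteq> 0 \<Longrightarrow> F x = 0 \<Longrightarrow> y \<noteq> 0 \<Longrightarrow> F y = 0 \<Longrightarrow>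
      bieval q0 x y * law1 (rot i y) x = bieval q1 x y * law0 (rot i y) x"
  obtain g0 where g0: "\<And>x y. bieval q0 x y = trilinear g0 y x" using biform_2_1[OF q(1)] by blast
  obtain g1 where g1: "\<And>x y. bieval q1 x y = trilinear g1 y x" using biform_2_1[OF q(2)] by blast
  have "trilinear g0 y x * law1 (rot i y) x = trilinear g1 y x * law0 (rot i y) x"
    if "y \<noteq> 0" "F y = 0" "x \<noteq> 0" "F x = 0" for x y
    using eq[OF that(3,4,1,2)] unfolding g0 g1 .
  from law_unique_rot[of g0 i g1, OF this]
  obtain c where "\<forall>y x. x \<noteq> 0 \<longrightarrow> F x = 0 \<longrightarrow>
      trilinear g0 y x = to_ac c * law0 (rot i y) x \<and> trilinear g1 y x = to_ac c * law1 (rot i y) x" ..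
  then show "\<exists>c. \<forall>x y. x \<noteq> 0 \<longrightarrow> F x = 0 \<longrightarrow> y \<noteq> 0 \<longrightarrow> F y = 0 \<longrightarrow>
      bieval q0 x y = to_ac c * law0 (rot i y) x \<and> bieval q1 x y = to_ac c * law1 (rot i y) x"
    unfolding g0 g1 by (intro exI[of _ c]) simp
qed

end

lemma biform_monomials:
  "biform 1 2 (Var (Inl i) * Var (Inr j) * Var (Inr k))"
  "biform 1 2 (Var (Inl i) * Var (Inr j) ^ 2)"
  "biform 2 1 (Var (Inl i) * Var (Inl j) * Var (Inr k))"
  "biform 2 1 (Var (Inl i) ^ 2 * Var (Inr k))"
  using biform_mult[OF biform_mult[OF biform_Inl[of i] biform_Inr[of j]] biform_Inr[of k]]
    biform_mult[OF biform_mult[OF biform_Inl[of i] biform_Inr[of j]] biform_Inr[of j]]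
    biform_mult[OF biform_mult[OF biform_Inl[of i] biform_Inl[of j]] biform_Inr[of k]]
    biform_mult[OF biform_mult[OF biform_Inl[of i] biform_Inl[of i]] biform_Inr[of k]]
  by (simp_all add: power2_eq_square mult.assoc numeral_2_eq_2)

section \<open>The degree of the projections\<close>

definition ev :: "'a::field poly \<Rightarrow> 'a alg_closure \<Rightarrow> 'a alg_closure" where
  "ev p = poly (map_poly to_ac p)"

lemma ev_0 [simp]: "ev 0 u = 0"
  by (simp add: ev_def)

lemma ev_pCons [simp]: "ev (pCons c p) u = to_ac c + u * ev p u"
  by (simp add: ev_def map_poly_pCons)

lemma ev_add [simp]: "ev (p + q) u = ev p u + ev q u"
proof -
  have "map_poly to_ac (p + q) = map_poly to_ac p + map_poly to_ac q"
    by (intro poly_eqI) (simp add: coeff_map_poly)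
  then show ?thesis by (simp add: ev_def)
qed

lemma ev_diff [simp]: "ev (p - q) u = ev p u - ev q u"
  using ev_add[of "p - q" q u] by (simp add: algebra_simps)

lemma ev_smult [simp]: "ev (Polynomial.smult c p) u = to_ac c * ev p u"
  by (induction p) (simp_all add: algebra_simps)

lemma ev_mult [simp]: "ev (p * q) u = ev p u * ev q u"
  by (induction p) (simp_all add: algebra_simps)

lemma ev_1 [simp]: "ev 1 u = 1"
  by (simp add: one_pCons)

lemma ev_power [simp]: "ev (p ^ n) u = ev p u ^ n"
  by (induction n) simp_all

lemma finite_roots_ev: "p \<noteq> 0 \<Longrightarrow> finite {u. ev p u = 0}"
  unfolding ev_def by (intro poly_roots_finite) (simp add: map_poly_eq_0_iff)

lemma root_imp_factor:
  assumes "poly p r = (0 :: 'k::field)"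
  obtains q where "p = [:- r, 1:] * q"
  using assms unfolding poly_eq_0_iff_dvd by (elim dvdE)

text \<open>Irreducibility of the cubic: \<open>t\<^sup>2 - t + (1 + u\<^sup>3) / (d u + 3)\<close> has no root in \<open>k(u)\<close>. For \<open>d \<noteq> 0\<close>
  this is seen at the simple pole \<open>u = -3/d\<close>, for \<open>d = 0\<close> at infinity.\<close>

lemma norm_form_anisotropic:
  fixes A B :: "'a::field poly"
  assumes three: "(3 :: 'a) \<noteq> 0" and d3: "d ^ 3 \<noteq> 27"
    and eq: "[:3, d:] * (A^2 + A * B) + B^2 * [:1, 0, 0, 1:] = 0"
  shows "A = 0 \<and> B = 0"
proof (cases "d = 0")
  case True
  let ?deg = "Polynomial.degree :: 'a poly \<Rightarrow> nat"
  have "[:3, d:] * (A^2 + A * B) = Polynomial.smult 3 (A * (A + B))"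
    using True by (simp add: power2_eq_square distrib_left Polynomial.smult_add_right)
  then have eq': "Polynomial.smult 3 (A * (A + B)) = - (B^2 * [:1, 0, 0, 1:])"
    using eq unfolding eq_neg_iff_add_eq_0 by (simp only:)
  show ?thesis
  proof (cases "B = 0")
    case True
    then show ?thesis using eq' three by simp
  next
    case False
    then have nz: "B^2 \<noteq> 0" "[:1, 0, 0, 1 :: 'a:] \<noteq> 0" by simp_all
    then have "- (B^2 * [:1, 0, 0, 1:]) \<noteq> 0" by (simp only: neg_equal_0_iff_equal mult_eq_0_iff) simp
    then have "A * (A + B) \<noteq> 0" using eq' by (metis Polynomial.smult_0_right)
    then have AB: "A \<noteq> 0" "A + B \<noteq> 0" by auto
    \<comment> \<open>Behavior at infinity. If \<open>deg A \<le> deg B\<close>, the left side is at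
      most \<open>2 deg B\<close>; otherwise it is \<open>2 deg A\<close>, which is even.\<close>
    have deg: "?deg A + ?deg (A + B) = 2 * ?deg B + 3"
    proof -
      have "?deg (Polynomial.smult 3 (A * (A + B))) = ?deg A + ?deg (A + B)"
        using AB three by (simp add: degree_mult_eq)
      moreover have "?deg (- (B^2 * [:1, 0, 0, 1:])) = 2 * ?deg B + 3"
        using False unfolding Polynomial.degree_minus degree_mult_eq[OF nz] by (simp add: degree_power_eq)
      ultimately show ?thesis using eq' by simp
    qed
    show ?thesis
    proof (cases "?deg A \<le> ?deg B")
      case True
      then have "?deg (A + B) \<le> ?deg B" by (rule degree_add_le) simp
      with True deg show ?thesis by simp
    next
      case False
      then have "?deg (A + B) = ?deg A" by (intro degree_add_eq_left) simp
      with deg have "2 * ?deg A = 2 * ?deg B + 3" by simp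
      then show ?thesis by presburger
    qed
  qed
next
  case False
  define r where "r = - 3 / d"
  define M where "M = [:- r, 1:]"
  have L: "[:3, d:] = Polynomial.smult d M" using False by (simp add: M_def r_def)
  have C: "poly [:1, 0, 0, 1:] r \<noteq> 0"
  proof
    assume "poly [:1, 0, 0, 1:] r = 0"
    then have "1 + r^3 = 0" by (simp add: power3_eq_cube mult.assoc)
    then have "d^3 + (d * r)^3 = 0" by Groebner_Basis.algebra
    moreover have "d * r = - 3" using False by (simp add: r_def)
    ultimately show False using d3 by simp
  qed
  have M0: "M \<noteq> 0" "poly M r = 0" by (simp_all add: M_def)
  define Cp where "Cp = [:1, 0, 0, 1 :: 'a:]"
  have "poly Cp r \<noteq> 0" using C unfolding Cp_def .
  note C = this
  have "Polynomial.smult d M * (A^2 + A * B) + B^2 * Cp = 0"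
    using eq unfolding L Cp_def .
  then show ?thesis
  \<comment> \<open>Infinite descent at the pole \<open>r\<close>: evaluation there shows that
    \<open>M\<close> divides \<open>B\<close>, then \<open>A\<close>, and the quotients satisfy the
    same equation.\<close>
  proof (induction "Polynomial.degree B" arbitrary: A B rule: less_induct)
    case less
    have "poly (Polynomial.smult d M * (A^2 + A * B) + B^2 * Cp) r = 0"
      using less.prems by simp
    then have "(poly B r)^2 * poly Cp r = 0"
      using M0 by simp
    then have "poly B r = 0" using C by (metis mult_eq_0_iff power_eq_0_iff)
    then obtain B' where B': "B = M * B'" unfolding M_def by (rule root_imp_factor)
    have "M * (Polynomial.smult d (A^2 + A * B) + M * B'^2 * Cp) = 0"
      using less.prems by (simp add: B' power2_eq_square algebra_simps Polynomial.smult_add_right)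
    then have 2: "Polynomial.smult d (A^2 + A * B) + M * B'^2 * Cp = 0" using M0 by simp
    then have "poly (Polynomial.smult d (A^2 + A * B) + M * B'^2 * Cp) r = 0" by simp
    then have "d * (poly A r)^2 = 0" using M0 \<open>poly B r = 0\<close> by simp
    then have "poly A r = 0" using False by simp
    then obtain A' where A': "A = M * A'" unfolding M_def by (rule root_imp_factor)
    have "M * (Polynomial.smult d M * (A'^2 + A' * B') + B'^2 * Cp) = 0"
      using 2 by (simp add: A' B' power2_eq_square algebra_simps Polynomial.smult_add_right)
    then have 3: "Polynomial.smult d M * (A'^2 + A' * B') + B'^2 * Cp = 0" using M0 by simp
    show ?case
    proof (cases "B' = 0")
      case True
      then have "Polynomial.smult d M * A'^2 = 0" using 3 by simp
      then show ?thesis using M0 False A' B' True by simp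
    next
      case B'0: False
      have "Polynomial.degree B' < Polynomial.degree B"
        using B'0 M0 unfolding B' by (subst degree_mult_eq) (auto simp: M_def)
      from less.hyps[OF this 3] show ?thesis using A' B' by simp
    qed
  qed
qed

definition param :: "3 \<Rightarrow> 'k::field \<Rightarrow> 'k \<Rightarrow> 'k ^ 3" where
  "param i u e = (\<chi> j. if j = i then u else if j = nx i then e else 1 - e)"

lemma param_nth [simp]: "param i u e $ i = u" "param i u e $ nx i = e" "param i u e $ nx (nx i) = 1 - e"
  by (simp_all add: param_def)

lemma param_nonzero: "param i u e \<noteq> 0"
  using param_nth[of i u e] by (metis diff_0_right one_neq_zero zero_index)

section \<open>The affine chart and the finite set outside it\<close>

context hessian_curve
begin

text \<open>On \<open>Y + Z = 1\<close> the curve is \<open>(d u + 3) (e - e\<^sup>2) = 1 + u\<^sup>3\<close> with \<open>u = X\<close> and \<open>e = Y\<close>.\<close>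

definition on_chart :: "'a alg_closure \<Rightarrow> 'a alg_closure \<Rightarrow> bool" where
  "on_chart u e \<longleftrightarrow> (\<delta> * u + 3) * (e - e^2) = 1 + u^3"

lemma F_param: "F (param i u e) = (1 + u^3) - (\<delta> * u + 3) * (e - e^2)"
  unfolding F_nx[of _ i] param_nth by Groebner_Basis.algebra

lemma on_chart_iff: "on_chart u e \<longleftrightarrow> F (param i u e) = 0"
  by (auto simp: on_chart_def F_param)

text \<open>A zero of \<open>\<delta> u + 3\<close> on the chart would satisfy
  \<open>u^3 = -1\<close> and \<open>\<delta> u = -3\<close>, whence
  \<open>\<delta>^3 = 27\<close>.\<close>

lemma on_chart_denom:
  assumes "on_chart u e"
  shows "\<delta> * u + 3 \<noteq> 0"
proof
  assume 0: "\<delta> * u + 3 = 0"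
  then have "1 + u^3 = 0" using assms by (simp add: on_chart_def)
  then have "\<delta>^3 + (\<delta> * u)^3 = 0" by Groebner_Basis.algebra
  moreover have "\<delta> * u = - 3" using 0 by (simp add: eq_neg_iff_add_eq_0)
  ultimately show False using d3_ac by simp
qed

lemma on_chart_ex:
  assumes "\<delta> * u + 3 \<noteq> 0"
  obtains e where "on_chart u e"
proof -
  obtain r s where rs: "\<And>z. z^2 + (- 1) * z + (1 + u^3) / (\<delta> * u + 3) = (z - r) * (z - s)"
    by (rule monic_quadratic_splits[of "- 1" "(1 + u^3) / (\<delta> * u + 3)"]) (rule that)
  have "(1 + u^3) / (\<delta> * u + 3) = r - r^2"
    using rs[of r] by (simp add: algebra_simps)
  then have "on_chart u r"
    using assms by (simp add: on_chart_def field_simps)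
  then show ?thesis by (rule that)
qed

lemma on_chart_swap: "on_chart u e \<Longrightarrow> on_chart u (1 - e)"
  unfolding on_chart_def by (simp add: algebra_simps power2_eq_square)

lemma finite_denom: "finite {u. \<delta> * u + 3 = 0}"
proof -
  have "[:3, \<delta>:] \<noteq> 0" by simp
  then have "finite {u. poly [:3, \<delta>:] u = 0}" by (rule poly_roots_finite)
  then show ?thesis by (simp add: algebra_simps)
qed

lemma on_chart_ex_avoiding:
  assumes "finite U"
  obtains u e where "u \<notin> U" "on_chart u e"
proof -
  have "finite (U \<union> {u. \<delta> * u + 3 = 0})" using assms finite_denom by simp
  then obtain u where u: "u \<notin> U \<union> {u. \<delta> * u + 3 = 0}"
    using ex_new_if_finite[OF infinite_alg_closed] by blast
  then obtain e where "on_chart u e" by (auto elim: on_chart_ex)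
  with u show ?thesis by (intro that) auto
qed

lemma pt_param_mem: "on_chart u e \<Longrightarrow> pt (param i u e) \<in> hessian 1 d"
  using mem_hessian[OF param_nonzero] on_chart_iff by blast

text \<open>Where the two coordinates other than \<open>i\<close> have sum 0 there are only
  \<open>flex i\<close> and the points \<open>(1 : t : -t)\<close> with
  \<open>1 + \<delta> t^2 = 0\<close>. Each excluded \<open>u\<close> has finitely many
  \<open>e\<close> above it.\<close>

lemma finite_off_chart:
  assumes U: "finite U"
  shows "finite {P \<in> hessian 1 d. \<not> (\<exists>u e. u \<notin> U \<and> on_chart u e \<and> P = pt (param i u e))}"
    (is "finite ?S")
proof -
  define T where "T = {t. 1 + \<delta> * t^2 = 0}"
  define v where "v t = (\<chi> j. if j = i then 1 else if j = nx i then t else - t)" for t :: "'a alg_closure"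
  have v: "v t $ i = 1" "v t $ nx i = t" "v t $ nx (nx i) = - t" for t by (simp_all add: v_def)
  have "finite T"
  proof -
    have "[:1, 0, \<delta>:] \<noteq> 0" by simp
    then have "finite {t. poly [:1, 0, \<delta>:] t = 0}" by (rule poly_roots_finite)
    then show ?thesis by (simp add: T_def algebra_simps power2_eq_square)
  qed
  moreover have "finite {e. on_chart u e}" for u
  proof (cases "\<delta> * u + 3 = 0")
    case True
    then have "{e. on_chart u e} = {}" using on_chart_denom by blast
    then show ?thesis by simp
  next
    case False
    then have "[:1 + u^3, - (\<delta> * u + 3), \<delta> * u + 3:] \<noteq> 0" by simp
    then have "finite {e. poly [:1 + u^3, - (\<delta> * u + 3), \<delta> * u + 3:] e = 0}"
      by (rule poly_roots_finite)
    moreover have "{e. on_chart u e} \<subseteq> {e. poly [:1 + u^3, - (\<delta> * u + 3), \<delta> * u + 3:] e = 0}"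
    proof clarify
      fix e assume "on_chart u e"
      then have "1 + u^3 = (\<delta> * u + 3) * (e - e^2)" by (simp add: on_chart_def)
      then show "poly [:1 + u^3, - (\<delta> * u + 3), \<delta> * u + 3:] e = 0"
        unfolding poly_pCons poly_0 mult_zero_right add_0_right by Groebner_Basis.algebra
    qed
    ultimately show ?thesis by (rule finite_subset[rotated])
  qed
  ultimately have "finite ({pt (flex i)} \<union> (\<lambda>t. pt (v t)) ` T \<union> (\<Union>u\<in>U. (\<lambda>e. pt (param i u e)) ` {e. on_chart u e}))"
    using U by simp
  moreover have "?S \<subseteq> {pt (flex i)} \<union> (\<lambda>t. pt (v t)) ` T \<union> (\<Union>u\<in>U. (\<lambda>e. pt (param i u e)) ` {e. on_chart u e})"
  proof
    fix P assume P: "P \<in> ?S"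
    obtain x where x: "x \<noteq> 0" "P = pt x" by (rule pt_cases)
    then have Fx: "F x = 0" using P mem_hessian by blast
    define w where "w = x$(nx i) + x$(nx (nx i))"
    show "P \<in> {pt (flex i)} \<union> (\<lambda>t. pt (v t)) ` T \<union> (\<Union>u\<in>U. (\<lambda>e. pt (param i u e)) ` {e. on_chart u e})"
    proof (cases "w = 0")
      case False
      have eq: "x $ j = w * param i (x$i / w) (x$(nx i) / w) $ j" for j
        using exhaust_nx[of j i] False by (auto simp: w_def right_diff_distrib)
      then have pt: "P = pt (param i (x$i / w) (x$(nx i) / w))"
        unfolding x(2) by (intro pt_scale[OF False param_nonzero, symmetric])
      then have "on_chart (x$i / w) (x$(nx i) / w)"
        using P mem_hessian[OF param_nonzero] on_chart_iff by blast
      with pt P show ?thesis by blast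
    next
      case True
      then have z: "x$(nx (nx i)) = - x$(nx i)"
        by (simp add: w_def eq_neg_iff_add_eq_0 add.commute)
      show ?thesis
      proof (cases "x$i = 0")
        case True
        then have "x $ j = - x$(nx i) * flex i $ j" for j
          using exhaust_nx[of j i] z by auto
        moreover have "- x$(nx i) \<noteq> 0"
          using x(1) True z vec_eq_0_nx[of x i] by auto
        ultimately have "P = pt (flex i)"
          unfolding x(2) by (intro pt_scale[OF _ flex_nonzero, symmetric])
        then show ?thesis by simp
      next
        case False
        define t where "t = x$(nx i) / x$i"
        have t: "x$(nx i) = x$i * t" using False by (simp add: t_def)
        have "x $ j = x$i * v t $ j" for j
          using exhaust_nx[of j i] z t by (auto simp: v)
        moreover have "v t \<noteq> 0" using v(1)[of t] by auto
        ultimately have "P = pt (v t)"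
          unfolding x(2) using False by (intro pt_scale[symmetric])
        moreover have "x$i^3 * (1 + \<delta> * t^2) = 0"
          using Fx unfolding F_nx[of _ i] z t by Groebner_Basis.algebra
        then have "t \<in> T" using False by (simp add: T_def)
        ultimately show ?thesis by blast
      qed
    qed
  qed
  ultimately show ?thesis by (rule finite_subset[rotated])
qed

lemma fun_eqI:
  assumes "finite U" "\<And>u e. u \<notin> U \<Longrightarrow> on_chart u e \<Longrightarrow> h (pt (param i u e)) = h' (pt (param i u e))"
  shows "fun_eq (hessian 1 d) h h'"
  unfolding fun_eq_def
  by (rule finite_subset[OF _ finite_off_chart[OF assms(1), of i]]) (use assms(2) in blast)

lemma phi_param: "phi i (pt (param i u e)) = pt (vector [u, - 1])"
  by (simp add: phi_pt[OF param_nonzero])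

end

text \<open>The sign of the second variable compensates that \<open>phi i\<close> maps
  \<open>param i u e\<close> to \<open>(u : -1)\<close>.\<close>

definition homogenize :: "nat \<Rightarrow> 'a::field poly \<Rightarrow> (2, 'a) mpoly" where
  "homogenize n p = (\<Sum>j\<le>n. Const (Polynomial.coeff p j) * Var 1 ^ j * (- Var 2) ^ (n - j))"

lemma form_homogenize: "form n (homogenize n p)"
  unfolding homogenize_def
proof (rule form_sum)
  fix j assume "j \<in> {..n}"
  have "form (0 + j * 1 + (n - j) * 1) (Const (Polynomial.coeff p j) * Var (1::2) ^ j * (- Var 2) ^ (n - j))"
    by (intro form_mult form_Const form_power form_Var form_uminus)
  then show "form n (Const (Polynomial.coeff p j) * Var (1::2) ^ j * (- Var 2) ^ (n - j))"
    using \<open>j \<in> {..n}\<close> by simp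
qed

lemma peval_homogenize:
  assumes "Polynomial.degree p \<le> n"
  shows "peval (homogenize n p) (($) (vector [u, - 1])) = ev p u"
proof -
  have "peval (homogenize n p) (($) (vector [u, - 1])) = (\<Sum>j\<le>n. to_ac (Polynomial.coeff p j) * u ^ j)"
    by (simp add: homogenize_def peval_simps)
  also have "\<dots> = (\<Sum>j\<le>Polynomial.degree p. to_ac (Polynomial.coeff p j) * u ^ j)"
    using assms by (intro sum.mono_neutral_right) (auto simp: coeff_eq_0)
  also have "\<dots> = ev p u"
  proof -
    have "Polynomial.degree (map_poly to_ac p) = Polynomial.degree p"
      by (intro degree_map_poly) simp
    then show ?thesis by (simp add: ev_def poly_altdef coeff_map_poly)
  qed
  finally show ?thesis .
qed

lemma finite_zeros_binary_form:
  fixes g :: "(2, 'a::field) mpoly"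
  assumes g: "form n g" and nz: "peval g (($) y) \<noteq> 0"
  shows "finite {u. peval g (($) (vector [u, - 1])) = 0}"
proof -
  have sep: "sep_poly (\<lambda>a b. peval p (($) (vector [a, b])))" for p :: "(2, 'a) mpoly"
  proof (rule peval_closure[where S = "\<lambda>f. sep_poly (\<lambda>a b. f (($) (vector [a, b] :: 'a alg_closure ^ 2)))"])
    show "sep_poly (\<lambda>a b. vector [a, b] $ v)" for v :: 2
      using exhaust_2[of v] by (auto simp: sep_poly_fst sep_poly_snd)
  qed (simp_all add: sep_poly_const sep_poly_add sep_poly_mult)
  obtain p where p: "\<And>u. peval g (($) (vector [u, - 1])) = poly p u"
    using sep[of g] unfolding sep_poly_def by blast
  have "p \<noteq> 0"
  proof
    assume "p = 0"
    \<comment> \<open>Homogeneity spreads the vanishing from \<open>b = -1\<close> to all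
      \<open>b \<noteq> 0\<close>; \<open>sep_poly_zero\<close> then adds
      \<open>b = 0\<close>.\<close>
    have "peval g (($) (vector [a, b])) = 0" if "b \<noteq> 0" for a b
    proof -
      have "vector [a, b] $ v = - b * vector [- a / b, - 1] $ v" for v :: 2
        using that exhaust_2[of v] by auto
      then have "(($) (vector [a, b] :: 'a alg_closure ^ 2)) = (\<lambda>v. - b * vector [- a / b, - 1] $ v)"
        by (rule ext)
      then have "peval g (($) (vector [a, b])) = (- b) ^ n * peval g (($) (vector [- a / b, - 1]))"
        using peval_form_scale[OF g, of "- b" "($) (vector [- a / b, - 1])"] by simp
      then show ?thesis using p \<open>p = 0\<close> by simp
    qed
    then have "peval g (($) (vector [a, b])) = 0" for a b
      by (intro sep_poly_zero[OF sep[of g]]) (auto intro: exI[of _ "{}"])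
    moreover have "vector [y$1, y$2] = y" by (simp add: vec_eq_iff forall_2)
    ultimately show False using nz by metis
  qed
  then show ?thesis unfolding p by (rule poly_roots_finite)
qed

section \<open>The pulled back field and the basis \<open>1\<close>, \<open>e\<close>\<close>

context hessian_curve
begin

lemma pullback_ex:
  fixes R S :: "'a poly"
  assumes "S \<noteq> 0"
  obtains c where "c \<in> pullback_field (hessian 1 d) (phi i)"
    "\<And>u e. on_chart u e \<Longrightarrow> ev S u \<noteq> 0 \<Longrightarrow> c (pt (param i u e)) = ev R u / ev S u"
proof -
  \<comment> \<open>A common degree makes the quotient independent of the chosen coordinate
    vector.\<close>
  define n where "n = max (Polynomial.degree R) (Polynomial.degree S)"
  define f where "f = homogenize n R"
  define g where "g = homogenize n S"
  have f: "form n f" "\<And>u. peval f (($) (vector [u, - 1])) = ev R u"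
    by (simp_all add: f_def form_homogenize peval_homogenize n_def)
  have g: "form n g" "\<And>u. peval g (($) (vector [u, - 1])) = ev S u"
    by (simp_all add: g_def form_homogenize peval_homogenize n_def)
  define c where "c P = peval f (($) (coords_of (phi i P))) / peval g (($) (coords_of (phi i P)))" for P
  have c: "c P = peval f (($) y) / peval g (($) y)" if y: "y \<noteq> 0" "phi i P = pt y" for P y
  proof -
    obtain k where k: "k \<noteq> 0" "\<And>i. coords_of (pt y) $ i = k * y $ i"
      by (rule coords_of_pt[OF y(1)]) (rule that)
    then have "($) (coords_of (pt y)) = (\<lambda>i. k * y $ i)" by blast
    then show ?thesis
      unfolding c_def y(2) using k(1) by (simp add: peval_form_scale[OF f(1)] peval_form_scale[OF g(1)])
  qed
  have nz: "(vector [u, - 1] :: 'a alg_closure ^ 2) \<noteq> 0" for u by (simp add: vector2_eq_0)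
  show ?thesis
  proof
    obtain u e where u: "u \<notin> {u. ev S u = 0}" "on_chart u e"
      by (rule on_chart_ex_avoiding[OF finite_roots_ev[OF assms]]) (rule that)
    have wit: "\<exists>P y. P \<in> hessian 1 d \<and> y \<noteq> 0 \<and> phi i P = pt y \<and> peval g (($) y) \<noteq> 0"
      using u by (intro exI[of _ "pt (param i u e)"] exI[of _ "vector [u, - 1]"])
        (simp add: pt_param_mem phi_param nz g(2))
    show "c \<in> pullback_field (hessian 1 d) (phi i)"
      unfolding pullback_field_def
      by (rule CollectI, rule exI[of _ n], rule exI[of _ f], rule exI[of _ g])
        (use f(1) g(1) wit c in auto)
  next
    fix u e assume "on_chart u e" "ev S u \<noteq> 0"
    show "c (pt (param i u e)) = ev R u / ev S u"
      using c[OF nz phi_param] by (simp add: f(2) g(2))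
  qed
qed

text \<open>The image \<open>(u : -1)\<close> of a chart point does not involve
  \<open>e\<close>.\<close>

lemma pullback_on_chart:
  assumes "c \<in> pullback_field (hessian 1 d) (phi i)"
  obtains U k where "finite U" "\<And>u e. u \<notin> U \<Longrightarrow> on_chart u e \<Longrightarrow> c (pt (param i u e)) = k u"
proof -
  obtain n and f g :: "(2, 'a) mpoly" where fg: "form n g"
    and wit: "\<exists>P y. P \<in> hessian 1 d \<and> y \<noteq> 0 \<and> phi i P = pt y \<and> peval g (($) y) \<noteq> 0"
    and c: "\<And>P y. P \<in> hessian 1 d \<Longrightarrow> y \<noteq> 0 \<Longrightarrow> phi i P = pt y \<Longrightarrow> peval g (($) y) \<noteq> 0 \<Longrightarrow>
        c P = peval f (($) y) / peval g (($) y)"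
    using assms unfolding pullback_field_def by blast
  from wit obtain y where y: "peval g (($) y) \<noteq> 0" by blast
  show ?thesis
  proof
    show "finite {u. peval g (($) (vector [u, - 1])) = 0}"
      by (rule finite_zeros_binary_form[OF fg y])
    fix u e assume "u \<notin> {u. peval g (($) (vector [u, - 1])) = 0}" "on_chart u e"
    then show "c (pt (param i u e)) = peval f (($) (vector [u, - 1])) / peval g (($) (vector [u, - 1]))"
      by (intro c pt_param_mem phi_param) (auto simp: vector2_eq_0)
  qed
qed

text \<open>Denominator and numerator in the chart equation \<open>e - e^2 = C / L\<close>.\<close>

abbreviation L :: "'a poly" where "L \<equiv> [:3, d:]"
abbreviation C :: "'a poly" where "C \<equiv> [:1, 0, 0, 1:]"

lemma ev_L: "ev L u = \<delta> * u + 3"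
  using to_ac_numeral[where ?'a = 'a, of "num.Bit1 num.One"] by (simp add: mult.commute)

lemma ev_C: "ev C u = 1 + u^3"
  by (simp add: power3_eq_cube)

text \<open>The functions of the shape \<open>(A(u) + B(u) e) / D(u)\<close> form a ring, because \<open>e\<close> is quadratic over
  \<open>k(u)\<close>.\<close>

definition two_dim :: "3 \<Rightarrow> ((3 \<Rightarrow> 'a alg_closure) \<Rightarrow> 'a alg_closure) \<Rightarrow> bool" where
  "two_dim i f \<longleftrightarrow> (\<exists>D A B. D \<noteq> 0 \<and>
     (\<forall>u e. on_chart u e \<longrightarrow> ev D u * f (($) (param i u e)) = ev A u + ev B u * e))"

lemma two_dimI:
  assumes "D \<noteq> 0" "\<And>u e. on_chart u e \<Longrightarrow> ev D u * f (($) (param i u e)) = ev A u + ev B u * e"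
  shows "two_dim i f"
  unfolding two_dim_def by (rule exI[of _ D], rule exI[of _ A], rule exI[of _ B]) (use assms in simp)

lemma two_dim_peval: "two_dim i (peval p)"
proof (rule peval_closure)
  show "two_dim i (\<lambda>x. to_ac c)" for c
    by (rule two_dimI[of 1 _ _ "[:c:]" 0]) simp_all
  show "two_dim i (\<lambda>x. x v)" for v
  proof -
    consider "v = i" | "v = nx i" | "v = nx (nx i)" using exhaust_nx by blast
    then show ?thesis
    proof cases
      case 1
      show ?thesis by (rule two_dimI[of 1 _ _ "[:0, 1:]" 0]) (simp_all add: 1)
    next
      case 2
      show ?thesis by (rule two_dimI[of 1 _ _ 0 1]) (simp_all add: 2)
    next
      case 3
      show ?thesis by (rule two_dimI[of 1 _ _ 1 "[:- 1:]"]) (simp_all add: 3)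
    qed
  qed
next
  fix f g
  assume fg: "two_dim i f" "two_dim i g"
  obtain D A B where D: "D \<noteq> 0" and f: "\<And>u e. on_chart u e \<Longrightarrow> ev D u * f (($) (param i u e)) = ev A u + ev B u * e"
    using fg(1) unfolding two_dim_def by blast
  obtain D' A' B' where D': "D' \<noteq> 0" and g: "\<And>u e. on_chart u e \<Longrightarrow> ev D' u * g (($) (param i u e)) = ev A' u + ev B' u * e"
    using fg(2) unfolding two_dim_def by blast
  show "two_dim i (\<lambda>x. f x + g x)"
  proof (rule two_dimI)
    show "D * D' \<noteq> 0" using D D' by simp
    fix u e assume "on_chart u e"
    note this = f[OF this] g[OF this]
    then show "ev (D * D') u * (f (($) (param i u e)) + g (($) (param i u e))) =
        ev (A * D' + A' * D) u + ev (B * D' + B' * D) u * e"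
      unfolding ev_mult ev_add by Groebner_Basis.algebra
  qed
  show "two_dim i (\<lambda>x. f x * g x)"
  proof (rule two_dimI)
    have "L \<noteq> 0" using three by simp
    then show "L * (D * D') \<noteq> 0" using D D' by (simp only: mult_eq_0_iff) simp
    fix u e assume on: "on_chart u e"
    \<comment> \<open>The factor \<open>L\<close> in the denominator of the product clears this
      replacement of \<open>e^2\<close>.\<close>
    have "ev L u * e^2 = ev L u * e - ev C u"
      using on unfolding ev_L ev_C on_chart_def by Groebner_Basis.algebra
    note this = f[OF on] g[OF on] this
    then show "ev (L * (D * D')) u * (f (($) (param i u e)) * g (($) (param i u e))) =
        ev (L * (A * A') - B * B' * C) u + ev (L * (A * B' + A' * B + B * B')) u * e"
      unfolding ev_mult ev_add ev_diff by Groebner_Basis.algebra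
  qed
qed

text \<open>The coordinate \<open>e\<close> of the chart as a function on the whole curve.\<close>

definition eta :: "3 \<Rightarrow> 'a plane \<Rightarrow> 'a alg_closure" where
  "eta i P = (let x = coords_of P in x$(nx i) / (x$(nx i) + x$(nx (nx i))))"

lemma eta_pt:
  assumes "x \<noteq> 0"
  shows "eta i (pt x) = x$(nx i) / (x$(nx i) + x$(nx (nx i)))"
proof -
  obtain c where c: "c \<noteq> 0" "\<And>i. coords_of (pt x) $ i = c * x$i"
    by (rule coords_of_pt[OF assms]) (rule that)
  then show ?thesis by (simp add: eta_def Let_def flip: distrib_left)
qed

lemma eta_param: "eta i (pt (param i u e)) = e"
  by (simp add: eta_pt[OF param_nonzero])

lemma eta_mem: "eta i \<in> function_field (hessian 1 d)"
proof -
  obtain u e where "on_chart u e"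
    by (rule on_chart_ex_avoiding[of "{}"]) auto
  then have "\<exists>x. x \<noteq> 0 \<and> pt x \<in> hessian 1 d \<and> peval (Var (nx i) + Var (nx (nx i)) :: (3, 'a) mpoly) (($) x) \<noteq> 0"
    by (intro exI[of _ "param i u e"]) (simp add: param_nonzero pt_param_mem peval_simps)
  moreover have "form 1 (Var (nx i) + Var (nx (nx i)) :: (3, 'a) mpoly)" "form 1 (Var (nx i) :: (3, 'a) mpoly)"
    by (simp_all only: form_add form_Var)
  ultimately show ?thesis
    unfolding function_field_def
    by (intro CollectI exI[of _ 1] exI[of _ "Var (nx i)"] exI[of _ "Var (nx i) + Var (nx (nx i))"])
      (auto simp: peval_simps eta_pt)
qed

lemma one_mem: "(\<lambda>P. 1) \<in> function_field (hessian 1 d)"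
proof -
  have "\<exists>x. x \<noteq> 0 \<and> pt x \<in> hessian 1 d \<and> peval (1 :: (3, 'a) mpoly) (($) x) \<noteq> 0"
    using mem_hessian[OF flex_nonzero] F_flex by (intro exI[of _ "flex 1"]) (simp add: flex_nonzero peval_one)
  then show ?thesis
    unfolding function_field_def
    by (intro CollectI exI[of _ 0] exI[of _ 1]) (auto simp: peval_one form_one)
qed

text \<open>To write \<open>f / g\<close> in the basis, numerator and denominator are multiplied by
  the conjugate of \<open>g\<close> under \<open>e \<mapsto> 1 - e\<close>, which makes the
  denominator a polynomial in \<open>u\<close>.\<close>

lemma generating:
  assumes "h \<in> function_field (hessian 1 d)"
  shows "\<exists>c0\<in>pullback_field (hessian 1 d) (phi i). \<exists>c1\<in>pullback_field (hessian 1 d) (phi i).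
    fun_eq (hessian 1 d) h (\<lambda>P. c0 P + c1 P * eta i P)"
proof -
  obtain n and f g :: "(3, 'a) mpoly" and x0 where fg: "form n f" "form n g"
    and x0: "x0 \<noteq> 0" "pt x0 \<in> hessian 1 d" "peval g (($) x0) \<noteq> 0"
    and h: "\<And>x. x \<noteq> 0 \<Longrightarrow> pt x \<in> hessian 1 d \<Longrightarrow> peval g (($) x) \<noteq> 0 \<Longrightarrow>
        h (pt x) = peval f (($) x) / peval g (($) x)"
    using assms unfolding function_field_def by blast
  obtain Df Af Bf where Df: "Df \<noteq> 0"
    and f: "\<And>u e. on_chart u e \<Longrightarrow> ev Df u * peval f (($) (param i u e)) = ev Af u + ev Bf u * e"
    using two_dim_peval[of i f] unfolding two_dim_def by blast
  obtain D A B where D: "D \<noteq> 0"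
    and g: "\<And>u e. on_chart u e \<Longrightarrow> ev D u * peval g (($) (param i u e)) = ev A u + ev B u * e"
    using two_dim_peval[of i g] unfolding two_dim_def by blast
  \<comment> \<open>\<open>L\<close> times the norm \<open>(A + B e) (A + B (1 - e))\<close>. If it
    is zero, so are \<open>A\<close> and \<open>B\<close>, and \<open>g\<close> vanishes on the
    whole curve.\<close>
  define N where "N = L * (A^2 + A * B) + B^2 * C"
  have "N \<noteq> 0"
  proof
    assume "N = 0"
    then have AB: "A = 0" "B = 0"
      using norm_form_anisotropic[OF three d3] unfolding N_def by blast+
    have "peval g (($) x0) = 0"
    proof (rule form_zero_if_cofinite[OF finite_off_chart[OF finite_roots_ev[OF D], of i]])
      fix x assume x: "x \<noteq> 0" "F x = 0" "pt x \<notin> {P \<in> hessian 1 d. \<not> (\<exists>u e. u \<notin> {u. ev D u = 0} \<and> on_chart u e \<and> P = pt (param i u e))}"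
      then obtain u e where u: "ev D u \<noteq> 0" "on_chart u e" "pt x = pt (param i u e)"
        using mem_hessian by blast
      then have "peval g (($) (param i u e)) = 0" using g AB by fastforce
      moreover obtain k where "\<And>j. x $ j = k * param i u e $ j"
        using u(3) pt_eq_iff[OF param_nonzero x(1)] by metis
      then have "($) x = (\<lambda>j. k * param i u e $ j)" by blast
      ultimately show "peval g (($) x) = 0" by (simp add: peval_form_scale[OF fg(2)])
    next
      show "F x0 = 0" using x0 mem_hessian by blast
    qed
    with x0(3) show False by simp
  qed
  \<comment> \<open>\<open>C0 + C1 e\<close> is \<open>L (Af + Bf e) (A + B - B e)\<close> with
    \<open>L e^2\<close> replaced by \<open>L e - C\<close>.\<close>
  define C0 where "C0 = L * Af * (A + B) + Bf * B * C"
  define C1 where "C1 = L * (Bf * (A + B) - Af * B - Bf * B)"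
  have DN: "Df * N \<noteq> 0" using Df \<open>N \<noteq> 0\<close> by simp
  obtain c0 where c0: "c0 \<in> pullback_field (hessian 1 d) (phi i)"
    "\<And>u e. on_chart u e \<Longrightarrow> ev (Df * N) u \<noteq> 0 \<Longrightarrow> c0 (pt (param i u e)) = ev (C0 * D) u / ev (Df * N) u"
    by (rule pullback_ex[OF DN, of i "C0 * D"]) (rule that)
  obtain c1 where c1: "c1 \<in> pullback_field (hessian 1 d) (phi i)"
    "\<And>u e. on_chart u e \<Longrightarrow> ev (Df * N) u \<noteq> 0 \<Longrightarrow> c1 (pt (param i u e)) = ev (C1 * D) u / ev (Df * N) u"
    by (rule pullback_ex[OF DN, of i "C1 * D"]) (rule that)
  have "fun_eq (hessian 1 d) h (\<lambda>P. c0 P + c1 P * eta i P)"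
  proof (rule fun_eqI[where i = i])
    show "finite ({u. ev (Df * N) u = 0} \<union> {u. ev D u = 0})"
      using finite_roots_ev[OF DN] finite_roots_ev[OF D] by simp
    fix u e assume u: "u \<notin> {u. ev (Df * N) u = 0} \<union> {u. ev D u = 0}" and on: "on_chart u e"
    define a where "a = ev A u + ev B u * e"
    define b where "b = ev Af u + ev Bf u * e"
    define m where "m = ev L u * (ev A u + ev B u - ev B u * e)"
    have nz: "ev Df u \<noteq> 0" "ev N u \<noteq> 0" "ev D u \<noteq> 0" using u by auto
    have e2: "ev L u * e^2 = ev L u * e - ev C u"
      using on unfolding ev_L ev_C on_chart_def by Groebner_Basis.algebra
    have N: "ev N u = a * m"
      using e2 unfolding N_def a_def m_def ev_mult ev_add ev_power by Groebner_Basis.algebra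
    have C01: "ev C0 u + ev C1 u * e = b * m"
      using e2 unfolding C0_def C1_def b_def m_def ev_mult ev_add ev_diff by Groebner_Basis.algebra
    have am: "a \<noteq> 0" "m \<noteq> 0" using N nz by auto
    have fv: "peval f (($) (param i u e)) = b / ev Df u" and gv: "peval g (($) (param i u e)) = a / ev D u"
      using f[OF on] g[OF on] nz by (simp_all add: a_def b_def field_simps)
    have "h (pt (param i u e)) = (b / ev Df u) / (a / ev D u)"
      using h[OF param_nonzero pt_param_mem[OF on]] am nz by (simp add: fv gv)
    also have "\<dots> = (b * m) * ev D u / (ev Df u * (a * m))"
      using am nz by (simp add: field_simps)
    also have "\<dots> = c0 (pt (param i u e)) + c1 (pt (param i u e)) * e"
      using u c0(2)[OF on] c1(2)[OF on] unfolding C01[symmetric] N[symmetric]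
      by (simp add: add_divide_distrib distrib_left distrib_right mult_ac)
    finally show "h (pt (param i u e)) = c0 (pt (param i u e)) + c1 (pt (param i u e)) * eta i (pt (param i u e))"
      by (simp add: eta_param)
  qed
  with c0(1) c1(1) show ?thesis by blast
qed

text \<open>Elements of the pulled back field are invariant under \<open>e \<mapsto> 1 - e\<close>, so a relation \<open>c0 + c1 e = 0\<close>
  implies \<open>c1 (2 e - 1) = 0\<close>.\<close>

lemma independent:
  assumes c: "c0 \<in> pullback_field (hessian 1 d) (phi i)" "c1 \<in> pullback_field (hessian 1 d) (phi i)"
    and zero: "fun_eq (hessian 1 d) (\<lambda>P. c0 P + c1 P * eta i P) (\<lambda>_. 0)"
  shows "fun_eq (hessian 1 d) c0 (\<lambda>_. 0) \<and> fun_eq (hessian 1 d) c1 (\<lambda>_. 0)"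
proof -
  obtain U0 k0 where k0: "finite U0" "\<And>u e. u \<notin> U0 \<Longrightarrow> on_chart u e \<Longrightarrow> c0 (pt (param i u e)) = k0 u"
    by (rule pullback_on_chart[OF c(1)]) (rule that)
  obtain U1 k1 where k1: "finite U1" "\<And>u e. u \<notin> U1 \<Longrightarrow> on_chart u e \<Longrightarrow> c1 (pt (param i u e)) = k1 u"
    by (rule pullback_on_chart[OF c(2)]) (rule that)
  define S where "S = {P \<in> hessian 1 d. c0 P + c1 P * eta i P \<noteq> 0}"
  \<comment> \<open>All \<open>u\<close> below an exceptional point are discarded, so that the
    relation holds at both \<open>e\<close> and \<open>1 - e\<close>.\<close>
  define V where "V = (\<lambda>P. coords_of P $ i / (coords_of P $ nx i + coords_of P $ nx (nx i))) ` S"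
  \<comment> \<open>Its roots are the \<open>u\<close> with
    \<open>4 (1 + u^3) = \<delta> u + 3\<close>, as happens when \<open>e = 1 - e\<close>. The
    constant term 1 makes it nonzero in characteristic 2 too.\<close>
  define p where "p = [:1, - \<delta>, 0, 4:]"
  define U where "U = U0 \<union> U1 \<union> V \<union> {u. poly p u = 0}"
  have "finite S" using zero by (simp add: S_def fun_eq_def)
  moreover have "finite {u. poly p u = 0}" by (rule poly_roots_finite) (simp add: p_def)
  ultimately have U: "finite U" using k0 k1 by (simp add: U_def V_def)
  have "k0 u = 0 \<and> k1 u = 0" if u: "u \<notin> U" and on: "on_chart u e" for u e
  proof -
    have eq: "k0 u + k1 u * e' = 0" if "on_chart u e'" for e'
    proof -
      have "pt (param i u e') \<notin> S"
      proof
        assume S: "pt (param i u e') \<in> S"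
        obtain k where k: "k \<noteq> 0" "\<And>j. coords_of (pt (param i u e')) $ j = k * param i u e' $ j"
          by (rule coords_of_pt[OF param_nonzero]) (rule that)
        then have "u = coords_of (pt (param i u e')) $ i / (coords_of (pt (param i u e')) $ nx i + coords_of (pt (param i u e')) $ nx (nx i))"
          by (simp add: right_diff_distrib)
        then have "u \<in> V" unfolding V_def using S by blast
        with u show False by (simp add: U_def)
      qed
      then have "c0 (pt (param i u e')) + c1 (pt (param i u e')) * e' = 0"
        using pt_param_mem[OF that] by (simp add: S_def eta_param)
      then show ?thesis using k0(2)[OF _ that] k1(2)[OF _ that] u by (simp add: U_def)
    qed
    have "k1 u * (2 * e - 1) = 0"
      using eq[OF on] eq[OF on_chart_swap[OF on]] by Groebner_Basis.algebra
    moreover have "2 * e - 1 \<noteq> 0"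
    proof
      assume e: "2 * e - 1 = 0"
      then have "4 * (e - e^2) = 1" by Groebner_Basis.algebra
      then have "4 * (1 + u^3) = \<delta> * u + 3"
        using on unfolding on_chart_def by Groebner_Basis.algebra
      then have "poly p u = 0"
        by (simp add: p_def algebra_simps power3_eq_cube)
      with u show False by (simp add: U_def)
    qed
    ultimately have "k1 u = 0" by simp
    with eq[OF on] show ?thesis by simp
  qed
  then have z: "c0 (pt (param i u e)) = 0" "c1 (pt (param i u e)) = 0" if "u \<notin> U" "on_chart u e" for u e
    using that k0(2)[OF _ that(2)] k1(2)[OF _ that(2)] by (auto simp: U_def)
  show ?thesis
    by (intro conjI fun_eqI[OF U, where i = i]) (simp_all add: z)
qed

lemma phi_degree: "morphism_degree (hessian 1 d) (phi i) 2"
proof -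
  define b where "b n = (if n = 0 then \<lambda>P. 1 else eta i)" for n :: nat
  have sum: "(\<Sum>n<2. c n P * b n P) = c 0 P + c 1 P * eta i P" for c P
    by (simp add: b_def numeral_2_eq_2)
  have "b n \<in> function_field (hessian 1 d)" for n
    by (simp add: b_def one_mem eta_mem)
  moreover have "\<exists>c. (\<forall>n<2. c n \<in> pullback_field (hessian 1 d) (phi i)) \<and>
      fun_eq (hessian 1 d) h (\<lambda>P. \<Sum>n<2. c n P * b n P)"
    if h: "h \<in> function_field (hessian 1 d)" for h
  proof -
    obtain c0 c1 where "c0 \<in> pullback_field (hessian 1 d) (phi i)" "c1 \<in> pullback_field (hessian 1 d) (phi i)"
      "fun_eq (hessian 1 d) h (\<lambda>P. c0 P + c1 P * eta i P)"
      using generating[OF h, of i] by meson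
    then show ?thesis
      unfolding sum by (intro exI[of _ "\<lambda>n. if n = 0 then c0 else c1"]) simp
  qed
  moreover have "\<forall>n<2. fun_eq (hessian 1 d) (c n) (\<lambda>_. 0)"
    if "(\<forall>n<2. c n \<in> pullback_field (hessian 1 d) (phi i)) \<and>
      fun_eq (hessian 1 d) (\<lambda>P. \<Sum>n<2. c n P * b n P) (\<lambda>_. 0)" for c
    using that independent[of "c 0" i "c 1"] unfolding sum by (auto simp: less_2_cases_iff)
  ultimately show ?thesis
    unfolding morphism_degree_def by (intro exI[of _ b]) blast
qed

section \<open>The projections as morphisms\<close>

lemma phi_given_by: "given_by (hessian 1 d) (phi i) (Var i) (Var i - T0)"
  unfolding given_by_def
proof (intro allI impI)
  fix x assume x: "x \<noteq> 0 \<and> pt x \<in> hessian 1 d \<and>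
    (peval (Var i :: (3, 'a) mpoly) (($) x) \<noteq> 0 \<or> peval (Var i - T0 :: (3, 'a) mpoly) (($) x) \<noteq> 0)"
  have T: "peval (Var i - T0 :: (3, 'a) mpoly) (($) x) = - (x$(nx i) + x$(nx (nx i)))"
    using exhaust_3[of i] by (auto simp: peval_simps)
  show "phi i (pt x) = pt (vector [peval (Var i :: (3, 'a) mpoly) (($) x), peval (Var i - T0 :: (3, 'a) mpoly) (($) x)])"
    using x phi_pt[of x i] unfolding T neg_equal_0_iff_equal peval_Var neg_0_equal_iff_equal by presburger
qed

lemma phi_morphism: "morphism (hessian 1 d) (phi i)"
  unfolding morphism_def
proof (intro allI impI)
  fix x :: "'a alg_closure ^ 3" assume x: "x \<noteq> 0 \<and> pt x \<in> hessian 1 d"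
  show "\<exists>n (f :: (3, 'a) mpoly) g. form n f \<and> form n g \<and>
        (peval f (($) x) \<noteq> 0 \<or> peval g (($) x) \<noteq> 0) \<and>
        (\<forall>y. y \<noteq> 0 \<and> pt y \<in> hessian 1 d \<and> (peval f (($) y) \<noteq> 0 \<or> peval g (($) y) \<noteq> 0) \<longrightarrow>
           phi i (pt y) = pt (vector [peval f (($) y), peval g (($) y)]))"
  proof (cases "x$i \<noteq> 0 \<or> x$(nx i) + x$(nx (nx i)) \<noteq> 0")
    case True
    have "form 1 (Var i :: (3, 'a) mpoly)" "form 1 (Var i - T0 :: (3, 'a) mpoly)"
      by (intro form_Var form_diff form_add)+
    moreover have "peval (Var i :: (3, 'a) mpoly) (($) x) \<noteq> 0 \<or> peval (Var i - T0 :: (3, 'a) mpoly) (($) x) \<noteq> 0"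
    proof -
      have "peval (Var i - T0 :: (3, 'a) mpoly) (($) x) = - (x$(nx i) + x$(nx (nx i)))"
        using exhaust_3[of i] by (auto simp: peval_simps)
      then show ?thesis using True by (simp only: peval_Var neg_equal_0_iff_equal)
    qed
    ultimately show ?thesis
      using phi_given_by[of i] unfolding given_by_def
      by (intro exI[of _ 1] exI[of _ "Var i"] exI[of _ "Var i - T0"] conjI) assumption+
  next
    case False
    \<comment> \<open>The second pair of forms comes from the factorization that gives the value of
      \<open>phi\<close> at the base point; there \<open>f\<close> is \<open>3 Y^2\<close>, which is
      nonzero.\<close>
    define f :: "(3, 'a) mpoly" where "f = Var (nx i) ^ 2 - Var (nx i) * Var (nx (nx i)) + Var (nx (nx i)) ^ 2"
    define g :: "(3, 'a) mpoly" where "g = Var i ^ 2 - Const d * (Var (nx i) * Var (nx (nx i)))"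
    have f: "peval f (($) y) = y$(nx i)^2 - y$(nx i) * y$(nx (nx i)) + y$(nx (nx i))^2" for y
      by (simp add: f_def peval_simps)
    have g: "peval g (($) y) = y$i^2 - \<delta> * (y$(nx i) * y$(nx (nx i)))" for y
      by (simp add: g_def peval_simps)
    have v1: "form (1 + 1) (Var j * Var l :: (3, 'a) mpoly)" for j l by (intro form_mult form_Var)
    then have v2: "form 2 (Var j * Var l :: (3, 'a) mpoly)" for j l by (simp add: numeral_2_eq_2)
    then have v3: "form 2 (Var j ^ 2 :: (3, 'a) mpoly)" for j by (simp add: power2_eq_square)
    have "form (0 + 2) (Const d * (Var (nx i) * Var (nx (nx i))) :: (3, 'a) mpoly)"
      by (intro form_mult form_Const v2)
    then have v4: "form 2 (Const d * (Var (nx i) * Var (nx (nx i))) :: (3, 'a) mpoly)"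
      by (simp only: add_0)
    have fg: "form 2 f" "form 2 g"
      unfolding f_def g_def by (intro form_add form_diff v2 v3 v4)+
    have nz: "peval f (($) x) \<noteq> 0"
    proof -
      have z: "x$i = 0" "x$(nx (nx i)) = - x$(nx i)"
        using False by (auto simp: eq_neg_iff_add_eq_0 add.commute)
      then have "x$(nx i) \<noteq> 0" using x by (auto simp: vec_eq_0_nx[of _ i])
      moreover have "peval f (($) x) = 3 * x$(nx i)^2"
        by (simp add: f z power2_eq_square)
      ultimately show ?thesis by simp
    qed
    have eq: "phi i (pt y) = pt (vector [peval f (($) y), peval g (($) y)])"
      if y: "y \<noteq> 0 \<and> pt y \<in> hessian 1 d \<and> (peval f (($) y) \<noteq> 0 \<or> peval g (($) y) \<noteq> 0)" for y
    proof (cases "y$i \<noteq> 0 \<or> y$(nx i) + y$(nx (nx i)) \<noteq> 0")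
      case True
      have Fy: "F y = 0" using y mem_hessian by blast
      have "peval f (($) y) * (y$(nx i) + y$(nx (nx i))) + peval g (($) y) * y$i = 0"
        using Fy unfolding f g F_nx[of _ i] by Groebner_Basis.algebra
      then have "pt (vector [peval f (($) y), peval g (($) y)]) =
          (pt (vector [y$i, - (y$(nx i) + y$(nx (nx i)))]) :: 'a line)"
        using y True by (intro pt_vector2_neg) auto
      then show ?thesis using phi_pt[of y i] y True by simp
    next
      case False
      then have z: "y$i = 0" "y$(nx (nx i)) = - y$(nx i)"
        by (auto simp: eq_neg_iff_add_eq_0 add.commute)
      have "peval f (($) y) = 3 * y$(nx i)^2" "peval g (($) y) = \<delta> * y$(nx i)^2"
        by (simp_all add: f g z power2_eq_square)
      then have "pt (vector [peval f (($) y), peval g (($) y)]) = (pt (vector [3, \<delta>]) :: 'a line)"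
        using y by (subst pt_vector2_eq) auto
      then show ?thesis using phi_pt[of y i] y False by simp
    qed
    show ?thesis
      by (rule exI[of _ 2], rule exI[of _ f], rule exI[of _ g], intro conjI allI impI)
        (rule fg disjI1[OF nz] | rule eq, assumption)+
  qed
qed

end

text \<open>If \<open>d^3 = 27\<close>, then \<open>d = 3 w\<close> with \<open>w^3 = 1\<close>, and
  all partial derivatives vanish at \<open>(1 : 1 : w^2)\<close>.\<close>

lemma nonsingular_imp_cube_neq_27:
  fixes d :: "'a::field"
  assumes "(3 :: 'a) \<noteq> 0" and "nonsingular_hessian 1 d"
  shows "d ^ 3 \<noteq> 27"
proof
  assume d: "d ^ 3 = 27"
  define w where "w = to_ac (d / 3)"
  define x :: "'a alg_closure ^ 3" where "x = vector [1, 1, w^2]"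
  have w: "to_ac d = 3 * w" "w^3 = 1"
  proof -
    have "d = 3 * (d / 3)" using assms(1) by simp
    then show "to_ac d = 3 * w" unfolding w_def by (metis to_ac_mult to_ac_numeral)
    have "(d / 3)^3 = 1"
    proof -
      have "(27 :: 'a) = 3^3" by simp
      then have "(27 :: 'a) \<noteq> 0" using assms(1) by (metis power_not_zero)
      then show ?thesis using d by (simp add: power_divide)
    qed
    then show "w^3 = 1" unfolding w_def by (metis to_ac_1 to_ac_power)
  qed
  have x: "x$1 = 1" "x$2 = 1" "x$3 = w^2" by (simp_all add: x_def)
  have w4: "w^4 = w" "w^6 = 1"
    using w(2) by (simp_all add: numeral_eq_Suc)
  have "x \<noteq> 0" using x(1) by auto
  moreover have "hessian_eq 1 d x = 0"
    using w(2) w4 by (simp add: hessian_eq_def x w(1) flip: power_mult power_Suc)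
  moreover have "3 * to_ac 1 * x$1^2 - to_ac d * x$2 * x$3 = 0" "3 * x$2^2 - to_ac d * x$1 * x$3 = 0"
      "3 * x$3^2 - to_ac d * x$1 * x$2 = 0"
    using w(2) w4 by (simp_all add: x w(1) power2_eq_square power3_eq_cube mult.assoc numeral_eq_Suc)
  ultimately show False using assms(2) unfolding nonsingular_hessian_def by blast
qed

theorem theorem10:
  fixes a d :: "'a::field"
  assumes "CHAR('a) \<noteq> 3"
    and "nonsingular_hessian a d"
    and "a = 1"
  shows "\<exists>\<phi>X \<phi>Y \<phi>Z.
    (\<forall>(\<phi>, W) \<in> {(\<phi>X, X0), (\<phi>Y, Y0), (\<phi>Z, Z0)}.
       morphism (hessian a d) \<phi> \<and>
       given_by (hessian a d) \<phi> W (W - T0) \<and>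
       morphism_degree (hessian a d) \<phi> 2) \<and>
    (\<forall>(\<phi>, m, n, p) \<in> {
       (\<phi>X, 1, 2, (X1*Y2*Z2 + Y1*X2*Y2 + Z1*X2*Z2, X1*X2^2 + Y1*Z2^2 + Z1*Y2^2)),
       (\<phi>Y, 1, 2, (X1*X2*Z2 + Y1*Y2*Z2 + Z1*X2*Y2, X1*Y2^2 + Y1*X2^2 + Z1*Z2^2)),
       (\<phi>Z, 1, 2, (X1*X2*Y2 + Y1*X2*Z2 + Z1*Y2*Z2, X1*Z2^2 + Z1*X2^2 + Y1*Y2^2)),
       (\<phi>X, 2, 1, (Y1*Z1*X2 + X1*Y1*Y2 + X1*Z1*Z2, X1^2*X2 + Z1^2*Y2 + Y1^2*Z2)),
       (\<phi>Y, 2, 1, (X1*Z1*X2 + Y1*Z1*Y2 + X1*Y1*Z2, Y1^2*X2 + X1^2*Y2 + Z1^2*Z2)),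
       (\<phi>Z, 2, 1, (X1*Y1*X2 + X1*Z1*Y2 + Y1*Z1*Z2, Z1^2*X2 + Y1^2*Y2 + X1^2*Z2))}.
       p \<in> addition_law_projections (hessian a d) (hessian_add a d) \<phi> m n \<and>
       alp_spanned_by (hessian a d) (hessian_add a d) \<phi> m n {p} \<and>
       alp_dim (hessian a d) (hessian_add a d) \<phi> m n 1)"
proof -
  have three: "(3 :: 'a) \<noteq> 0"
  proof
    assume "(3 :: 'a) = 0"
    then have "of_nat 3 = (0 :: 'a)" by simp
    then have "CHAR('a) dvd 3" unfolding of_nat_eq_0_iff_char_dvd .
    moreover from this have "CHAR('a) \<le> 3" by (rule dvd_imp_le) simp
    moreover have "{..3 :: nat} = {0, 1, 2, 3}" by auto
    ultimately have "CHAR('a) \<in> {0, 1, 2, 3}" "CHAR('a) dvd 3" by blast+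
    then show False using assms(1) CHAR_not_1'[where ?'a = 'a] by auto
  qed
  interpret hessian_curve d
    using three nonsingular_imp_cube_neq_27[OF three] assms(2,3) by unfold_locales auto
  note biform = biform_add biform_monomials
  note ev = bieval_simps law0_def law1_def rot_nth nx_simps
  show ?thesis
    unfolding \<open>a = 1\<close>
  proof (rule exI[of _ "phi 1"], rule exI[of _ "phi 2"], rule exI[of _ "phi 3"], intro conjI)
    show "\<forall>(\<phi>, W) \<in> {(phi 1, X0), (phi 2, Y0), (phi 3, Z0)}.
       morphism (hessian 1 d) \<phi> \<and> given_by (hessian 1 d) \<phi> W (W - T0) \<and>
       morphism_degree (hessian 1 d) \<phi> 2"
      using phi_morphism phi_given_by phi_degree by blast
  next
    show "\<forall>(\<phi>, m, n, p) \<in> {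
       (phi 1, 1, 2, (X1*Y2*Z2 + Y1*X2*Y2 + Z1*X2*Z2, X1*X2^2 + Y1*Z2^2 + Z1*Y2^2)),
       (phi 2, 1, 2, (X1*X2*Z2 + Y1*Y2*Z2 + Z1*X2*Y2, X1*Y2^2 + Y1*X2^2 + Z1*Z2^2)),
       (phi 3, 1, 2, (X1*X2*Y2 + Y1*X2*Z2 + Z1*Y2*Z2, X1*Z2^2 + Z1*X2^2 + Y1*Y2^2)),
       (phi 1, 2, 1, (Y1*Z1*X2 + X1*Y1*Y2 + X1*Z1*Z2, X1^2*X2 + Z1^2*Y2 + Y1^2*Z2)),
       (phi 2, 2, 1, (X1*Z1*X2 + Y1*Z1*Y2 + X1*Y1*Z2, Y1^2*X2 + X1^2*Y2 + Z1^2*Z2)),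
       (phi 3, 2, 1, (X1*Y1*X2 + X1*Z1*Y2 + Y1*Z1*Z2, Z1^2*X2 + Y1^2*Y2 + X1^2*Z2))}.
       p \<in> addition_law_projections (hessian 1 d) (hessian_add 1 d) \<phi> m n \<and>
       alp_spanned_by (hessian 1 d) (hessian_add 1 d) \<phi> m n {p} \<and>
       alp_dim (hessian 1 d) (hessian_add 1 d) \<phi> m n 1"
      unfolding ball_simps prod.case
      by (intro conjI TrueI alp_1_2 alp_2_1 biform) (simp_all add: ev)
  qed
qed

end
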